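(* For every fixed positive integer $k$, the following problem can be solved in polynomial time: given a list $Q=(q_1,\ldots,q_k)$ of $k$ sequences of bins with pallet symbols and a positive integer $p$, decide whether there is a processing of $Q$ with at most $p$ stack-up places.
   Context: A bin $b$ carries a pallet symbol $\mathit{plt}(b)$ (a positive integer). In an instance, all bins are pairwise distinct, and for every pallet symbol occurring, the sequences together contain at least two bins destined for it. A subsequence of $q=(b_1,\ldots,b_n)$ is a suffix $q'=(b_j,\ldots,b_n)$ (possibly empty), and $q-q'=(b_1,\ldots,b_{j-1})$. A configuration is $(Q,Q')$ with $Q'=(q'_1,\ldots,q'_k)$, each $q'_j$ a subsequence of $q_j$. A pallet $t$ is open in $(Q,Q')$ if some bin for $t$ lies in some $q'_i$ and some bin for $t$ lies in some $q_j-q'_j$. A transformation step removes the first bin of one nonempty $q'_i$. A processing of $Q$ is a sequence of transformation steps transforming $(Q,Q)$ into the configuration with all sequences empty; it uses at most $p$ stack-up places if every configuration along it has at most $p$ open pallets. *)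

theory Defs
  imports Main
begin

text \<open>A bin is represented by its pallet symbol; bins are identified by their
  position in the sequences, so pairwise distinctness of bins is automatic.
  An instance is a list Q of k sequences (lists) of pallet symbols.\<close>

definition valid_instance :: "nat \<Rightarrow> nat list list \<Rightarrow> bool" where
  "valid_instance k Q \<longleftrightarrow> length Q = k \<and>
     (\<forall>q\<in>set Q. \<forall>t\<in>set q. 0 < t) \<and>
     (\<forall>t\<in>set (concat Q). 2 \<le> count_list (concat Q) t)"

definition is_config :: "nat list list \<Rightarrow> nat list list \<Rightarrow> bool" where
  "is_config Q Q' \<longleftrightarrow> length Q' = length Q \<and>
     (\<forall>j<length Q. \<exists>i. Q' ! j = drop i (Q ! j))"

definition removed_part :: "nat list \<Rightarrow> nat list \<Rightarrow> nat list" where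
  "removed_part q q' = take (length q - length q') q"

definition is_open :: "nat list list \<Rightarrow> nat list list \<Rightarrow> nat \<Rightarrow> bool" where
  "is_open Q Q' t \<longleftrightarrow>
     (\<exists>i<length Q. t \<in> set (Q' ! i)) \<and>
     (\<exists>j<length Q. t \<in> set (removed_part (Q ! j) (Q' ! j)))"

definition open_pallets :: "nat list list \<Rightarrow> nat list list \<Rightarrow> nat set" where
  "open_pallets Q Q' = {t. is_open Q Q' t}"

definition trans_step :: "nat list list \<Rightarrow> nat list list \<Rightarrow> bool" where
  "trans_step Q1 Q2 \<longleftrightarrow>
     (\<exists>i<length Q1. Q1 ! i \<noteq> [] \<and> Q2 = Q1[i := tl (Q1 ! i)])"

definition has_processing :: "nat list list \<Rightarrow> nat \<Rightarrow> bool" where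
  "has_processing Q p \<longleftrightarrow>
     (\<exists>cs. cs \<noteq> [] \<and> hd cs = Q \<and> last cs = map (\<lambda>_. []) Q \<and>
        (\<forall>i. Suc i < length cs \<longrightarrow> trans_step (cs ! i) (cs ! Suc i)) \<and>
        (\<forall>c\<in>set cs. card (open_pallets Q c) \<le> p))"

text \<open>Tape alphabet: 0 = blank, 1 = bit 0, 2 = bit 1, 3 = bin separator,
  4 = sequence separator.  Numbers are written in binary (least significant bit first).\<close>
fun bits :: "nat \<Rightarrow> nat list" where
  "bits n = (if n < 2 then [n + 1] else (n mod 2 + 1) # bits (n div 2))"

definition encode :: "nat list list \<Rightarrow> nat \<Rightarrow> nat list" where
  "encode Q p = bits p @ concat (map (\<lambda>q. 4 # concat (map (\<lambda>t. 3 # bits t) q)) Q)"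

datatype dir = Left | Right | Stay

record tm =
  nstates :: nat
  nsyms :: nat
  delta :: "nat \<Rightarrow> nat \<Rightarrow> nat \<times> nat \<times> dir"
  acc :: nat
  rej :: nat

text \<open>Finite machine: states are 0..<nstates (start state 0), symbols 0..<nsyms
  (0 is the blank), and the input symbols 1..4 belong to the alphabet.\<close>
definition valid_tm :: "tm \<Rightarrow> bool" where
  "valid_tm M \<longleftrightarrow> acc M < nstates M \<and> rej M < nstates M \<and> acc M \<noteq> rej M \<and>
     5 \<le> nsyms M \<and>
     (\<forall>q<nstates M. \<forall>s<nsyms M.
        fst (delta M q s) < nstates M \<and> fst (snd (delta M q s)) < nsyms M)"

type_synonym tm_config = "nat \<times> nat list \<times> nat list"
  \<comment> \<open>state, cells left of head (reversed), cells from head on\<close>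

definition tm_step :: "tm \<Rightarrow> tm_config \<Rightarrow> tm_config" where
  "tm_step M c = (case c of (q, ls, rs) \<Rightarrow>
     if q = acc M \<or> q = rej M then (q, ls, rs) else
     (let s = (case rs of [] \<Rightarrow> 0 | x # _ \<Rightarrow> x);
          (q', w, d) = delta M q s;
          rs' = w # tl rs
      in case d of
           Left \<Rightarrow> (case ls of [] \<Rightarrow> (q', [], rs') | x # ls' \<Rightarrow> (q', ls', x # rs'))
         | Right \<Rightarrow> (q', w # ls, tl rs)
         | Stay \<Rightarrow> (q', ls, rs')))"

definition tm_run :: "tm \<Rightarrow> nat \<Rightarrow> nat list \<Rightarrow> tm_config" where
  "tm_run M n w = (tm_step M ^^ n) (0, [], w)"

definition decides_within :: "tm \<Rightarrow> nat list \<Rightarrow> nat \<Rightarrow> bool \<Rightarrow> bool" where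
  "decides_within M w T b \<longleftrightarrow>
     (\<exists>n\<le>T. (fst (tm_run M n w) = acc M \<or> fst (tm_run M n w) = rej M) \<and>
             (fst (tm_run M n w) = acc M \<longleftrightarrow> b))"

end

theory Submission imports Defs begin

text \<open>The problem is reachability in a configuration graph whose nodes are \<open>k\<close>-tuples of positions in
  the input word, so it is expressed in first-order logic with a transitive closure operator on tuples,
  interpreted over the positions of the input. Equality of binary numbers, counting, doubling and the
  comparison with the binary parameter are themselves reachability statements about pairs of
  positions. Every such sentence is decided in polynomial time: the cells of a single-tape machine are
  split into bit tracks, a variable is a track holding exactly one mark, and the closure operator is
  evaluated by marking reached tuples in a table that is indexed by nested loops over all tuples. All loops
  run exactly once through the positions of the input, which makes the running time a polynomial that
  depends only on the formula.\<close>

subsection \<open>Structured programs on bit tracks\<close>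

text \<open>Three obstacles shape the formula. The bound concerns pallet symbols, whereas the logic
  counts positions; so each open pallet is represented by the first of its removed bins in the word,
  and these representatives are counted. The parameter may be exponentially larger than the number
  of positions; it is therefore read from its most significant bit on, so that every intermediate
  value is at most \<open>p\<close>, and a computation that outgrows the universe only means that
  \<open>p\<close> is too large to be exceeded. Finally, positions are finer than configurations: an
  entry moves symbol by symbol through the code of a bin. A bin counts as removed once its separator
  has been passed, so the additional tuples merely repeat a configuration. On the machine side, the
  closure is computed without a queue. With \<open>M = N ^ k\<close> tuples, a fixed number
  \<open>M * M\<close> of passes over all pairs suffices because a path needs no more edges than the
  relation has. This number is \<open>N ^ (k + k)\<close>, which is just what \<open>2 * k\<close>
  further nested loops provide.\<close>

datatype track = I0 | I1 | I2 | Origin | Flag | Limit | V nat | P nat | Tab nat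

text \<open>The number of a track is its bit position inside a tape symbol. Tracks 0 to 2 are the
  bits of the input symbols themselves, so the input needs no recoding. \<open>V\<close> is meant
  for variables, \<open>P\<close> for pointers into tables, \<open>Tab\<close> for tables.\<close>

fun tnum :: "track \<Rightarrow> nat" where
  "tnum I0 = 0"
| "tnum I1 = 1"
| "tnum I2 = 2"
| "tnum Origin = 3"
| "tnum Flag = 4"
| "tnum Limit = 5"
| "tnum (V v) = 6 + 3 * v"
| "tnum (P v) = 7 + 3 * v"
| "tnum (Tab v) = 8 + 3 * v"

lemma tnum_inject [simp]: "tnum x = tnum y \<longleftrightarrow> x = y"
  by (cases x; cases y; simp; presburger)

type_synonym tape = "track \<Rightarrow> nat set"

datatype prog = SetB track | ClrB track | MvR | MvL
  | Seq prog prog (infixr ";;" 60)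
  | IfB track prog prog
  | While bool "track list" prog

text \<open>The cost is the exact number of machine steps of the translation. A test and a jump take
  one step each: a taken then-branch pays for the jump over the else-branch, a loop round for the
  jump back. The truncated \<open>h - 1\<close> mirrors the machine at the left end of its
  tape.\<close>

inductive run :: "prog \<Rightarrow> nat \<times> tape \<Rightarrow> nat \<Rightarrow> nat \<times> tape \<Rightarrow> bool" where
  run_SetB: "run (SetB x) (h, G) 1 (h, G(x := insert h (G x)))"
| run_ClrB: "run (ClrB x) (h, G) 1 (h, G(x := G x - {h}))"
| run_MvR: "run MvR (h, G) 1 (Suc h, G)"
| run_MvL: "run MvL (h, G) 1 (h - 1, G)"
| run_Seq: "run a s t s' \<Longrightarrow> run b s' t' s'' \<Longrightarrow> run (a ;; b) s (t + t') s''"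
| run_IfT: "h \<in> G x \<Longrightarrow> run a (h, G) t s' \<Longrightarrow> run (IfB x a b) (h, G) (Suc (Suc t)) s'"
| run_IfF: "h \<notin> G x \<Longrightarrow> run b (h, G) t s' \<Longrightarrow> run (IfB x a b) (h, G) (Suc t) s'"
| run_WhileStop: "(\<exists>x\<in>set xs. h \<in> G x) \<noteq> v \<Longrightarrow> run (While v xs c) (h, G) 1 (h, G)"
| run_WhileStep: "(\<exists>x\<in>set xs. h \<in> G x) = v \<Longrightarrow> run c (h, G) t s' \<Longrightarrow>
    run (While v xs c) s' t' s'' \<Longrightarrow> run (While v xs c) (h, G) (Suc (t + Suc t')) s''"

section \<open>Translation of programs into transition tables\<close>

fun tracks :: "prog \<Rightarrow> track set" where
  "tracks (SetB x) = {x}"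
| "tracks (ClrB x) = {x}"
| "tracks MvR = {}"
| "tracks MvL = {}"
| "tracks (a ;; b) = tracks a \<union> tracks b"
| "tracks (IfB x a b) = insert x (tracks a \<union> tracks b)"
| "tracks (While v xs c) = set xs \<union> tracks c"

lemma finite_tracks: "finite (tracks c)"
  by (induction c) auto

fun psize :: "prog \<Rightarrow> nat" where
  "psize (a ;; b) = psize a + psize b"
| "psize (IfB x a b) = psize a + psize b + 2"
| "psize (While v xs c) = psize c + 2"
| "psize _ = 1"

text \<open>\<open>c\<close> occupies the states from \<open>b\<close> on, \<open>psize c\<close>
  many, and leaves through \<open>b + psize c\<close>, the entry of whatever follows. The two extra
  states of \<open>IfB\<close> and \<open>While\<close> are the test and the jump.\<close>

fun pdelta :: "prog \<Rightarrow> nat \<Rightarrow> nat \<Rightarrow> nat \<Rightarrow> nat \<times> nat \<times> dir" where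
  "pdelta (SetB x) b q s = (Suc b, set_bit (tnum x) s, Stay)"
| "pdelta (ClrB x) b q s = (Suc b, unset_bit (tnum x) s, Stay)"
| "pdelta MvR b q s = (Suc b, s, Right)"
| "pdelta MvL b q s = (Suc b, s, Left)"
| "pdelta (c1 ;; c2) b q s =
     (if q < b + psize c1 then pdelta c1 b q s else pdelta c2 (b + psize c1) q s)"
| "pdelta (IfB x c1 c2) b q s =
     (if q = b then (if bit s (tnum x) then Suc b else b + psize c1 + 2, s, Stay)
      else if q < Suc b + psize c1 then pdelta c1 (Suc b) q s
      else if q = Suc b + psize c1 then (b + psize c1 + psize c2 + 2, s, Stay)
      else pdelta c2 (b + psize c1 + 2) q s)"
| "pdelta (While v xs c) b q s =
     (if q = b then (if (\<exists>x\<in>set xs. bit s (tnum x)) = v then Suc b else b + psize c + 2, s, Stay)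
      else if q < Suc b + psize c then pdelta c (Suc b) q s
      else (b, s, Stay))"

lemma pdelta_bound:
  "b \<le> q \<Longrightarrow> q < b + psize c \<Longrightarrow> fst (pdelta c b q s) \<le> b + psize c"
proof (induction c arbitrary: b)
  case (Seq c1 c2)
  show ?case
    using Seq.IH(1)[of b] Seq.IH(2)[of "b + psize c1"] Seq.prems by auto
next
  case (IfB x c1 c2)
  show ?case
    using IfB.IH(1)[of "Suc b"] IfB.IH(2)[of "b + psize c1 + 2"] IfB.prems by auto
next
  case (While v xs c)
  show ?case
    using While.IH[of "Suc b"] While.prems by auto
qed auto

section \<open>Simulation of programs by Turing machines\<close>

definition cell :: "nat list \<Rightarrow> nat list \<Rightarrow> nat \<Rightarrow> nat" where
  "cell ls rs i = (if i < length ls then rev ls ! i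
     else if i - length ls < length rs then rs ! (i - length ls) else 0)"

text \<open>Cells are addressed absolutely, so a move of the head leaves the represented tracks
  unchanged. Only tracks below \<open>D\<close> are tied to the machine's tape.\<close>

definition rep :: "nat \<Rightarrow> nat list \<Rightarrow> nat list \<Rightarrow> nat \<times> tape \<Rightarrow> bool" where
  "rep D ls rs s \<longleftrightarrow> length ls = fst s \<and>
     (\<forall>i x. tnum x < D \<longrightarrow> (bit (cell ls rs i) (tnum x) \<longleftrightarrow> i \<in> snd s x))"

fun dmove :: "dir \<Rightarrow> nat \<Rightarrow> nat" where
  "dmove Left h = h - 1"
| "dmove Right h = Suc h"
| "dmove Stay h = h"

lemma tm_step_cell:
  assumes "q \<noteq> acc M" "q \<noteq> rej M" "delta M q (cell ls rs (length ls)) = (q', w, d)"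
  obtains ls' rs' where "tm_step M (q, ls, rs) = (q', ls', rs')"
    "length ls' = dmove d (length ls)"
    "\<And>i. cell ls' rs' i = (if i = length ls then w else cell ls rs i)"
proof -
  have sym: "(case rs of [] \<Rightarrow> 0 | x # _ \<Rightarrow> x) = cell ls rs (length ls)"
    by (cases rs) (auto simp: cell_def)
  have stay: "cell ls (w # tl rs) i = (if i = length ls then w else cell ls rs i)" for i
    by (cases rs) (auto simp: cell_def nth_Cons split: nat.splits)
  have right: "cell (w # ls) (tl rs) i = (if i = length ls then w else cell ls rs i)" for i
    unfolding stay[symmetric] by (auto simp: cell_def nth_append nth_Cons')
  show ?thesis
  proof (cases d)
    case Left
    show ?thesis
    proof (cases ls)
      case Nil
      then show ?thesis using assms Left sym stay
        by (intro that[of "[]" "w # tl rs"]) (auto simp: tm_step_def)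
    next
      case (Cons x ls')
      have "cell ls' (x # w # tl rs) i = cell ls (w # tl rs) i" for i
        unfolding Cons by (auto simp: cell_def nth_append nth_Cons' Suc_diff_Suc)
      then show ?thesis using assms Left sym stay Cons
        by (intro that[of ls' "x # w # tl rs"]) (auto simp: tm_step_def)
    qed
  next
    case Right
    then show ?thesis using assms sym right
      by (intro that[of "w # ls" "tl rs"]) (auto simp: tm_step_def)
  next
    case Stay
    then show ?thesis using assms sym stay
      by (intro that[of ls "w # tl rs"]) (auto simp: tm_step_def)
  qed
qed

text \<open>The offset \<open>b\<close> allows a program to sit inside a larger one.
  \<open>take_bit D\<close> makes it immediate that written symbols stay below \<open>2 ^ D\<close>,
  and it does not touch the tracks below \<open>D\<close>.\<close>

definition hosts :: "nat \<Rightarrow> tm \<Rightarrow> prog \<Rightarrow> nat \<Rightarrow> bool" where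
  "hosts D M c b \<longleftrightarrow> (\<forall>x\<in>tracks c. tnum x < D) \<and>
     (\<forall>q. b \<le> q \<and> q < b + psize c \<longrightarrow> q \<noteq> acc M \<and> q \<noteq> rej M \<and>
        (\<forall>s. delta M q s = (case pdelta c b q s of (q', w, d) \<Rightarrow> (q', take_bit D w, d))))"

lemma hosts_step:
  assumes "hosts D M c b" "b \<le> q" "q < b + psize c" "rep D ls rs (h, G)"
    "pdelta c b q (cell ls rs h) = (q', w, d)"
  obtains ls' rs' where "tm_step M (q, ls, rs) = (q', ls', rs')"
    "length ls' = dmove d h"
    "\<And>i. cell ls' rs' i = (if i = h then take_bit D w else cell ls rs i)"
proof -
  have "length ls = h"
    using assms by (simp add: rep_def)
  with assms show ?thesis
    using tm_step_cell[of q M ls rs q' "take_bit D w" d] that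
    by (auto simp: hosts_def)
qed

lemma hosts_test:
  assumes "hosts D M c b" "b \<le> q" "q < b + psize c" "rep D ls rs (h, G)"
    "pdelta c b q (cell ls rs h) = (q', cell ls rs h, Stay)"
  obtains ls' rs' where "tm_step M (q, ls, rs) = (q', ls', rs')" "rep D ls' rs' (h, G)"
proof -
  obtain ls' rs' where "tm_step M (q, ls, rs) = (q', ls', rs')" "length ls' = h"
    "\<And>i. cell ls' rs' i = (if i = h then take_bit D (cell ls rs h) else cell ls rs i)"
    using hosts_step[OF assms] by auto
  with assms(4) show ?thesis
    by (intro that[of ls' rs']) (auto simp: rep_def bit_simps)
qed

text \<open>The induction follows the run, not the program, because a loop round continues with the
  same loop. The offset stays general since the parts of a program are hosted at shifted
  offsets.\<close>

lemma run_sim: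
  assumes "run c s t s'" "hosts D M c b" "rep D ls rs s"
  shows "\<exists>ls' rs'. (tm_step M ^^ t) (b, ls, rs) = (b + psize c, ls', rs') \<and> rep D ls' rs' s'"
  using assms
proof (induction arbitrary: b ls rs rule: run.induct)
  case (run_SetB x h G)
  from hosts_step[OF run_SetB(1) _ _ run_SetB(2) pdelta.simps(1)]
  obtain ls' rs' where "tm_step M (b, ls, rs) = (Suc b, ls', rs')" "length ls' = h"
    "\<And>i. cell ls' rs' i = (if i = h then take_bit D (set_bit (tnum x) (cell ls rs h)) else cell ls rs i)"
    by auto
  with run_SetB(2) show ?case
    by (auto simp: rep_def bit_simps)
next
  case (run_ClrB x h G)
  from hosts_step[OF run_ClrB(1) _ _ run_ClrB(2) pdelta.simps(2)]
  obtain ls' rs' where "tm_step M (b, ls, rs) = (Suc b, ls', rs')" "length ls' = h"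
    "\<And>i. cell ls' rs' i = (if i = h then take_bit D (unset_bit (tnum x) (cell ls rs h)) else cell ls rs i)"
    by auto
  with run_ClrB(2) show ?case
    by (auto simp: rep_def bit_simps)
next
  case (run_MvR h G)
  from hosts_step[OF run_MvR(1) _ _ run_MvR(2) pdelta.simps(3)]
  obtain ls' rs' where "tm_step M (b, ls, rs) = (Suc b, ls', rs')" "length ls' = Suc h"
    "\<And>i. cell ls' rs' i = (if i = h then take_bit D (cell ls rs h) else cell ls rs i)"
    by auto
  with run_MvR(2) show ?case
    by (auto simp: rep_def bit_simps)
next
  case (run_MvL h G)
  from hosts_step[OF run_MvL(1) _ _ run_MvL(2) pdelta.simps(4)]
  obtain ls' rs' where "tm_step M (b, ls, rs) = (Suc b, ls', rs')" "length ls' = h - 1"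
    "\<And>i. cell ls' rs' i = (if i = h then take_bit D (cell ls rs h) else cell ls rs i)"
    by auto
  with run_MvL(2) show ?case
    by (auto simp: rep_def bit_simps)
next
  case (run_Seq c1 s t s' c2 t' s'')
  have "hosts D M c1 b" "hosts D M c2 (b + psize c1)"
    using run_Seq.prems(1) by (auto simp: hosts_def)
  note H = this
  obtain ls1 rs1 where 1: "(tm_step M ^^ t) (b, ls, rs) = (b + psize c1, ls1, rs1)" "rep D ls1 rs1 s'"
    using run_Seq.IH(1)[OF H(1) run_Seq.prems(2)] by auto
  obtain ls2 rs2 where 2: "(tm_step M ^^ t') (b + psize c1, ls1, rs1) = (b + psize c1 + psize c2, ls2, rs2)"
    "rep D ls2 rs2 s''"
    using run_Seq.IH(2)[OF H(2) 1(2)] by auto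
  have "(tm_step M ^^ (t + t')) (b, ls, rs) = (tm_step M ^^ t') ((tm_step M ^^ t) (b, ls, rs))"
    by (metis add.commute comp_apply funpow_add)
  then show ?case
    using 1 2 by (auto simp: add.assoc)
next
  case (run_IfT h G x c1 t s' c2)
  have H: "hosts D M c1 (Suc b)"
    using run_IfT.prems(1) by (auto simp: hosts_def)
  have "bit (cell ls rs h) (tnum x)"
    using run_IfT.hyps run_IfT.prems by (auto simp: rep_def hosts_def)
  then obtain ls1 rs1 where 1: "tm_step M (b, ls, rs) = (Suc b, ls1, rs1)" "rep D ls1 rs1 (h, G)"
    using hosts_test[OF run_IfT.prems(1) _ _ run_IfT.prems(2), of b "Suc b"] by auto
  obtain ls2 rs2 where 2: "(tm_step M ^^ t) (Suc b, ls1, rs1) = (Suc b + psize c1, ls2, rs2)"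
    "rep D ls2 rs2 s'"
    using run_IfT.IH[OF H 1(2)] by auto
  obtain h' G' where s': "s' = (h', G')" by fastforce
  obtain ls3 rs3 where 3: "tm_step M (Suc b + psize c1, ls2, rs2) = (b + psize c1 + psize c2 + 2, ls3, rs3)"
    "rep D ls3 rs3 s'"
    using hosts_test[OF run_IfT.prems(1) _ _ 2(2)[unfolded s'],
        of "Suc b + psize c1" "b + psize c1 + psize c2 + 2"] s' by auto
  have "(tm_step M ^^ Suc (Suc t)) (b, ls, rs) = tm_step M ((tm_step M ^^ t) (tm_step M (b, ls, rs)))"
    by (simp add: funpow_swap1)
  then show ?case
    using 1 2 3 by (auto simp: algebra_simps)
next
  case (run_IfF h G x c2 t s' c1)
  have H: "hosts D M c2 (b + psize c1 + 2)"
    using run_IfF.prems(1) by (auto simp: hosts_def)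
  have "\<not> bit (cell ls rs h) (tnum x)"
    using run_IfF.hyps run_IfF.prems by (auto simp: rep_def hosts_def)
  then obtain ls1 rs1 where 1: "tm_step M (b, ls, rs) = (b + psize c1 + 2, ls1, rs1)" "rep D ls1 rs1 (h, G)"
    using hosts_test[OF run_IfF.prems(1) _ _ run_IfF.prems(2), of b "b + psize c1 + 2"] by auto
  have "(tm_step M ^^ Suc t) (b, ls, rs) = (tm_step M ^^ t) (tm_step M (b, ls, rs))"
    by (simp add: funpow_swap1)
  then show ?case
    using 1 run_IfF.IH[OF H 1(2)] by (auto simp: algebra_simps)
next
  case (run_WhileStop xs h G v c)
  have "(\<exists>x\<in>set xs. bit (cell ls rs h) (tnum x)) \<longleftrightarrow> (\<exists>x\<in>set xs. h \<in> G x)"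
    using run_WhileStop.prems by (auto simp: rep_def hosts_def)
  then obtain ls1 rs1 where 1: "tm_step M (b, ls, rs) = (b + psize c + 2, ls1, rs1)" "rep D ls1 rs1 (h, G)"
    using hosts_test[OF run_WhileStop.prems(1) _ _ run_WhileStop.prems(2), of b "b + psize c + 2"]
      run_WhileStop.hyps by auto
  then show ?case by auto
next
  case (run_WhileStep xs h G v c t s' t' s'')
  have H: "hosts D M c (Suc b)"
    using run_WhileStep.prems(1) by (auto simp: hosts_def)
  have "(\<exists>x\<in>set xs. bit (cell ls rs h) (tnum x)) \<longleftrightarrow> (\<exists>x\<in>set xs. h \<in> G x)"
    using run_WhileStep.prems by (auto simp: rep_def hosts_def)
  then obtain ls1 rs1 where 1: "tm_step M (b, ls, rs) = (Suc b, ls1, rs1)" "rep D ls1 rs1 (h, G)"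
    using hosts_test[OF run_WhileStep.prems(1) _ _ run_WhileStep.prems(2), of b "Suc b"]
      run_WhileStep.hyps by auto
  obtain ls2 rs2 where 2: "(tm_step M ^^ t) (Suc b, ls1, rs1) = (Suc b + psize c, ls2, rs2)"
    "rep D ls2 rs2 s'"
    using run_WhileStep.IH(1)[OF H 1(2)] by auto
  obtain h' G' where s': "s' = (h', G')" by fastforce
  obtain ls3 rs3 where 3: "tm_step M (Suc b + psize c, ls2, rs2) = (b, ls3, rs3)"
    "rep D ls3 rs3 s'"
    using hosts_test[OF run_WhileStep.prems(1) _ _ 2(2)[unfolded s'],
        of "Suc b + psize c" b] s' by auto
  have "(tm_step M ^^ Suc (t + Suc t')) (b, ls, rs) =
      (tm_step M ^^ t') (tm_step M ((tm_step M ^^ t) (tm_step M (b, ls, rs))))"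
  proof -
    have "Suc (t + Suc t') = t' + (1 + (t + 1))"
      by simp
    then show ?thesis
      by (simp only: funpow_add comp_apply) simp
  qed
  then show ?case
    using 1 2 3 run_WhileStep.IH(2)[OF run_WhileStep.prems(1) 3(2)] by auto
qed

text \<open>After the program the machine spends one more step on turning the flag at the origin into
  its verdict.\<close>
definition machine :: "nat \<Rightarrow> prog \<Rightarrow> tm" where
  "machine D c = \<lparr>nstates = psize c + 3, nsyms = 2 ^ D,
     delta = (\<lambda>q s. if q < psize c then (case pdelta c 0 q s of (q', w, d) \<Rightarrow> (q', take_bit D w, d))
        else if q = psize c then (if bit s (tnum Flag) then psize c + 1 else psize c + 2, s, Stay)
        else (q, s, Stay)),
     acc = psize c + 1, rej = psize c + 2\<rparr>"

lemma valid_machine: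
  assumes "3 \<le> D"
  shows "valid_tm (machine D c)"
proof -
  have "(2::nat) ^ 3 \<le> 2 ^ D"
    using assms by (intro power_increasing) auto
  moreover have "fst (pdelta c 0 q s) < psize c + 3" if "q < psize c" for q s
    using pdelta_bound[of 0 q c s] that by simp
  ultimately show ?thesis
    by (auto simp: valid_tm_def machine_def split: prod.splits) (metis fst_conv)
qed

text \<open>The hypothesis \<open>init\<close> restricts \<open>G\<close> only on tracks below
  \<open>D\<close>; on all higher tracks its contents can be chosen freely, and the initialisation
  makes use of this freedom.\<close>

lemma machine_decides:
  assumes "run c (0, G) t (0, G')" "\<forall>x\<in>tracks c. tnum x < D" "tnum Flag < D"
    and init: "\<And>x i. tnum x < D \<Longrightarrow> i \<in> G x \<longleftrightarrow> i < length w \<and> bit (w ! i) (tnum x)"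
  shows "decides_within (machine D c) w (Suc t) (0 \<in> G' Flag)"
proof -
  let ?M = "machine D c"
  have "rep D [] w (0, G)"
    using init by (auto simp: rep_def cell_def)
  moreover have "hosts D ?M c 0"
    using assms by (auto simp: hosts_def machine_def)
  ultimately obtain ls rs where 1: "(tm_step ?M ^^ t) (0, [], w) = (psize c, ls, rs)"
    and 2: "rep D ls rs (0, G')"
    using run_sim[OF assms(1)] by fastforce
  have "bit (cell ls rs 0) (tnum Flag) \<longleftrightarrow> 0 \<in> G' Flag"
    using 2 assms(3) unfolding rep_def by (metis snd_conv)
  moreover have "length ls = 0"
    using 2 by (simp add: rep_def)
  ultimately have "delta ?M (psize c) (cell ls rs (length ls)) =
      (if 0 \<in> G' Flag then psize c + 1 else psize c + 2, cell ls rs 0, Stay)"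
    by (simp add: machine_def)
  moreover have verdicts: "acc ?M = psize c + 1" "rej ?M = psize c + 2"
    by (auto simp: machine_def)
  ultimately obtain ls' rs' where "tm_step ?M (psize c, ls, rs) =
      (if 0 \<in> G' Flag then psize c + 1 else psize c + 2, ls', rs')"
    using tm_step_cell[of "psize c" ?M ls rs] by (metis Suc_eq_plus1 add_2_eq_Suc' less_add_Suc1 nat_neq_iff n_not_Suc_n)
  then have "tm_run ?M (Suc t) w = (if 0 \<in> G' Flag then psize c + 1 else psize c + 2, ls', rs')"
    using 1 by (simp add: tm_run_def)
  then show ?thesis
    unfolding decides_within_def by (intro exI[of _ "Suc t"]) (auto simp: verdicts)
qed

subsection \<open>Programs with heads, tables and a flag\<close>

definition runs :: "prog \<Rightarrow> nat \<times> tape \<Rightarrow> nat \<Rightarrow> nat \<times> tape \<Rightarrow> bool" where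
  "runs c s B s' \<longleftrightarrow> (\<exists>t\<le>B. run c s t s')"

lemma runs_Seq: "runs a s B s' \<Longrightarrow> runs b s' B' s'' \<Longrightarrow> runs (a ;; b) s (B + B') s''"
  unfolding runs_def by (meson add_mono run_Seq)

lemma runs_mono: "runs c s B s' \<Longrightarrow> B \<le> B' \<Longrightarrow> runs c s B' s'"
  unfolding runs_def by (meson order_trans)

lemma runs_SetB: "runs (SetB x) (h, G) 1 (h, G(x := insert h (G x)))"
  unfolding runs_def using run_SetB by blast

lemma runs_ClrB: "runs (ClrB x) (h, G) 1 (h, G(x := G x - {h}))"
  unfolding runs_def using run_ClrB by blast

lemma runs_MvR: "runs MvR (h, G) 1 (Suc h, G)"
  unfolding runs_def using run_MvR by blast

lemma runs_MvL: "runs MvL (h, G) 1 (h - 1, G)"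
  unfolding runs_def using run_MvL by blast

lemma runs_IfB:
  assumes "h \<in> G x \<Longrightarrow> runs a (h, G) B s'" "h \<notin> G x \<Longrightarrow> runs b (h, G) B s'"
  shows "runs (IfB x a b) (h, G) (B + 2) s'"
proof (cases "h \<in> G x")
  case True
  then obtain t where "t \<le> B" "run a (h, G) t s'"
    using assms(1) by (auto simp: runs_def)
  with True show ?thesis
    unfolding runs_def by (intro exI[of _ "Suc (Suc t)"]) (simp add: run_IfT)
next
  case False
  then obtain t where "t \<le> B" "run b (h, G) t s'"
    using assms(2) by (auto simp: runs_def)
  with False show ?thesis
    unfolding runs_def by (intro exI[of _ "Suc t"]) (simp add: run_IfF)
qed

lemma runs_WhileStop: "(\<exists>x\<in>set xs. h \<in> G x) \<noteq> v \<Longrightarrow> runs (While v xs c) (h, G) 1 (h, G)"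
  unfolding runs_def using run_WhileStop by blast

lemma runs_WhileStep:
  assumes "(\<exists>x\<in>set xs. h \<in> G x) = v" "runs c (h, G) B s'" "runs (While v xs c) s' B' s''"
  shows "runs (While v xs c) (h, G) (B + B' + 2) s''"
proof -
  obtain t t' where "t \<le> B" "t' \<le> B'" "run c (h, G) t s'" "run (While v xs c) s' t' s''"
    using assms(2,3) by (auto simp: runs_def)
  then show ?thesis
    unfolding runs_def using run_WhileStep[OF assms(1)]
    by (intro exI[of _ "Suc (t + Suc t')"]) auto
qed

text \<open>Test, move and jump back cost 3 steps per round, the failing last test costs 1.\<close>

lemma runs_search:
  assumes "h \<le> p" "\<And>i. h \<le> i \<Longrightarrow> i < p \<Longrightarrow> (\<exists>x\<in>set xs. i \<in> G x) = v"
    "(\<exists>x\<in>set xs. p \<in> G x) \<noteq> v"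
  shows "runs (While v xs MvR) (h, G) (3 * (p - h) + 1) (p, G)"
  using assms
proof (induction h rule: inc_induct)
  case base
  with runs_WhileStop[of xs p G v MvR] show ?case by simp
next
  case (step h)
  have "runs (While v xs MvR) (Suc h, G) (3 * (p - Suc h) + 1) (p, G)"
    using step by (intro step.IH) auto
  with step have "runs (While v xs MvR) (h, G) (1 + (3 * (p - Suc h) + 1) + 2) (p, G)"
    by (intro runs_WhileStep[OF _ runs_MvR]) auto
  then show ?case
    by (rule runs_mono) (use step in simp)
qed

abbreviation goto :: "track \<Rightarrow> prog" where
  "goto x \<equiv> While False [x] MvR"

abbreviation home :: prog where
  "home \<equiv> While False [Origin] MvL"

lemma runs_goto: "G x = {p} \<Longrightarrow> runs (goto x) (0, G) (3 * p + 1) (p, G)"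
  using runs_search[of 0 p "[x]" G False] by simp

lemma runs_home: "G Origin = {0} \<Longrightarrow> runs home (h, G) (3 * h + 1) (0, G)"
proof (induction h)
  case 0
  then show ?case using runs_WhileStop[of "[Origin]" 0 G False] by simp
next
  case (Suc h)
  then have "runs home (Suc h, G) (1 + (3 * h + 1) + 2) (0, G)"
    by (intro runs_WhileStep[OF _ runs_MvL]) auto
  then show ?case
    by (rule runs_mono) simp
qed

subsection \<open>Tapes describing heads, tables and a flag\<close>

type_synonym state = "(track \<Rightarrow> nat) \<times> (nat \<Rightarrow> nat set) \<times> bool"

text \<open>A variable or pointer is a track with a single mark. The flag is a mark on cell 0, where
  every block begins and ends, so branching on it requires no walk.\<close>

fun tape :: "(track \<Rightarrow> nat set) \<Rightarrow> nat \<Rightarrow> state \<Rightarrow> tape" where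
  "tape In N (h, tb, f) = (\<lambda>x. case x of V v \<Rightarrow> {h x} | P r \<Rightarrow> {h x} | Tab t \<Rightarrow> tb t
     | Origin \<Rightarrow> {0} | Flag \<Rightarrow> (if f then {0} else {}) | Limit \<Rightarrow> {N} | _ \<Rightarrow> In x)"

declare tape.simps [simp del]

definition is_head :: "track \<Rightarrow> bool" where
  "is_head x \<longleftrightarrow> (\<exists>v. x = V v \<or> x = P v)"

lemma is_head_simps [simp]: "is_head (V v)" "is_head (P v)"
  by (auto simp: is_head_def)

lemma tape_head [simp]: "is_head x \<Longrightarrow> tape In N (h, tb, f) x = {h x}"
  by (auto simp: is_head_def tape.simps)

lemma tape_head_upd: "is_head x \<Longrightarrow> (tape In N (h, tb, f))(x := {p}) = tape In N (h(x := p), tb, f)"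
  by (rule ext) (auto simp: is_head_def tape.simps split: track.split)

lemma tape_Tab_upd: "(tape In N (h, tb, f))(Tab t := X) = tape In N (h, tb(t := X), f)"
  by (rule ext) (auto simp: tape.simps split: track.split)

lemma tape_Flag_upd: "X = (if f' then {0} else {}) \<Longrightarrow>
    (tape In N (h, tb, f))(Flag := X) = tape In N (h, tb, f')"
  by (rule ext) (auto simp: tape.simps split: track.split)

lemmas tape_upds = tape_head_upd tape_Tab_upd tape_Flag_upd

lemma tape_simps [simp]:
  "tape In N (h, tb, f) Origin = {0}"
  "tape In N (h, tb, f) Limit = {N}"
  "tape In N (h, tb, f) Flag = (if f then {0} else {})"
  "tape In N (h, tb, f) (Tab t) = tb t"
  "tape In N (h, tb, f) I0 = In I0"
  "tape In N (h, tb, f) I1 = In I1"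
  "tape In N (h, tb, f) I2 = In I2"
  by (auto simp: tape.simps)

lemma tape_Origin: "tape In N s Origin = {0}"
  by (cases s) simp

text \<open>With cell 0 as the common start and end of all blocks, composition need not mention the
  head. The price is a walk out and back for each access to a mark, which remains polynomial as long
  as the marks do not stray too far.\<close>

definition exec :: "(track \<Rightarrow> nat set) \<Rightarrow> nat \<Rightarrow> prog \<Rightarrow> nat \<Rightarrow> state \<Rightarrow> state \<Rightarrow> bool" where
  "exec In N c B s s' \<longleftrightarrow> runs c (0, tape In N s) B (0, tape In N s')"

lemma runs_home_tape: "runs home (p, tape In N s) (3 * p + 1) (0, tape In N s)"
  by (rule runs_home) (rule tape_Origin)

section \<open>Blocks that start and end on cell 0\<close>

definition step_right :: "track \<Rightarrow> prog" where
  "step_right x = goto x ;; ClrB x ;; MvR ;; SetB x ;; home"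

definition reset :: "track \<Rightarrow> prog" where
  "reset x = goto x ;; ClrB x ;; home ;; SetB x"

definition mark :: "track \<Rightarrow> track \<Rightarrow> prog" where
  "mark y x = goto x ;; SetB y ;; home"

definition unmark :: "track \<Rightarrow> track \<Rightarrow> prog" where
  "unmark y x = goto x ;; ClrB y ;; home"

definition test :: "track \<Rightarrow> track \<Rightarrow> prog \<Rightarrow> prog \<Rightarrow> prog" where
  "test y x a b = goto x ;; IfB y (home ;; a) (home ;; b)"

definition test_le :: "track \<Rightarrow> track \<Rightarrow> prog \<Rightarrow> prog \<Rightarrow> prog" where
  "test_le x y a b = While False [x, y] MvR ;; IfB x (home ;; a) (home ;; b)"

definition on_flag :: "prog \<Rightarrow> prog \<Rightarrow> prog" where
  "on_flag a b = IfB Flag (ClrB Flag ;; a) b"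

text \<open>The \<open>While\<close> test reads the cell on which \<open>x\<close> stands, so the
  rounds belong to the positions 0 to \<open>N - 1\<close>. The final \<open>reset\<close> makes the
  loop repeatable inside another loop.\<close>

definition loop :: "track \<Rightarrow> prog \<Rightarrow> prog" where
  "loop x c = goto x ;; While False [Limit] (home ;; c ;; goto x ;; ClrB x ;; MvR ;; SetB x) ;; home ;; reset x"

text \<open>Moving left at the origin has no effect.\<close>
abbreviation skip :: prog where
  "skip \<equiv> MvL"

context
  fixes In :: "track \<Rightarrow> nat set" and N :: nat
begin

lemma exec_mono: "exec In N c B s s' \<Longrightarrow> B \<le> B' \<Longrightarrow> exec In N c B' s s'"
  unfolding exec_def by (rule runs_mono)

lemma exec_Seq:
  "exec In N a B s s' \<Longrightarrow> exec In N b B' s' s'' \<Longrightarrow> exec In N (a ;; b) (B + B') s s''"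
  unfolding exec_def by (rule runs_Seq)

lemma exec_skip: "exec In N skip 1 s s"
  unfolding exec_def using runs_MvL[of 0] by simp

lemma exec_step_right:
  assumes "is_head x" "h x \<le> S"
  shows "exec In N (step_right x) (6 * S + 8) (h, tb, f) (h(x := Suc (h x)), tb, f)"
proof -
  let ?G = "tape In N (h, tb, f)"
  have "runs (step_right x) (0, ?G) ((3 * h x + 1) + (1 + (1 + (1 + (3 * Suc (h x) + 1)))))
      (0, ?G(x := {}, x := {Suc (h x)}))"
    unfolding step_right_def
    apply (intro runs_Seq)
        apply (rule runs_goto)
        apply (simp add: assms)
       apply (rule runs_ClrB)
      apply (rule runs_MvR)
     apply (rule runs_SetB)
    using assms runs_home[of "?G(x := {Suc (h x)})" "Suc (h x)"] tape_Origin[of In N "(h, tb, f)"]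
    by (auto simp: is_head_def)
  with assms show ?thesis
    unfolding exec_def by (simp add: tape_upds) (erule runs_mono, simp)
qed

lemma exec_reset:
  assumes "is_head x" "h x \<le> S"
  shows "exec In N (reset x) (6 * S + 4) (h, tb, f) (h(x := 0), tb, f)"
proof -
  let ?G = "tape In N (h, tb, f)"
  have "runs (reset x) (0, ?G) ((3 * h x + 1) + (1 + ((3 * h x + 1) + 1)))
      (0, ?G(x := {}, x := {0}))"
    unfolding reset_def
    apply (intro runs_Seq)
       apply (rule runs_goto)
       apply (simp add: assms)
      apply (rule runs_ClrB)
     apply (rule runs_home)
    using assms runs_SetB[of x 0 "?G(x := {})"] tape_Origin[of In N "(h, tb, f)"]
    by (auto simp: is_head_def)
  with assms show ?thesis
    unfolding exec_def by (simp add: tape_upds) (erule runs_mono, simp)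
qed

lemma exec_mark:
  assumes "is_head x" "h x \<le> S"
  shows "exec In N (mark (Tab t) x) (6 * S + 4) (h, tb, f) (h, tb(t := insert (h x) (tb t)), f)"
proof -
  let ?G = "tape In N (h, tb, f)"
  have "runs (mark (Tab t) x) (0, ?G) ((3 * h x + 1) + (1 + (3 * h x + 1)))
      (0, ?G(Tab t := insert (h x) (?G (Tab t))))"
    unfolding mark_def
    apply (intro runs_Seq)
      apply (rule runs_goto)
      apply (simp add: assms)
     apply (rule runs_SetB)
    apply (rule runs_home)
    by simp
  with assms show ?thesis
    unfolding exec_def by (simp only: tape_upds) (simp add: runs_mono)
qed

lemma exec_unmark:
  assumes "is_head x" "h x \<le> S"
  shows "exec In N (unmark (Tab t) x) (6 * S + 4) (h, tb, f) (h, tb(t := tb t - {h x}), f)"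
proof -
  let ?G = "tape In N (h, tb, f)"
  have "runs (unmark (Tab t) x) (0, ?G) ((3 * h x + 1) + (1 + (3 * h x + 1)))
      (0, ?G(Tab t := ?G (Tab t) - {h x}))"
    unfolding unmark_def
    apply (intro runs_Seq)
      apply (rule runs_goto)
      apply (simp add: assms)
     apply (rule runs_ClrB)
    apply (rule runs_home)
    by simp
  with assms show ?thesis
    unfolding exec_def by (simp only: tape_upds) (simp add: runs_mono)
qed

lemma exec_home_then:
  assumes "exec In N a B s s'" "p \<le> S"
  shows "runs (home ;; a) (p, tape In N s) (3 * S + 1 + B) (0, tape In N s')"
  by (rule runs_mono[OF runs_Seq[OF runs_home_tape assms(1)[unfolded exec_def]]]) (use assms(2) in simp)

lemma exec_test:
  assumes "is_head x" "h x \<le> S"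
    "h x \<in> tape In N (h, tb, f) y \<Longrightarrow> exec In N a B (h, tb, f) s'"
    "h x \<notin> tape In N (h, tb, f) y \<Longrightarrow> exec In N b B (h, tb, f) s'"
  shows "exec In N (test y x a b) (6 * S + 4 + B) (h, tb, f) s'"
proof -
  have "runs (test y x a b) (0, tape In N (h, tb, f)) ((3 * h x + 1) + ((3 * S + 1 + B) + 2))
      (0, tape In N s')"
    unfolding test_def using assms
    by (intro runs_Seq[OF runs_goto] runs_IfB exec_home_then) auto
  then show ?thesis
    unfolding exec_def by (rule runs_mono) (use assms(2) in simp)
qed

text \<open>A walk to the right that stops at either mark ends at the minimum of the two, and
  \<open>x\<close> is found there exactly if \<open>h x\<close> is at most
  \<open>h y\<close>.\<close>

lemma exec_test_le:
  assumes "is_head x" "is_head y" "h x \<le> S"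
    "h x \<le> h y \<Longrightarrow> exec In N a B (h, tb, f) s'"
    "\<not> h x \<le> h y \<Longrightarrow> exec In N b B (h, tb, f) s'"
  shows "exec In N (test_le x y a b) (6 * S + 4 + B) (h, tb, f) s'"
proof -
  let ?p = "min (h x) (h y)"
  have "runs (While False [x, y] MvR) (0, tape In N (h, tb, f)) (3 * (?p - 0) + 1)
      (?p, tape In N (h, tb, f))"
    using assms by (intro runs_search) (simp, simp, auto simp: min_def)
  moreover have "runs (IfB x (home ;; a) (home ;; b)) (?p, tape In N (h, tb, f))
      ((3 * S + 1 + B) + 2) (0, tape In N s')"
  proof (rule runs_IfB)
    assume "?p \<in> tape In N (h, tb, f) x"
    with assms show "runs (home ;; a) (?p, tape In N (h, tb, f)) (3 * S + 1 + B) (0, tape In N s')"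
      by (intro exec_home_then) (auto simp: min_def split: if_splits)
  next
    assume "?p \<notin> tape In N (h, tb, f) x"
    with assms show "runs (home ;; b) (?p, tape In N (h, tb, f)) (3 * S + 1 + B) (0, tape In N s')"
      by (intro exec_home_then) (auto simp: min_def split: if_splits)
  qed
  ultimately have "runs (test_le x y a b) (0, tape In N (h, tb, f)) ((3 * (?p - 0) + 1) + ((3 * S + 1 + B) + 2))
      (0, tape In N s')"
    unfolding test_le_def by (rule runs_Seq)
  then show ?thesis
    unfolding exec_def by (rule runs_mono) (use assms(3) in simp)
qed

lemma exec_set_flag: "exec In N (SetB Flag) 1 (h, tb, f) (h, tb, True)"
  unfolding exec_def using runs_SetB[of Flag 0 "tape In N (h, tb, f)"]
  by (subst (asm) tape_Flag_upd[where f' = True]) auto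

lemma exec_clear_flag: "exec In N (ClrB Flag) 1 (h, tb, f) (h, tb, False)"
  unfolding exec_def using runs_ClrB[of Flag 0 "tape In N (h, tb, f)"]
  by (subst (asm) tape_Flag_upd[where f' = False]) auto

lemma exec_negate_flag: "exec In N (IfB Flag (ClrB Flag) (SetB Flag)) 3 (h, tb, f) (h, tb, \<not> f)"
proof -
  have "exec In N (IfB Flag (ClrB Flag) (SetB Flag)) (1 + 2) (h, tb, f) (h, tb, \<not> f)"
    unfolding exec_def
    by (rule runs_IfB; cases f) (use exec_set_flag[of h tb f] exec_clear_flag[of h tb f] in
        \<open>auto simp: exec_def\<close>)
  then show ?thesis by (simp add: numeral_3_eq_3)
qed

lemma exec_on_flag:
  assumes "f \<Longrightarrow> exec In N a B (h, tb, False) s'" "\<not> f \<Longrightarrow> exec In N b B (h, tb, False) s'"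
  shows "exec In N (on_flag a b) (B + 3) (h, tb, f) s'"
proof (cases f)
  case True
  then show ?thesis
    using runs_IfB[of 0 "tape In N (h, tb, f)" Flag "ClrB Flag ;; a" "1 + B"] exec_Seq[OF exec_clear_flag assms(1)[OF True]]
    unfolding on_flag_def exec_def by (auto simp: eval_nat_numeral)
next
  case False
  then show ?thesis
    using runs_IfB[of 0 "tape In N (h, tb, f)" Flag "ClrB Flag ;; a" B "(0, tape In N s')" b] assms(2)[OF False]
    unfolding on_flag_def exec_def by (auto elim!: runs_mono)
qed

definition loop_time :: "nat \<Rightarrow> nat" where
  "loop_time B = (N + 1) * (B + 6 * N + 16)"

text \<open>The sequences \<open>hh\<close>, \<open>tt\<close>, \<open>ff\<close> take the place of
  an invariant: they give the state before round \<open>i\<close>, with \<open>x\<close> overwritten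
  by the round number. \<open>loop_time\<close> grants 9 steps per round more than the rounds
  consume, which pays for the walk home and the reset afterwards.\<close>

lemma exec_loop:
  assumes x: "is_head x"
    and body: "\<And>i. i < N \<Longrightarrow>
      exec In N c B ((hh i)(x := i), tt i, ff i) ((hh (Suc i))(x := i), tt (Suc i), ff (Suc i))"
  shows "exec In N (loop x c) (loop_time B) ((hh 0)(x := 0), tt 0, ff 0) ((hh N)(x := 0), tt N, ff N)"
proof -
  let ?G = "\<lambda>i. tape In N ((hh i)(x := i), tt i, ff i)"
  let ?c = "home ;; c ;; goto x ;; ClrB x ;; MvR ;; SetB x"
  have iter: "runs ?c (i, ?G i) (B + 6 * N + 5) (Suc i, ?G (Suc i))" if "i < N" for i
  proof -
    let ?H = "tape In N ((hh (Suc i))(x := i), tt (Suc i), ff (Suc i))"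
    have H: "?H x = {i}" using x by (simp)
    have "runs ?c (i, ?G i) ((3 * i + 1) + (B + ((3 * i + 1) + (1 + (1 + 1)))))
        (Suc i, ?H(x := {}, x := {Suc i}))"
      apply (intro runs_Seq)
           apply (rule runs_home_tape)
          apply (rule body[OF that, unfolded exec_def])
         apply (rule runs_goto[of ?H x i, OF H])
        apply (rule runs_ClrB)
       apply (rule runs_MvR)
      using runs_SetB[of x "Suc i" "?H(x := {})"] H by (simp)
    moreover have "?H(x := {}, x := {Suc i}) = ?G (Suc i)"
      using x by (simp add: tape_head_upd)
    ultimately show ?thesis
      by (simp only:) (erule runs_mono, use that in simp)
  qed
  have "runs (While False [Limit] ?c) (i, ?G i) ((N - i) * (B + 6 * N + 7) + 1) (N, ?G N)"
    if "i \<le> N" for i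
    using that
  proof (induction i rule: inc_induct)
    case base
    show ?case by (rule runs_mono[OF runs_WhileStop]) auto
  next
    case (step i)
    have "runs (While False [Limit] ?c) (i, ?G i)
       (B + 6 * N + 5 + ((N - Suc i) * (B + 6 * N + 7) + 1) + 2) (N, ?G N)"
      using step by (intro runs_WhileStep[OF _ iter step.IH]) auto
    moreover have N: "N - i = Suc (N - Suc i)"
      using step by simp
    ultimately show ?case
      by (elim runs_mono) (unfold N, simp)
  qed
  from this[of 0] have loop: "runs (While False [Limit] ?c) (0, ?G 0) (N * (B + 6 * N + 7) + 1) (N, ?G N)"
    by simp
  have G0: "?G 0 x = {0}" using x by (simp)
  have reset: "runs (reset x) (0, ?G N) (6 * N + 4) (0, tape In N ((hh N)(x := 0), tt N, ff N))"
    using exec_reset[OF x, of "(hh N)(x := N)" N] by (simp add: exec_def)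
  have "runs (loop x c) (0, ?G 0) ((3 * 0 + 1) + ((N * (B + 6 * N + 7) + 1) + ((3 * N + 1) + (6 * N + 4))))
     (0, tape In N ((hh N)(x := 0), tt N, ff N))"
    unfolding loop_def
    by (intro runs_Seq[OF runs_goto[of "?G 0" x 0, OF G0]] runs_Seq[OF loop] runs_Seq[OF runs_home_tape] reset)
  then show ?thesis
    unfolding exec_def by (rule runs_mono) (simp add: loop_time_def algebra_simps)
qed

end

subsection \<open>Loops over tuples\<close>

text \<open>Base-\<open>N\<close> digits, most significant first. This is the order in which nested
  loops enumerate tuples, the outermost loop supplying the leading digit.\<close>

fun dig :: "nat \<Rightarrow> nat \<Rightarrow> nat \<Rightarrow> nat list" where
  "dig N 0 x = []"
| "dig N (Suc k) x = x div N ^ k # dig N k (x mod N ^ k)"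

lemma div_mult_add: "y < M \<Longrightarrow> (a * M + y) div M = (a :: nat)"
  using div_mult_self1[of M y a] by (simp add: add.commute)

definition tuples :: "nat \<Rightarrow> nat \<Rightarrow> nat list set" where
  "tuples N k = {as. length as = k \<and> set as \<subseteq> {..<N}}"

lemma length_dig [simp]: "length (dig N k x) = k"
  by (induction k arbitrary: x) auto

lemma dig_tuples: "x < N ^ k \<Longrightarrow> dig N k x \<in> tuples N k"
proof (induction k arbitrary: x)
  case (Suc k)
  then have "0 < N ^ k" by (cases N) auto
  moreover from this have "x div N ^ k < N"
    using Suc.prems by (simp add: less_mult_imp_div_less)
  ultimately show ?case
    using Suc.IH[of "x mod N ^ k"] by (auto simp: tuples_def)
qed (simp add: tuples_def)

lemma tuples_dig: "as \<in> tuples N k \<Longrightarrow> \<exists>x<N ^ k. dig N k x = as"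
proof (induction k arbitrary: as)
  case (Suc k)
  then obtain a bs where as: "as = a # bs" and a: "a < N" and "bs \<in> tuples N k"
    by (cases as) (auto simp: tuples_def)
  then obtain x where x: "x < N ^ k" "dig N k x = bs"
    using Suc.IH by blast
  have "a * N ^ k + x < Suc a * N ^ k"
    using x by simp
  also have "\<dots> \<le> N * N ^ k"
    using a by (intro mult_right_mono) auto
  finally show ?case
    using x as by (intro exI[of _ "a * N ^ k + x"]) (auto simp: div_mult_add)
qed (simp add: tuples_def)

fun hset :: "(track \<Rightarrow> nat) \<Rightarrow> track list \<Rightarrow> nat list \<Rightarrow> track \<Rightarrow> nat" where
  "hset h [] as = h"
| "hset h (x # xs) as = (hset h xs (tl as))(x := hd as)"

lemma hset_other: "y \<notin> set xs \<Longrightarrow> hset h xs as y = h y"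
  by (induction xs arbitrary: as) auto

lemma hset_upd: "y \<notin> set xs \<Longrightarrow> hset (h(y := i)) xs as = (hset h xs as)(y := i)"
  by (induction xs arbitrary: as) (auto simp: fun_upd_twist)

lemma hset_zero: "(\<And>x. x \<in> set xs \<Longrightarrow> h x = 0) \<Longrightarrow> hset h xs (replicate (length xs) 0) = h"
  by (induction xs) (auto intro!: ext)

lemma hset_le: "length as = length xs \<Longrightarrow> set as \<subseteq> {..S} \<Longrightarrow> h y \<le> S \<Longrightarrow> hset h xs as y \<le> S"
proof (induction xs arbitrary: as)
  case (Cons x xs)
  then show ?case by (cases as) auto
qed auto

definition fors :: "track list \<Rightarrow> prog \<Rightarrow> prog" where
  "fors xs c = foldr loop xs c"

text \<open>With \<open>k\<close> inner loops, round \<open>i\<close> of the outermost loop covers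
  the block of \<open>N ^ k\<close> numbers that starts at \<open>i * N ^ k\<close>. The induction
  hypothesis is thus applied to the shifted sequences, with \<open>x\<close> frozen at
  \<open>i\<close>. That \<open>hh\<close> varies with \<open>y\<close> admits a body that moves
  further heads.\<close>

lemma exec_fors:
  assumes "distinct xs" "\<forall>x\<in>set xs. is_head x"
    "\<And>y. y < N ^ length xs \<Longrightarrow> exec In N c B
       (hset (hh y) xs (dig N (length xs) y), tt y, ff y)
       (hset (hh (Suc y)) xs (dig N (length xs) y), tt (Suc y), ff (Suc y))"
  shows "exec In N (fors xs c) ((loop_time N ^^ length xs) B)
     (hset (hh 0) xs (replicate (length xs) 0), tt 0, ff 0)
     (hset (hh (N ^ length xs)) xs (replicate (length xs) 0), tt (N ^ length xs), ff (N ^ length xs))"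
  using assms
proof (induction xs arbitrary: hh tt ff)
  case Nil
  then show ?case by (simp add: fors_def)
next
  case (Cons x xs)
  let ?k = "length xs"
  let ?z = "replicate ?k 0"
  have x: "x \<notin> set xs" "is_head x"
    using Cons.prems by auto
  have "exec In N (fors xs c) ((loop_time N ^^ ?k) B)
     ((hset (hh (i * N ^ ?k)) xs ?z)(x := i), tt (i * N ^ ?k), ff (i * N ^ ?k))
     ((hset (hh (Suc i * N ^ ?k)) xs ?z)(x := i), tt (Suc i * N ^ ?k), ff (Suc i * N ^ ?k))"
    if i: "i < N" for i
  proof -
    have "exec In N c B
       (hset ((hh (i * N ^ ?k + y))(x := i)) xs (dig N ?k y), tt (i * N ^ ?k + y), ff (i * N ^ ?k + y))
       (hset ((hh (i * N ^ ?k + Suc y))(x := i)) xs (dig N ?k y), tt (i * N ^ ?k + Suc y), ff (i * N ^ ?k + Suc y))"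
      if y: "y < N ^ ?k" for y
    proof -
      have "i * N ^ ?k + y < Suc i * N ^ ?k"
        using y by simp
      also have "\<dots> \<le> N * N ^ ?k"
        using i by (intro mult_right_mono) auto
      finally have "i * N ^ ?k + y < N ^ length (x # xs)"
        by simp
      from Cons.prems(3)[OF this] show ?thesis
        using y x by (simp add: hset_upd div_mult_add del: fun_upd_apply)
    qed
    from Cons.IH[OF _ _ this] Cons.prems x show ?thesis
      by (simp add: hset_upd add.commute del: fun_upd_apply)
  qed
  from exec_loop[OF x(2) this] show ?case
    by (simp add: fors_def del: fun_upd_apply)
qed

text \<open>The pointer advances once per tuple, so it stands on cell \<open>y\<close> while the
  loop heads show the digits of \<open>y\<close>. Hence cell \<open>y\<close> of a table can serve
  as the entry of the tuple \<open>dig N k y\<close>. A table occupies \<open>N ^ k\<close> cells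
  and may reach far beyond the input.\<close>

definition forp :: "track list \<Rightarrow> track \<Rightarrow> prog \<Rightarrow> prog" where
  "forp xs p c = fors xs (c ;; step_right p) ;; reset p"

definition forp_time :: "nat \<Rightarrow> nat \<Rightarrow> nat \<Rightarrow> nat" where
  "forp_time N k B = (loop_time N ^^ k) (B + (6 * N ^ k + 8)) + (6 * N ^ k + 4)"

lemma exec_forp:
  assumes "distinct xs" "\<forall>x\<in>set xs. is_head x \<and> h x = 0" "is_head p" "p \<notin> set xs" "h p = 0"
    and k: "length xs = k"
    and body: "\<And>y. y < N ^ k \<Longrightarrow> exec In N c B
       ((hset h xs (dig N k y))(p := y), tt y, ff y)
       ((hset h xs (dig N k y))(p := y), tt (Suc y), ff (Suc y))"
  shows "exec In N (forp xs p c) (forp_time N k B)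
     (h, tt 0, ff 0) (h, tt (N ^ k), ff (N ^ k))"
proof -
  have "exec In N (c ;; step_right p) (B + (6 * N ^ k + 8))
       (hset (h(p := y)) xs (dig N k y), tt y, ff y)
       (hset (h(p := Suc y)) xs (dig N k y), tt (Suc y), ff (Suc y))" if y: "y < N ^ k" for y
    using exec_Seq[OF body[OF y]
        exec_step_right[OF assms(3), where h = "(hset h xs (dig N k y))(p := y)" and S = "N ^ k"]] assms y
    by (simp add: hset_upd)
  from exec_fors[of xs N In _ _ "\<lambda>y. h(p := y)" tt ff, unfolded k, OF _ _ this] assms
  have "exec In N (fors xs (c ;; step_right p)) ((loop_time N ^^ k) (B + (6 * N ^ k + 8)))
     (h, tt 0, ff 0) (h(p := N ^ k), tt (N ^ k), ff (N ^ k))"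
    using hset_zero[of xs h] by (simp add: hset_upd fun_upd_idem)
  from exec_Seq[OF this exec_reset[OF assms(3), where h = "h(p := N ^ k)" and S = "N ^ k"]] assms(5)
  show ?thesis
    by (simp add: forp_def forp_time_def fun_upd_idem)
qed

subsection \<open>Formulas with tuple reachability\<close>

datatype fm = At nat nat | Le nat nat | Neg fm | Conj fm fm | Reach nat fm fm fm

fun ext :: "nat \<Rightarrow> nat list \<Rightarrow> (nat \<Rightarrow> nat) \<Rightarrow> nat \<Rightarrow> nat" where
  "ext m [] e = e"
| "ext m (a # as) e = (ext (Suc m) as e)(m := a)"

definition inp :: "nat \<Rightarrow> track" where
  "inp i = (if i = 0 then I0 else if i = 1 then I1 else I2)"

text \<open>The number \<open>m\<close> is the first variable that is not in use. \<open>Reach k S R T\<close> binds \<open>k\<close> variables from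
  \<open>m\<close> on in \<open>S\<close> and \<open>T\<close>, and \<open>2 * k\<close> variables in \<open>R\<close>: some tuple satisfying \<open>T\<close> is reachable by
  \<open>R\<close>-steps from some tuple satisfying \<open>S\<close>.\<close>
fun sem :: "(track \<Rightarrow> nat set) \<Rightarrow> nat \<Rightarrow> nat \<Rightarrow> (nat \<Rightarrow> nat) \<Rightarrow> fm \<Rightarrow> bool" where
  "sem In N m e (At i v) \<longleftrightarrow> e v \<in> In (inp i)"
| "sem In N m e (Le v u) \<longleftrightarrow> e v \<le> e u"
| "sem In N m e (Neg a) \<longleftrightarrow> \<not> sem In N m e a"
| "sem In N m e (Conj a b) \<longleftrightarrow> sem In N m e a \<and> sem In N m e b"
| "sem In N m e (Reach k S R T) \<longleftrightarrow>
    (\<exists>as\<in>tuples N k. \<exists>bs\<in>tuples N k. sem In N (m + k) (ext m as e) S \<and>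
       (as, bs) \<in> {(as, bs). as \<in> tuples N k \<and> bs \<in> tuples N k \<and>
          sem In N (m + k + k) (ext (m + k) bs (ext m as e)) R}\<^sup>* \<and>
       sem In N (m + k) (ext m bs e) T)"

lemma hset_V: "length as = k \<Longrightarrow> (\<lambda>v. hset h (map V [m..<m + k]) as (V v)) = ext m as (\<lambda>v. h (V v))"
proof (induction k arbitrary: m as)
  case (Suc k)
  then obtain a bs where as: "as = a # bs" "length bs = k"
    by (cases as) auto
  have "[m..<m + Suc k] = m # [Suc m..<Suc m + k]"
    by (simp add: upt_conv_Cons)
  with Suc.IH[OF as(2), of "Suc m"] as show ?case
    by (auto simp: fun_eq_iff)
qed simp

text \<open>For \<open>Reach\<close>, table \<open>q\<close> is filled from \<open>S\<close>, closed
  under \<open>R\<close>, filtered by \<open>T\<close> and tested for a remaining entry.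
  \<open>P q\<close> and \<open>P (q + 1)\<close> scan sources and targets; the \<open>k + k\<close>
  pointers from \<open>P (q + 2)\<close> on are mere counters that repeat the sweep. The last pass
  erases the table while testing it, so that the next evaluation finds it empty. Compiled code
  expects a cleared flag, which \<open>on_flag\<close> provides.\<close>

fun compile :: "fm \<Rightarrow> nat \<Rightarrow> nat \<Rightarrow> prog" where
  "compile (At i v) m q = test (inp i) (V v) (SetB Flag) skip"
| "compile (Le v u) m q = test_le (V v) (V u) (SetB Flag) skip"
| "compile (Neg a) m q = compile a m q ;; IfB Flag (ClrB Flag) (SetB Flag)"
| "compile (Conj a b) m q = compile a m q ;; on_flag (compile b m q) skip"
| "compile (Reach k S R T) m q =
    (let as = map V [m..<m + k]; bs = map V [m + k..<m + k + k]; r = q + 2 + (k + k) in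
     forp as (P q) (compile S (m + k) r ;; on_flag (mark (Tab q) (P q)) skip) ;;
     fors (map P [q + 2..<r])
       (forp as (P q) (test (Tab q) (P q)
         (forp bs (P (q + 1)) (compile R (m + k + k) r ;; on_flag (mark (Tab q) (P (q + 1))) skip))
         skip)) ;;
     forp as (P q) (compile T (m + k) r ;; on_flag skip (unmark (Tab q) (P q))) ;;
     forp as (P q) (test (Tab q) (P q) (SetB Flag ;; unmark (Tab q) (P q)) skip))"

section \<open>Polynomial bounds\<close>

definition polyb :: "(nat \<Rightarrow> nat) \<Rightarrow> bool" where
  "polyb f \<longleftrightarrow> (\<exists>c d. \<forall>n. f n \<le> c * (n + 1) ^ d)"

lemma polyb_const: "polyb (\<lambda>n. c)"
  unfolding polyb_def by (intro exI[of _ c] exI[of _ 0]) simp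

lemma polyb_id: "polyb (\<lambda>n. n)"
  unfolding polyb_def by (intro exI[of _ 1]) simp

lemma polyb_mult: "polyb f \<Longrightarrow> polyb g \<Longrightarrow> polyb (\<lambda>n. f n * g n)"
proof -
  assume "polyb f" "polyb g"
  then obtain c d c' d' where "\<And>n. f n \<le> c * (n + 1) ^ d" "\<And>n. g n \<le> c' * (n + 1) ^ d'"
    unfolding polyb_def by blast
  then have "f n * g n \<le> (c * c') * (n + 1) ^ (d + d')" for n
    using mult_mono[of "f n" "c * (n + 1) ^ d" "g n" "c' * (n + 1) ^ d'"]
    by (simp add: power_add mult_ac)
  then show ?thesis
    unfolding polyb_def by blast
qed

lemma polyb_add: "polyb f \<Longrightarrow> polyb g \<Longrightarrow> polyb (\<lambda>n. f n + g n)"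
proof -
  assume "polyb f" "polyb g"
  then obtain c d c' d' where "\<And>n. f n \<le> c * (n + 1) ^ d" "\<And>n. g n \<le> c' * (n + 1) ^ d'"
    unfolding polyb_def by blast
  \<comment> \<open>The degrees are added rather than maximised: since \<open>n + 1\<close> is at
    least 1, the sum dominates both.\<close>
  moreover have "c * (n + 1) ^ d + c' * (n + 1) ^ d' \<le> (c + c') * (n + 1) ^ (d + d')" for n
    unfolding add_mult_distrib by (intro add_mono mult_left_mono power_increasing) auto
  ultimately have "f n + g n \<le> (c + c') * (n + 1) ^ (d + d')" for n
    by (meson add_mono order_trans)
  then show ?thesis
    unfolding polyb_def by blast
qed

lemma polyb_power: "polyb f \<Longrightarrow> polyb (\<lambda>n. f n ^ k)"
  by (induction k) (auto intro: polyb_const polyb_mult)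

lemma polyb_loop_time: "polyb f \<Longrightarrow> polyb (\<lambda>n. (loop_time n ^^ k) (f n))"
  by (induction k) (auto simp: loop_time_def intro!: polyb_const polyb_mult polyb_add polyb_id)

lemma polyb_forp_time: "polyb f \<Longrightarrow> polyb (\<lambda>n. forp_time n k (f n))"
  unfolding forp_time_def
  by (intro polyb_loop_time polyb_const polyb_mult polyb_add polyb_id polyb_power)

lemmas polybs = polyb_const polyb_mult polyb_add polyb_id polyb_power polyb_loop_time polyb_forp_time

section \<open>Transitive closure by repeated sweeps\<close>

text \<open>One pass over all pairs; rows whose table entry was set by an earlier row of the same pass
  already take part.\<close>
fun sweep :: "(nat \<Rightarrow> nat \<Rightarrow> bool) \<Rightarrow> nat \<Rightarrow> nat \<Rightarrow> nat set \<Rightarrow> nat set" where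
  "sweep R M 0 X = X"
| "sweep R M (Suc i) X = (if i \<in> sweep R M i X then sweep R M i X \<union> {y. y < M \<and> R i y} else sweep R M i X)"

lemma sweep_mono: "i \<le> j \<Longrightarrow> sweep R M i X \<subseteq> sweep R M j X"
proof (induction j)
  case (Suc j)
  then show ?case by (cases "i = Suc j") fastforce+
qed simp

lemma sweep_sound:
  "i \<le> M \<Longrightarrow> X \<subseteq> C \<Longrightarrow> (\<And>x y. x \<in> C \<Longrightarrow> x < M \<Longrightarrow> y < M \<Longrightarrow> R x y \<Longrightarrow> y \<in> C) \<Longrightarrow> sweep R M i X \<subseteq> C"
  by (induction i) (auto split: if_splits)

text \<open>Entries are never erased, so \<open>x\<close> is still present when its row is reached,
  and what this row adds survives the later rows.\<close>

lemma sweep_complete: "x \<in> X \<Longrightarrow> x < M \<Longrightarrow> y < M \<Longrightarrow> R x y \<Longrightarrow> y \<in> sweep R M M X"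
  using sweep_mono[of 0 x R M X] sweep_mono[of "Suc x" M R M X] by fastforce

text \<open>Soundness holds because each sweep stays inside any closed set. Conversely,
  \<open>n\<close> sweeps cover all paths with \<open>n\<close> edges, and paths with at most
  \<open>card\<close> many edges of the relation suffice, which is at most
  \<open>M * M\<close>.\<close>

lemma sweeps_reach:
  assumes "X \<subseteq> {..<M}"
  shows "(sweep R M M ^^ (M * M)) X = {(x, y). x < M \<and> y < M \<and> R x y}\<^sup>* `` X"
proof
  let ?E = "{(x, y). x < M \<and> y < M \<and> R x y}"
  have "(sweep R M M ^^ n) X \<subseteq> ?E\<^sup>* `` X" for n
  proof (induction n)
    case (Suc n)
    then show ?case
      by (simp, intro sweep_sound) (auto intro: rtrancl_into_rtrancl)
  qed auto
  then show "(sweep R M M ^^ (M * M)) X \<subseteq> ?E\<^sup>* `` X" .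
  have mono: "(sweep R M M ^^ n) X \<subseteq> (sweep R M M ^^ (n + j)) X" for n j
  proof (induction j)
    case (Suc j)
    then show ?case using sweep_mono[of 0 M R M "(sweep R M M ^^ (n + j)) X"] by auto
  qed simp
  have pow: "(?E ^^ n) `` X \<subseteq> (sweep R M M ^^ n) X" for n
  proof (induction n)
    case (Suc n)
    then show ?case by (auto intro!: sweep_complete)
  qed auto
  have fin: "finite ?E" and card: "card ?E \<le> M * M"
    using card_mono[of "{..<M} \<times> {..<M}" ?E] by (auto intro: finite_subset[of _ "{..<M} \<times> {..<M}"])
  show "?E\<^sup>* `` X \<subseteq> (sweep R M M ^^ (M * M)) X"
  proof
    fix y assume "y \<in> ?E\<^sup>* `` X"
    then obtain x n where "x \<in> X" "n \<le> card ?E" "(x, y) \<in> ?E ^^ n"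
      using rtrancl_finite_eq_relpow[OF fin] by auto
    then show "y \<in> (sweep R M M ^^ (M * M)) X"
      using pow[of n] mono[of n "M * M - n"] card by auto
  qed
qed

lemma rtrancl_dig:
  assumes "x < N ^ k"
  shows "(x, y) \<in> {(x, y). x < N ^ k \<and> y < N ^ k \<and> R (dig N k x) (dig N k y)}\<^sup>* \<Longrightarrow>
    (dig N k x, dig N k y) \<in> {(as, bs). as \<in> tuples N k \<and> bs \<in> tuples N k \<and> R as bs}\<^sup>*"
  by (induction rule: rtrancl_induct) (auto intro: rtrancl_into_rtrancl dig_tuples)

lemma rtrancl_tuples:
  assumes "(as, bs) \<in> {(as, bs). as \<in> tuples N k \<and> bs \<in> tuples N k \<and> R as bs}\<^sup>*"
    "dig N k x = as" "x < N ^ k"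
  shows "\<exists>y<N ^ k. dig N k y = bs \<and>
    (x, y) \<in> {(x, y). x < N ^ k \<and> y < N ^ k \<and> R (dig N k x) (dig N k y)}\<^sup>*"
  using assms
proof (induction rule: rtrancl_induct)
  case base
  then show ?case by blast
next
  case (step bs cs)
  then obtain y where y: "y < N ^ k" "dig N k y = bs"
    "(x, y) \<in> {(x, y). x < N ^ k \<and> y < N ^ k \<and> R (dig N k x) (dig N k y)}\<^sup>*"
    by blast
  moreover obtain z where "z < N ^ k" "dig N k z = cs"
    using step tuples_dig[of cs N k] by blast
  ultimately show ?case
    using step(2) by (intro exI[of _ z]) (auto intro: rtrancl_into_rtrancl)
qed

section \<open>Correctness of compiled formulas\<close>

text \<open>All resources still to be allocated are in their initial state. The bound on the
  variables limits the walks to them.\<close>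

definition fresh :: "nat \<Rightarrow> nat \<Rightarrow> nat \<Rightarrow> (track \<Rightarrow> nat) \<Rightarrow> (nat \<Rightarrow> nat set) \<Rightarrow> bool" where
  "fresh N m q h tb \<longleftrightarrow> (\<forall>v. h (V v) \<le> N) \<and> (\<forall>v\<ge>m. h (V v) = 0) \<and>
     (\<forall>r\<ge>q. h (P r) = 0 \<and> tb r = {})"

lemma hset_V_other [simp]:
  "hset h (map V vs) as (P r) = h (P r)"
  "v \<notin> set vs \<Longrightarrow> hset h (map V vs) as (V v) = h (V v)"
  by (rule hset_other; auto)+

lemma fresh_tuple:
  assumes "fresh N m q h tb" "as \<in> tuples N k" "r < q'" "t < q'" "q \<le> q'"
  shows "fresh N (m + k) q' ((hset h (map V [m..<m + k]) as)(P r := y)) (tb(t := X))"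
  using assms by (auto simp: fresh_def tuples_def intro!: hset_le)

text \<open>Heads and tables come back unchanged and only the flag carries a result; this is what
  allows an evaluation to be the body of a loop. The bound is uniform in the variable values and the
  table contents.\<close>

definition evaluates :: "(track \<Rightarrow> nat set) \<Rightarrow> nat \<Rightarrow> fm \<Rightarrow> nat \<Rightarrow> bool" where
  "evaluates In N a B \<longleftrightarrow> (\<forall>m q h tb. fresh N m q h tb \<longrightarrow>
     exec In N (compile a m q) B (h, tb, False) (h, tb, sem In N m (\<lambda>v. h (V v)) a))"

lemma exec_on_flag_mark:
  assumes "is_head x" "h x \<le> S"
  shows "exec In N (on_flag (mark (Tab t) x) skip) (6 * S + 7) (h, tb, f)
     (h, tb(t := (if f then insert (h x) (tb t) else tb t)), False)"
proof -
  have "exec In N (on_flag (mark (Tab t) x) skip) (6 * S + 4 + 3) (h, tb, f)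
     (h, tb(t := (if f then insert (h x) (tb t) else tb t)), False)"
    using exec_mark[of x h S, OF assms] exec_mono[OF exec_skip]
    by (intro exec_on_flag) auto
  then show ?thesis by (rule exec_mono) simp
qed

lemma exec_on_flag_unmark:
  assumes "is_head x" "h x \<le> S"
  shows "exec In N (on_flag skip (unmark (Tab t) x)) (6 * S + 7) (h, tb, f)
     (h, tb(t := (if f then tb t else tb t - {h x})), False)"
proof -
  have "exec In N (on_flag skip (unmark (Tab t) x)) (6 * S + 4 + 3) (h, tb, f)
     (h, tb(t := (if f then tb t else tb t - {h x})), False)"
    using exec_unmark[of x h S, OF assms] exec_mono[OF exec_skip]
    by (intro exec_on_flag) auto
  then show ?thesis by (rule exec_mono) simp
qed

context
  fixes In :: "track \<Rightarrow> nat set" and N m q k r :: nat and h :: "track \<Rightarrow> nat" and tb :: "nat \<Rightarrow> nat set"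
  assumes fresh: "fresh N m r h tb" and Pq: "h (P q) = 0" "h (P (q + 1)) = 0" and qr: "q + 1 < r"
begin

lemma exec_for_tuples:
  assumes "\<And>y. y < N ^ k \<Longrightarrow> exec In N c B
       ((hset h (map V [m..<m + k]) (dig N k y))(P q := y), tt y, ff y)
       ((hset h (map V [m..<m + k]) (dig N k y))(P q := y), tt (Suc y), ff (Suc y))"
  shows "exec In N (forp (map V [m..<m + k]) (P q) c) (forp_time N k B)
     (h, tt 0, ff 0) (h, tt (N ^ k), ff (N ^ k))"
  using assms Pq fresh by (intro exec_forp) (auto simp: fresh_def distinct_map inj_on_def)

lemma exec_filter_mark:
  assumes "evaluates In N S B"
  shows "exec In N (forp (map V [m..<m + k]) (P q) (compile S (m + k) r ;; on_flag (mark (Tab q) (P q)) skip))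
     (forp_time N k (B + (6 * N ^ k + 7))) (h, tb(q := {}), False)
     (h, tb(q := {y. y < N ^ k \<and> sem In N (m + k) (ext m (dig N k y) (\<lambda>v. h (V v))) S}), False)"
proof -
  let ?s = "\<lambda>y. sem In N (m + k) (ext m (dig N k y) (\<lambda>v. h (V v))) S"
  let ?X = "\<lambda>y. {z. z < y \<and> ?s z}"
  have "exec In N (compile S (m + k) r ;; on_flag (mark (Tab q) (P q)) skip) (B + (6 * N ^ k + 7))
     ((hset h (map V [m..<m + k]) (dig N k y))(P q := y), tb(q := ?X y), False)
     ((hset h (map V [m..<m + k]) (dig N k y))(P q := y), tb(q := ?X (Suc y)), False)"
    if y: "y < N ^ k" for y
  proof -
    let ?H = "(hset h (map V [m..<m + k]) (dig N k y))(P q := y)"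
    have "fresh N (m + k) r ?H (tb(q := ?X y))"
      using fresh dig_tuples[OF y] qr by (intro fresh_tuple) auto
    from assms[unfolded evaluates_def, rule_format, OF this]
    have 1: "exec In N (compile S (m + k) r) B (?H, tb(q := ?X y), False) (?H, tb(q := ?X y), ?s y)"
      by (simp add: hset_V)
    have 2: "exec In N (on_flag (mark (Tab q) (P q)) skip) (6 * N ^ k + 7) (?H, tb(q := ?X y), ?s y)
       (?H, (tb(q := ?X y))(q := (if ?s y then insert (?H (P q)) ((tb(q := ?X y)) q) else (tb(q := ?X y)) q)), False)"
      using y by (intro exec_on_flag_mark) auto
    have "(tb(q := ?X y))(q := (if ?s y then insert (?H (P q)) ((tb(q := ?X y)) q) else (tb(q := ?X y)) q)) =
       tb(q := ?X (Suc y))"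
      by (auto simp: less_Suc_eq intro!: ext)
    with exec_Seq[OF 1 2] show ?thesis by simp
  qed
  from exec_for_tuples[of _ _ "\<lambda>y. tb(q := ?X y)" "\<lambda>y. False", OF this] show ?thesis
    by simp
qed

lemma exec_filter_unmark:
  assumes "evaluates In N T B"
  shows "exec In N (forp (map V [m..<m + k]) (P q) (compile T (m + k) r ;; on_flag skip (unmark (Tab q) (P q))))
     (forp_time N k (B + (6 * N ^ k + 7))) (h, tb(q := X), False)
     (h, tb(q := X - {y. y < N ^ k \<and> \<not> sem In N (m + k) (ext m (dig N k y) (\<lambda>v. h (V v))) T}), False)"
proof -
  let ?s = "\<lambda>y. sem In N (m + k) (ext m (dig N k y) (\<lambda>v. h (V v))) T"
  let ?X = "\<lambda>y. X - {z. z < y \<and> \<not> ?s z}"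
  have "exec In N (compile T (m + k) r ;; on_flag skip (unmark (Tab q) (P q))) (B + (6 * N ^ k + 7))
     ((hset h (map V [m..<m + k]) (dig N k y))(P q := y), tb(q := ?X y), False)
     ((hset h (map V [m..<m + k]) (dig N k y))(P q := y), tb(q := ?X (Suc y)), False)"
    if y: "y < N ^ k" for y
  proof -
    let ?H = "(hset h (map V [m..<m + k]) (dig N k y))(P q := y)"
    have "fresh N (m + k) r ?H (tb(q := ?X y))"
      using fresh dig_tuples[OF y] qr by (intro fresh_tuple) auto
    from assms[unfolded evaluates_def, rule_format, OF this]
    have 1: "exec In N (compile T (m + k) r) B (?H, tb(q := ?X y), False) (?H, tb(q := ?X y), ?s y)"
      by (simp add: hset_V)
    have 2: "exec In N (on_flag skip (unmark (Tab q) (P q))) (6 * N ^ k + 7) (?H, tb(q := ?X y), ?s y)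
       (?H, (tb(q := ?X y))(q := (if ?s y then (tb(q := ?X y)) q else (tb(q := ?X y)) q - {?H (P q)})), False)"
      using y by (intro exec_on_flag_unmark) auto
    have "(tb(q := ?X y))(q := (if ?s y then (tb(q := ?X y)) q else (tb(q := ?X y)) q - {?H (P q)})) =
       tb(q := ?X (Suc y))"
      by (auto simp: less_Suc_eq intro!: ext)
    with exec_Seq[OF 1 2] show ?thesis by simp
  qed
  from exec_for_tuples[of _ _ "\<lambda>y. tb(q := ?X y)" "\<lambda>y. False", OF this] show ?thesis
    by simp
qed

lemma exec_nonempty:
  assumes "X \<subseteq> {..<N ^ k}"
  shows "exec In N (forp (map V [m..<m + k]) (P q) (test (Tab q) (P q) (SetB Flag ;; unmark (Tab q) (P q)) skip))
     (forp_time N k (6 * N ^ k + 4 + (1 + (6 * N ^ k + 4)))) (h, tb(q := X), False) (h, tb(q := {}), X \<noteq> {})"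
proof -
  \<comment> \<open>Before round \<open>y\<close> all entries below \<open>y\<close> are erased, and
    the flag tells whether one of them was marked.\<close>
  let ?X = "\<lambda>y. X - {..<y}" and ?f = "\<lambda>y. \<exists>z\<in>X. z < y"
  have "exec In N (test (Tab q) (P q) (SetB Flag ;; unmark (Tab q) (P q)) skip) (6 * N ^ k + 4 + (1 + (6 * N ^ k + 4)))
     ((hset h (map V [m..<m + k]) (dig N k y))(P q := y), tb(q := ?X y), ?f y)
     ((hset h (map V [m..<m + k]) (dig N k y))(P q := y), tb(q := ?X (Suc y)), ?f (Suc y))"
    if y: "y < N ^ k" for y
  proof (rule exec_test)
    let ?H = "(hset h (map V [m..<m + k]) (dig N k y))(P q := y)"
    assume "?H (P q) \<in> tape In N (?H, tb(q := ?X y), ?f y) (Tab q)"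
    then have "?f (Suc y)" by auto
    moreover have "(tb(q := ?X y))(q := (tb(q := ?X y)) q - {?H (P q)}) = tb(q := ?X (Suc y))"
      by (auto intro!: ext)
    ultimately show "exec In N (SetB Flag ;; unmark (Tab q) (P q)) (1 + (6 * N ^ k + 4))
       (?H, tb(q := ?X y), ?f y) (?H, tb(q := ?X (Suc y)), ?f (Suc y))"
      using exec_Seq[OF exec_set_flag exec_unmark[of "P q" ?H "N ^ k" In N q "tb(q := ?X y)"],
          of "?f y"] y by simp
  next
    let ?H = "(hset h (map V [m..<m + k]) (dig N k y))(P q := y)"
    assume "?H (P q) \<notin> tape In N (?H, tb(q := ?X y), ?f y) (Tab q)"
    then have "y \<notin> X" by auto
    then have "?f (Suc y) = ?f y" "?X (Suc y) = ?X y"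
      by (auto simp: less_Suc_eq)
    then show "exec In N skip (1 + (6 * N ^ k + 4))
       (?H, tb(q := ?X y), ?f y) (?H, tb(q := ?X (Suc y)), ?f (Suc y))"
      by (simp only:) (rule exec_mono[OF exec_skip], simp)
  qed (use y in auto)
  note that = exec_for_tuples[of _ _ "\<lambda>y. tb(q := ?X y)" ?f, OF this]
  show ?thesis
  proof -
    have "?X (N ^ k) = {}" "?f (N ^ k) \<longleftrightarrow> X \<noteq> {}" "?X 0 = X" "?f 0 = False"
      using assms by auto
    with that show ?thesis by simp
  qed
qed

lemma exec_sweep:
  assumes "evaluates In N R B"
  shows "exec In N (forp (map V [m..<m + k]) (P q) (test (Tab q) (P q)
       (forp (map V [m + k..<m + k + k]) (P (q + 1)) (compile R (m + k + k) r ;; on_flag (mark (Tab q) (P (q + 1))) skip)) skip))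
     (forp_time N k (6 * N ^ k + 4 + (1 + forp_time N k (B + (6 * N ^ k + 7))))) (h, tb(q := X), False)
     (h, tb(q := sweep (\<lambda>x y. sem In N (m + k + k) (ext (m + k) (dig N k y) (ext m (dig N k x) (\<lambda>v. h (V v)))) R)
        (N ^ k) (N ^ k) X), False)"
proof -
  let ?R = "\<lambda>x y. sem In N (m + k + k) (ext (m + k) (dig N k y) (ext m (dig N k x) (\<lambda>v. h (V v)))) R"
  let ?bs = "map V [m + k..<m + k + k]"
  let ?inner = "compile R (m + k + k) r ;; on_flag (mark (Tab q) (P (q + 1))) skip"
  let ?S = "\<lambda>x. sweep ?R (N ^ k) x X"
  have "exec In N (test (Tab q) (P q) (forp ?bs (P (q + 1)) ?inner) skip)
       (6 * N ^ k + 4 + (1 + forp_time N k (B + (6 * N ^ k + 7))))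
     ((hset h (map V [m..<m + k]) (dig N k x))(P q := x), tb(q := ?S x), False)
     ((hset h (map V [m..<m + k]) (dig N k x))(P q := x), tb(q := ?S (Suc x)), False)"
    if x: "x < N ^ k" for x
  proof (rule exec_test)
    let ?H = "(hset h (map V [m..<m + k]) (dig N k x))(P q := x)"
    assume "?H (P q) \<in> tape In N (?H, tb(q := ?S x), False) (Tab q)"
    then have mem: "x \<in> ?S x" by simp
    \<comment> \<open>Row \<open>x\<close> after its targets below \<open>y\<close> have been
      treated; at \<open>y = N ^ k\<close> this is the next stage of \<open>sweep\<close>.\<close>
    let ?X = "\<lambda>y. ?S x \<union> {z. z < y \<and> ?R x z}"
    have freshH: "fresh N (m + k) r ?H tb"
      using fresh_tuple[OF fresh dig_tuples[OF x], where t = q and X = "tb q" and r = q and q' = r] qr by simp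
    have "exec In N ?inner (B + (6 * N ^ k + 7))
       ((hset ?H ?bs (dig N k y))(P (q + 1) := y), tb(q := ?X y), False)
       ((hset ?H ?bs (dig N k y))(P (q + 1) := y), tb(q := ?X (Suc y)), False)" if y: "y < N ^ k" for y
    proof -
      let ?K = "(hset ?H ?bs (dig N k y))(P (q + 1) := y)"
      have "fresh N (m + k + k) r ?K (tb(q := ?X y))"
        using freshH dig_tuples[OF y] qr by (intro fresh_tuple) auto
      moreover have "(\<lambda>v. ?K (V v)) = ext (m + k) (dig N k y) (ext m (dig N k x) (\<lambda>v. h (V v)))"
        using hset_V[of "dig N k y" k ?H "m + k"] hset_V[of "dig N k x" k h m] by simp
      ultimately have 1: "exec In N (compile R (m + k + k) r) B (?K, tb(q := ?X y), False) (?K, tb(q := ?X y), ?R x y)"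
        using assms[unfolded evaluates_def, rule_format, of "m + k + k" r ?K "tb(q := ?X y)"] by simp
      have 2: "exec In N (on_flag (mark (Tab q) (P (q + 1))) skip) (6 * N ^ k + 7) (?K, tb(q := ?X y), ?R x y)
         (?K, (tb(q := ?X y))(q := (if ?R x y then insert (?K (P (q + 1))) ((tb(q := ?X y)) q) else (tb(q := ?X y)) q)), False)"
        using y by (intro exec_on_flag_mark) auto
      have "(tb(q := ?X y))(q := (if ?R x y then insert (?K (P (q + 1))) ((tb(q := ?X y)) q) else (tb(q := ?X y)) q)) =
         tb(q := ?X (Suc y))"
        by (auto simp: less_Suc_eq intro!: ext)
      with exec_Seq[OF 1 2] show ?thesis by simp
    qed
    moreover have "\<forall>x\<in>set ?bs. is_head x \<and> ?H x = 0" "?H (P (q + 1)) = 0"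
      using freshH Pq by (auto simp: fresh_def hset_other)
    ultimately have "exec In N (forp ?bs (P (q + 1)) ?inner) (forp_time N k (B + (6 * N ^ k + 7)))
       (?H, tb(q := ?X 0), False) (?H, tb(q := ?X (N ^ k)), False)"
      using exec_forp[of ?bs ?H "P (q + 1)" k N In ?inner _ "\<lambda>y. tb(q := ?X y)" "\<lambda>y. False"]
      by (auto simp: distinct_map inj_on_def)
    with mem show "exec In N (forp ?bs (P (q + 1)) ?inner) (1 + forp_time N k (B + (6 * N ^ k + 7)))
       (?H, tb(q := ?S x), False) (?H, tb(q := ?S (Suc x)), False)"
      by simp (erule exec_mono, simp)
  next
    let ?H = "(hset h (map V [m..<m + k]) (dig N k x))(P q := x)"
    assume "?H (P q) \<notin> tape In N (?H, tb(q := ?S x), False) (Tab q)"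
    then show "exec In N skip (1 + forp_time N k (B + (6 * N ^ k + 7)))
       (?H, tb(q := ?S x), False) (?H, tb(q := ?S (Suc x)), False)"
      by simp (rule exec_mono[OF exec_skip], simp)
  qed (use x in auto)
  from exec_for_tuples[of _ _ "\<lambda>x. tb(q := ?S x)" "\<lambda>x. False", OF this] show ?thesis
    by simp
qed

end

lemma evaluates_Reach:
  assumes "evaluates In N S BS" "evaluates In N R BR" "evaluates In N T BT"
  shows "evaluates In N (Reach k S R T)
     (forp_time N k (BS + (6 * N ^ k + 7)) +
      ((loop_time N ^^ (k + k)) (forp_time N k (6 * N ^ k + 4 + (1 + forp_time N k (BR + (6 * N ^ k + 7))))) +
       (forp_time N k (BT + (6 * N ^ k + 7)) +
        forp_time N k (6 * N ^ k + 4 + (1 + (6 * N ^ k + 4))))))"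
  unfolding evaluates_def
proof (intro allI impI)
  fix m q h tb
  assume fresh: "fresh N m q h tb"
  let ?e = "\<lambda>v. h (V v)" and ?M = "N ^ k" and ?r = "q + 2 + (k + k)"
  let ?s = "\<lambda>as. sem In N (m + k) (ext m as ?e) S" and ?t = "\<lambda>as. sem In N (m + k) (ext m as ?e) T"
  let ?R = "\<lambda>as bs. sem In N (m + k + k) (ext (m + k) bs (ext m as ?e)) R"
  let ?Rd = "\<lambda>x y. ?R (dig N k x) (dig N k y)"
  have fresh': "fresh N m ?r h tb" and hq: "h (P q) = 0" "h (P (q + 1)) = 0" and tb: "tb(q := {}) = tb"
    using fresh by (auto simp: fresh_def fun_upd_idem)
  have qr: "q + 1 < ?r" by simp
  note ctx = fresh' hq qr
  define X1 where "X1 = {y. y < ?M \<and> ?s (dig N k y)}"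
  define X2 where "X2 = (sweep ?Rd ?M ?M ^^ (?M * ?M)) X1"
  define X3 where "X3 = X2 - {y. y < ?M \<and> \<not> ?t (dig N k y)}"
  let ?rs = "map P [q + 2..<?r]"
  let ?round = "forp (map V [m..<m + k]) (P q) (test (Tab q) (P q)
       (forp (map V [m + k..<m + k + k]) (P (q + 1)) (compile R (m + k + k) ?r ;; on_flag (mark (Tab q) (P (q + 1))) skip)) skip)"
  let ?BR = "forp_time N k (6 * N ^ k + 4 + (1 + forp_time N k (BR + (6 * N ^ k + 7))))"
  have "exec In N ?round ?BR
      (hset h ?rs (dig N (k + k) y), tb(q := (sweep ?Rd ?M ?M ^^ y) X1), False)
      (hset h ?rs (dig N (k + k) y), tb(q := (sweep ?Rd ?M ?M ^^ Suc y) X1), False)"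
    if "y < N ^ (k + k)" for y
  proof -
    define H where "H = hset h ?rs (dig N (k + k) y)"
    have V: "H (V v) = h (V v)" for v
      unfolding H_def by (rule hset_other) auto
    \<comment> \<open>A sweep asks for freshness only from \<open>?r\<close> on and for
      \<open>P q\<close> and \<open>P (q + 1)\<close> at 0, so the counters in between may stand
      anywhere.\<close>
    have "H (P i) = h (P i)" if "i < q + 2 \<or> ?r \<le> i" for i
      unfolding H_def using that by (intro hset_other) auto
    then have "fresh N m ?r H tb" "H (P q) = 0" "H (P (q + 1)) = 0"
      using fresh' hq by (auto simp: fresh_def V)
    from exec_sweep[OF this qr assms(2), where X = "(sweep ?Rd ?M ?M ^^ y) X1"] show ?thesis
      unfolding H_def[symmetric] by (simp add: V)
  qed
  note round = this
  have rs: "distinct ?rs" "\<forall>x\<in>set ?rs. is_head x" "length ?rs = k + k"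
    by (auto simp: distinct_map inj_on_def)
  have "h x = 0" if "x \<in> set ?rs" for x
    using that fresh by (auto simp: fresh_def)
  from hset_zero[of ?rs h, OF this] have "hset h ?rs (replicate (k + k) 0) = h"
    unfolding rs(3) by simp
  \<comment> \<open>The counters run through \<open>N ^ (k + k) = ?M * ?M\<close> rounds, the number
    of sweeps after which the closure is complete.\<close>
  with exec_fors[of ?rs N In ?round ?BR "\<lambda>y. h" "\<lambda>y. tb(q := (sweep ?Rd ?M ?M ^^ y) X1)"
      "\<lambda>y. False", OF rs(1,2), unfolded rs(3), OF round]
  have "exec In N (fors ?rs ?round) ((loop_time N ^^ (k + k)) ?BR)
     (h, tb(q := X1), False) (h, tb(q := X2), False)"
    unfolding X2_def power_add by simp
  moreover have X1: "X1 \<subseteq> {..<?M}"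
    by (auto simp: X1_def)
  then have X2: "X2 = {(x, y). x < ?M \<and> y < ?M \<and> ?Rd x y}\<^sup>* `` X1"
    unfolding X2_def by (rule sweeps_reach)
  then have "X2 \<subseteq> {..<?M}"
    using X1 by (auto elim: rtranclE)
  then have "X3 \<subseteq> {..<?M}"
    by (auto simp: X3_def)
  ultimately have *: "exec In N (compile (Reach k S R T) m q)
     (forp_time N k (BS + (6 * N ^ k + 7)) +
      ((loop_time N ^^ (k + k)) ?BR + (forp_time N k (BT + (6 * N ^ k + 7)) +
        forp_time N k (6 * N ^ k + 4 + (1 + (6 * N ^ k + 4))))))
     (h, tb, False) (h, tb, X3 \<noteq> {})"
    using exec_filter_mark[OF ctx assms(1), of k, folded X1_def]
      exec_filter_unmark[OF ctx assms(3), of k X2, folded X3_def] exec_nonempty[OF ctx, of X3 k]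
    unfolding compile.simps Let_def tb by (intro exec_Seq)
  have "X3 \<noteq> {} \<longleftrightarrow> sem In N m ?e (Reach k S R T)"
  proof
    assume "X3 \<noteq> {}"
    then obtain x y where "x \<in> X1" "(x, y) \<in> {(x, y). x < ?M \<and> y < ?M \<and> ?Rd x y}\<^sup>*" "y \<in> X3"
      by (auto simp: X3_def X2)
    moreover from this have "x < ?M" "y < ?M" "?s (dig N k x)" "?t (dig N k y)"
      using \<open>X3 \<subseteq> {..<?M}\<close> by (auto simp: X1_def X3_def)
    ultimately show "sem In N m ?e (Reach k S R T)"
      using rtrancl_dig[of x N k y ?R] dig_tuples[of x N k] dig_tuples[of y N k] by auto
  next
    assume "sem In N m ?e (Reach k S R T)"
    then obtain as bs where as: "as \<in> tuples N k" "?s as" "?t bs"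
      "(as, bs) \<in> {(as, bs). as \<in> tuples N k \<and> bs \<in> tuples N k \<and> ?R as bs}\<^sup>*"
      by auto
    obtain x where x: "x < ?M" "dig N k x = as"
      using tuples_dig[OF as(1)] by auto
    from rtrancl_tuples[OF as(4) x(2,1)] obtain y where "y < ?M" "dig N k y = bs"
      "(x, y) \<in> {(x, y). x < ?M \<and> y < ?M \<and> ?Rd x y}\<^sup>*"
      by auto
    then have "y \<in> X3"
      using x as by (auto simp: X3_def X2 X1_def)
    then show "X3 \<noteq> {}" by auto
  qed
  with * show "exec In N (compile (Reach k S R T) m q)
     (forp_time N k (BS + (6 * N ^ k + 7)) +
      ((loop_time N ^^ (k + k)) ?BR + (forp_time N k (BT + (6 * N ^ k + 7)) +
        forp_time N k (6 * N ^ k + 4 + (1 + (6 * N ^ k + 4))))))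
     (h, tb, False) (h, tb, sem In N m ?e (Reach k S R T))"
    by simp
qed

lemma evaluates_poly: "\<exists>B. polyb B \<and> (\<forall>In N. evaluates In N a (B N))"
proof (induction a)
  case (At i v)
  have "evaluates In N (At i v) (6 * N + 4 + 1)" for In N
    unfolding evaluates_def
  proof (intro allI impI)
    fix m q h tb
    assume "fresh N m q h tb"
    then show "exec In N (compile (At i v) m q) (6 * N + 4 + 1) (h, tb, False) (h, tb, sem In N m (\<lambda>v. h (V v)) (At i v))"
      using exec_set_flag[of In N h tb False] exec_skip[of In N "(h, tb, False)"]
      unfolding compile.simps by (intro exec_test) (auto simp: fresh_def inp_def split: if_splits)
  qed
  then show ?case
    by (intro exI[of _ "\<lambda>N. 6 * N + 4 + 1"]) (auto intro!: polybs)
next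
  case (Le v u)
  have "evaluates In N (Le v u) (6 * N + 4 + 1)" for In N
    unfolding evaluates_def
  proof (intro allI impI)
    fix m q h tb
    assume "fresh N m q h tb"
    then show "exec In N (compile (Le v u) m q) (6 * N + 4 + 1) (h, tb, False) (h, tb, sem In N m (\<lambda>v. h (V v)) (Le v u))"
      using exec_set_flag[of In N h tb False] exec_skip[of In N "(h, tb, False)"]
      unfolding compile.simps by (intro exec_test_le) (auto simp: fresh_def)
  qed
  then show ?case
    by (intro exI[of _ "\<lambda>N. 6 * N + 4 + 1"]) (auto intro!: polybs)
next
  case (Neg a)
  then obtain B where "polyb B" "\<And>In N. evaluates In N a (B N)" by auto
  then show ?case
    by (intro exI[of _ "\<lambda>N. B N + 3"])
      (auto simp: evaluates_def intro!: polybs exec_Seq[OF _ exec_negate_flag])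
next
  case (Conj a b)
  then obtain A B where *: "polyb A" "\<And>In N. evaluates In N a (A N)"
    "polyb B" "\<And>In N. evaluates In N b (B N)" by auto
  have "evaluates In N (Conj a b) (A N + ((B N + 1) + 3))" for In N
    unfolding evaluates_def
  proof (intro allI impI)
    fix m q h tb
    assume "fresh N m q h tb"
    then have "exec In N (compile a m q) (A N) (h, tb, False) (h, tb, sem In N m (\<lambda>v. h (V v)) a)"
      "exec In N (compile b m q) (B N) (h, tb, False) (h, tb, sem In N m (\<lambda>v. h (V v)) b)"
      using *(2,4) by (auto simp: evaluates_def)
    moreover from this(2) have "exec In N (on_flag (compile b m q) skip) ((B N + 1) + 3)
       (h, tb, sem In N m (\<lambda>v. h (V v)) a) (h, tb, sem In N m (\<lambda>v. h (V v)) (Conj a b))"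
      using exec_skip[of In N "(h, tb, False)"] by (intro exec_on_flag) (auto elim: exec_mono)
    ultimately show "exec In N (compile (Conj a b) m q) (A N + ((B N + 1) + 3))
       (h, tb, False) (h, tb, sem In N m (\<lambda>v. h (V v)) (Conj a b))"
      by (auto intro: exec_Seq)
  qed
  with * show ?case
    by (intro exI[of _ "\<lambda>N. A N + ((B N + 1) + 3)"]) (auto intro!: polybs)
next
  case (Reach k S R T)
  then obtain A B C where *: "polyb A" "\<And>In N. evaluates In N S (A N)"
    "polyb B" "\<And>In N. evaluates In N R (B N)" "polyb C" "\<And>In N. evaluates In N T (C N)" by auto
  show ?case
    by (rule exI, rule conjI[rotated], rule allI, rule allI, rule evaluates_Reach[OF *(2,4,6)])
      (intro polybs *)
qed

subsection \<open>From sentences to polynomial-time machines\<close>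

definition word_tracks :: "nat list \<Rightarrow> track \<Rightarrow> nat set" where
  "word_tracks w x = {i. i < length w \<and> bit (w ! i) (tnum x)}"

text \<open>Every input symbol has one of its three low bits set and a blank has none, so the search
  halts on the first cell behind the word.\<close>

definition init :: "track list \<Rightarrow> prog" where
  "init hs = SetB Origin ;; foldr (\<lambda>x c. SetB x ;; c) hs
     (While True [I0, I1, I2] MvR ;; SetB Limit ;; home)"

lemma runs_sets:
  "runs c (0, \<lambda>x. if x \<in> set hs then insert 0 (G x) else G x) B s' \<Longrightarrow>
    runs (foldr (\<lambda>x c. SetB x ;; c) hs c) (0, G) (length hs + B) s'"
proof (induction hs arbitrary: G)
  case (Cons x hs)
  have "(\<lambda>y. if y \<in> set hs then insert 0 ((G(x := insert 0 (G x))) y) else (G(x := insert 0 (G x))) y) =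
      (\<lambda>y. if y \<in> set (x # hs) then insert 0 (G y) else G y)"
    by (auto simp: fun_eq_iff)
  with Cons have "runs (foldr (\<lambda>x c. SetB x ;; c) hs c) (0, G(x := insert 0 (G x))) (length hs + B) s'"
    by simp
  from runs_Seq[OF runs_SetB this] show ?case
    by simp
qed simp

lemma bit_symbol:
  assumes "s \<in> {1, 2, 3, 4 :: nat}"
  shows "(\<exists>x\<in>set [I0, I1, I2]. bit s (tnum x))" "3 \<le> j \<Longrightarrow> \<not> bit s j"
proof -
  show "\<exists>x\<in>set [I0, I1, I2]. bit s (tnum x)"
    using assms by (auto simp: bit_iff_odd)
  assume "3 \<le> j"
  then have "(2::nat) ^ 3 \<le> 2 ^ j"
    by (intro power_increasing) auto
  then have "s div 2 ^ j = 0"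
    using assms by auto
  then show "\<not> bit s j"
    by (simp add: bit_iff_odd)
qed

text \<open>Only finitely many heads can be placed, whereas \<open>tape\<close> prescribes a mark
  for every index. Tracks from \<open>D\<close> on are not represented on the machine's tape, so
  they are given their target contents from the start.\<close>

lemma runs_init:
  assumes w: "set w \<subseteq> {1, 2, 3, 4}"
    and hs: "set hs = {x. is_head x \<and> tnum x < D}" and D: "6 \<le> D"
  defines "target \<equiv> tape (word_tracks w) (length w) (\<lambda>x. 0, \<lambda>t. {}, False)"
  shows "runs (init hs) (0, \<lambda>x. if tnum x < D then word_tracks w x else target x)
     (6 * length w + length hs + 4) (0, target)"
proof -
  let ?n = "length w" and ?xs = "[I0, I1, I2]"
  let ?G = "\<lambda>x. if tnum x < D then word_tracks w x else target x"
  let ?G1 = "?G(Origin := insert 0 (?G Origin))"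
  let ?G2 = "\<lambda>x. if x \<in> set hs then insert 0 (?G1 x) else ?G1 x"
  have "?G2 x = word_tracks w x" if "x \<in> set ?xs" for x
    using that D by (auto simp: hs is_head_def)
  then have "(\<exists>x\<in>set ?xs. i \<in> ?G2 x) \<longleftrightarrow> (\<exists>x\<in>set ?xs. i \<in> word_tracks w x)" for i
    by (intro bex_cong) auto
  moreover have "(\<exists>x\<in>set ?xs. i \<in> word_tracks w x) \<longleftrightarrow> i < ?n" for i
  proof
    assume "i < ?n"
    then have "w ! i \<in> {1, 2, 3, 4}"
      using w nth_mem by blast
    from bit_symbol(1)[OF this] \<open>i < ?n\<close> show "\<exists>x\<in>set ?xs. i \<in> word_tracks w x"
      unfolding word_tracks_def by blast
  qed (auto simp: word_tracks_def)
  ultimately have bits: "(\<exists>x\<in>set ?xs. i \<in> ?G2 x) \<longleftrightarrow> i < ?n" for i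
    by blast
  \<comment> \<open>Input symbols are below 8, so no track beyond the first three carries a mark
    initially.\<close>
  have empty: "word_tracks w x = {}" if "3 \<le> tnum x" for x
  proof -
    have "\<not> bit (w ! i) (tnum x)" if "i < ?n" for i
      using bit_symbol(2)[of "w ! i" "tnum x"] \<open>3 \<le> tnum x\<close> nth_mem[OF that] w by blast
    then show ?thesis
      by (auto simp: word_tracks_def)
  qed
  have G2: "?G2(Limit := insert ?n (?G2 Limit)) = target"
  proof
    fix x
    show "(?G2(Limit := insert ?n (?G2 Limit))) x = target x"
      using empty[of x] D by (cases x) (auto simp: hs target_def tape.simps is_head_def)
  qed
  have "runs (While True ?xs MvR) (0, ?G2) (3 * (?n - 0) + 1) (?n, ?G2)"
    by (intro runs_search) (simp_all only: bits, auto)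
  from runs_Seq[OF this runs_Seq[OF runs_SetB[of Limit ?n ?G2, unfolded G2] runs_home[of target ?n]]]
  have "runs (While True ?xs MvR ;; SetB Limit ;; home) (0, ?G2) (3 * (?n - 0) + 1 + (1 + (3 * ?n + 1))) (0, target)"
    by (simp add: target_def)
  from runs_Seq[OF runs_SetB runs_sets[OF this]]
  show ?thesis
    unfolding init_def by (rule runs_mono) simp
qed

lemma decides_within_mono: "decides_within M w T b \<Longrightarrow> T \<le> T' \<Longrightarrow> decides_within M w T' b"
  unfolding decides_within_def by (meson order_trans)

theorem sentence_decidable:
  "\<exists>M c d. valid_tm M \<and> (\<forall>w. set w \<subseteq> {1, 2, 3, 4} \<longrightarrow>
     decides_within M w (c * (length w + 1) ^ d) (sem (word_tracks w) (length w) 0 (\<lambda>v. 0) a))"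
proof -
  obtain B where B: "polyb B" "\<And>In N. evaluates In N a (B N)"
    using evaluates_poly by blast
  define main where "main = compile a 0 0"
  \<comment> \<open>The 5 is the number of \<open>Limit\<close>: all fixed tracks then lie below
    \<open>D\<close>, whatever \<open>main\<close> uses.\<close>
  define D where "D = Max (insert 5 (tnum ` tracks main)) + 1"
  have fin: "finite (insert 5 (tnum ` tracks main))"
    by (simp add: finite_tracks)
  have D: "6 \<le> D" "\<forall>x\<in>tracks main. tnum x < D"
    using Max_ge[OF fin, of 5] Max_ge[OF fin] unfolding D_def by (simp, auto simp: less_Suc_eq_le)
  define hs where "hs = filter (\<lambda>x. tnum x < D) (map V [0..<D] @ map P [0..<D])"
  have hs: "set hs = {x. is_head x \<and> tnum x < D}"
    by (auto simp: hs_def is_head_def)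
  let ?c = "init hs ;; main"
  have "tracks (foldr (\<lambda>x c. SetB x ;; c) xs c) = set xs \<union> tracks c" for xs c
    by (induction xs) auto
  then have tracks: "\<forall>x\<in>tracks ?c. tnum x < D"
    using D hs by (auto simp: init_def)
  have decides: "decides_within (machine D ?c) w (6 * length w + length hs + 5 + B (length w))
      (sem (word_tracks w) (length w) 0 (\<lambda>v. 0) a)" if w: "set w \<subseteq> {1, 2, 3, 4}" for w
  proof -
    let ?target = "tape (word_tracks w) (length w) (\<lambda>x. 0, \<lambda>t. {}, False)"
    let ?sem = "sem (word_tracks w) (length w) 0 (\<lambda>v. 0) a"
    let ?G = "\<lambda>x. if tnum x < D then word_tracks w x else ?target x"
    have "exec (word_tracks w) (length w) main (B (length w)) (\<lambda>x. 0, \<lambda>t. {}, False)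
       (\<lambda>x. 0, \<lambda>t. {}, ?sem)"
      using B(2)[of "word_tracks w" "length w", unfolded evaluates_def, rule_format, of 0 0 "\<lambda>x. 0" "\<lambda>t. {}"]
      by (simp add: fresh_def main_def)
    from runs_Seq[OF runs_init[OF w hs D(1)] this[unfolded exec_def]]
    obtain t where t: "t \<le> 6 * length w + length hs + 4 + B (length w)"
      "run ?c (0, ?G) t (0, tape (word_tracks w) (length w) (\<lambda>x. 0, \<lambda>t. {}, ?sem))"
      by (auto simp: runs_def)
    have "decides_within (machine D ?c) w (Suc t)
       (0 \<in> tape (word_tracks w) (length w) (\<lambda>x. 0, \<lambda>t. {}, ?sem) Flag)"
      using D by (intro machine_decides[OF t(2) tracks]) (auto simp: word_tracks_def)
    then have "decides_within (machine D ?c) w (Suc t) ?sem"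
      by (simp split: if_splits)
    then show ?thesis
      by (rule decides_within_mono) (use t(1) in simp)
  qed
  have "polyb (\<lambda>n. 6 * n + length hs + 5 + B n)"
    by (intro polybs B)
  then obtain c d where cd: "\<And>n. 6 * n + length hs + 5 + B n \<le> c * (n + 1) ^ d"
    unfolding polyb_def by blast
  have "valid_tm (machine D ?c)"
    using D by (intro valid_machine) auto
  moreover have "decides_within (machine D ?c) w (c * (length w + 1) ^ d)
      (sem (word_tracks w) (length w) 0 (\<lambda>v. 0) a)" if "set w \<subseteq> {1, 2, 3, 4}" for w
    using decides[OF that] cd by (rule decides_within_mono)
  ultimately show ?thesis by blast
qed

subsection \<open>The stack-up problem as a formula\<close>

text \<open>A closure over the empty step relation: only the start tuple itself is reached, and
  \<open>Le 0 0\<close> is the constant truth.\<close>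

definition Exists :: "fm \<Rightarrow> fm" where
  "Exists a = Reach 1 a (Neg (Le 0 0)) (Le 0 0)"

definition Disj :: "fm \<Rightarrow> fm \<Rightarrow> fm" where
  "Disj a b = Neg (Conj (Neg a) (Neg b))"

definition Conjs :: "fm list \<Rightarrow> fm" where
  "Conjs as = foldr Conj as (Le 0 0)"

definition Disjs :: "fm list \<Rightarrow> fm" where
  "Disjs as = Neg (Conjs (map Neg as))"

definition Less :: "nat \<Rightarrow> nat \<Rightarrow> fm" where
  "Less v u = Neg (Le u v)"

definition Eq :: "nat \<Rightarrow> nat \<Rightarrow> fm" where
  "Eq v u = Conj (Le v u) (Le u v)"

definition Succ :: "nat \<Rightarrow> nat \<Rightarrow> nat \<Rightarrow> fm" where
  "Succ m v u = Conj (Less v u) (Neg (Exists (Conj (Less v m) (Less m u))))"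

definition Zero :: "nat \<Rightarrow> nat \<Rightarrow> fm" where
  "Zero m v = Neg (Exists (Less m v))"

definition Lit :: "nat \<Rightarrow> nat \<Rightarrow> nat \<Rightarrow> fm" where
  "Lit s i v = (if bit s i then At i v else Neg (At i v))"

definition Sym :: "nat \<Rightarrow> nat \<Rightarrow> fm" where
  "Sym s v = Conj (Lit s 0 v) (Conj (Lit s 1 v) (Lit s 2 v))"

text \<open>The numbers of the bins starting at \<open>v\<close> and \<open>u\<close> are read in parallel until both of them end.\<close>
definition Same :: "nat \<Rightarrow> nat \<Rightarrow> nat \<Rightarrow> fm" where
  "Same m v u = (let m1 = Suc m; m2 = Suc m1; m3 = Suc m2; m4 = Suc m3;
       ended = (\<lambda>x. Neg (Exists (Conj (Succ m3 x m2) (Disj (Sym 1 m2) (Sym 2 m2))))) in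
     Reach 2 (Conj (Eq m v) (Eq m1 u))
       (Conj (Conj (Succ m4 m m2) (Succ m4 m1 m3))
          (Disj (Conj (Sym 1 m2) (Sym 1 m3)) (Conj (Sym 2 m2) (Sym 2 m3))))
       (Conj (ended m) (ended m1)))"

definition Double :: "nat \<Rightarrow> nat \<Rightarrow> nat \<Rightarrow> fm" where
  "Double m v u = (let m1 = Suc m; m2 = Suc m1; m3 = Suc m2; m4 = Suc m3; m5 = Suc m4 in
     Reach 2 (Conj (Zero m2 m) (Zero m2 m1))
       (Conj (Succ m4 m m2) (Exists (Conj (Succ m5 m1 m4) (Succ m5 m4 m3))))
       (Conj (Eq m v) (Eq m1 u)))"

text \<open>The bits of the parameter are read from the most significant one on; values that do not fit into
  the universe are larger than \<open>v\<close> anyway.\<close>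
definition Param_less :: "nat \<Rightarrow> nat \<Rightarrow> fm" where
  "Param_less m v = (let m1 = Suc m; m2 = Suc m1; m3 = Suc m2; m4 = Suc m3; m5 = Suc m4 in
     Reach 2 (Conj (Conj (Sym 4 m) (Neg (Exists (Conj (Less m2 m) (Sym 4 m2))))) (Zero m2 m1))
       (Conj (Succ m4 m2 m)
          (Exists (Conj (Double m5 m1 m4) (Disj (Conj (Sym 1 m2) (Eq m3 m4)) (Conj (Sym 2 m2) (Succ m5 m4 m3))))))
       (Conj (Zero m2 m) (Less m1 v)))"

text \<open>The pair consists of a position and the count up to it. A step judges the position that
  it enters, so position 0 is not judged; the walk must end on the last position.\<close>

definition Count :: "(nat \<Rightarrow> nat \<Rightarrow> fm) \<Rightarrow> nat \<Rightarrow> nat \<Rightarrow> fm" where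
  "Count a m v = (let m1 = Suc m; m2 = Suc m1; m3 = Suc m2; m4 = Suc m3 in
     Reach 2 (Conj (Zero m2 m) (Zero m2 m1))
       (Conj (Succ m4 m m2)
          (Disj (Conj (a m4 m2) (Succ m4 m1 m3)) (Conj (Neg (a m4 m2)) (Eq m1 m3))))
       (Conj (Neg (Exists (Succ (Suc m2) m m2))) (Eq m1 v)))"

text \<open>In the tuple stored from variable \<open>b\<close> on, entry \<open>j\<close> is the position of the last symbol of
  sequence \<open>j\<close> that has been consumed, initially the position of its sequence separator.\<close>
definition Removed :: "nat \<Rightarrow> nat \<Rightarrow> nat \<Rightarrow> nat \<Rightarrow> fm" where
  "Removed k b m v = Disjs (map (\<lambda>j. Conj (Le v (b + j))
      (Neg (Exists (Conj (Less v m) (Conj (Le m (b + j)) (Sym 4 m)))))) [0..<k])"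

text \<open>A representative of an open pallet: the first removed bin in the word with its number,
  provided that another bin with this number remains. Two different representatives carry different
  numbers, so counting them counts open pallets.\<close>

definition Opener :: "nat \<Rightarrow> nat \<Rightarrow> nat \<Rightarrow> nat \<Rightarrow> fm" where
  "Opener k b m v = Conj (Conj (Sym 3 v) (Removed k b m v)) (Conj
     (Neg (Exists (Conj (Less m v) (Conj (Conj (Sym 3 m) (Removed k b (Suc m) m)) (Same (Suc m) m v)))))
     (Exists (Conj (Conj (Sym 3 m) (Neg (Removed k b (Suc m) m))) (Same (Suc m) m v))))"

definition Few_open :: "nat \<Rightarrow> nat \<Rightarrow> nat \<Rightarrow> fm" where
  "Few_open k b m = Exists (Conj (Count (Opener k b) (Suc m) m) (Neg (Param_less (Suc m) m)))"

text \<open>A code contains exactly \<open>k\<close> sequence separators, so \<open>k\<close>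
  increasing separator positions can only be the initial tuple. The bound is tested on the tuple
  that a step enters; initially no pallet is open. \<open>Le 0 0\<close> exempts the moved entry
  from the equalities.\<close>

definition Problem :: "nat \<Rightarrow> fm" where
  "Problem k = Reach k
     (Conj (Conjs (map (Sym 4) [0..<k])) (Conjs (map (\<lambda>j. Less j (Suc j)) [0..<k - 1])))
     (Conj (Few_open k k (k + k)) (Disjs (map (\<lambda>j. Conj (Conj (Succ (k + k) j (k + j)) (Neg (Sym 4 (k + j))))
        (Conjs (map (\<lambda>l. if l = j then Le 0 0 else Eq l (k + l)) [0..<k]))) [0..<k])))
     (Conjs (map (\<lambda>j. Neg (Exists (Conj (Succ (Suc k) j k) (Neg (Sym 4 k))))) [0..<k]))"

section \<open>Meaning of the formulas on words\<close>

definition block :: "nat list \<Rightarrow> nat \<Rightarrow> nat list" where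
  "block w x = takeWhile (\<lambda>s. s \<le> 2) (drop (Suc x) w)"

text \<open>The absence of a separator after \<open>s\<close> up to the entry forces both into the
  same sequence, so an entry of a later sequence does not count.\<close>

definition removed :: "nat list \<Rightarrow> nat list \<Rightarrow> nat \<Rightarrow> bool" where
  "removed w is s \<longleftrightarrow> (\<exists>j<length is. s \<le> is ! j \<and> (\<forall>u. s < u \<and> u \<le> is ! j \<longrightarrow> w ! u \<noteq> 4))"

definition opener :: "nat list \<Rightarrow> nat list \<Rightarrow> nat \<Rightarrow> bool" where
  "opener w is s \<longleftrightarrow> w ! s = 3 \<and> removed w is s \<and>
     \<not> (\<exists>u<s. w ! u = 3 \<and> removed w is u \<and> block w u = block w s) \<and>
     (\<exists>u<length w. w ! u = 3 \<and> \<not> removed w is u \<and> block w u = block w s)"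

definition start_tuple :: "nat list \<Rightarrow> nat list \<Rightarrow> bool" where
  "start_tuple w as \<longleftrightarrow> (\<forall>j<length as. w ! (as ! j) = 4) \<and> (\<forall>j. Suc j < length as \<longrightarrow> as ! j < as ! Suc j)"

definition move_tuple :: "nat list \<Rightarrow> nat list \<Rightarrow> nat list \<Rightarrow> bool" where
  "move_tuple w as bs \<longleftrightarrow> (\<exists>j<length as. bs = as[j := Suc (as ! j)] \<and> w ! Suc (as ! j) \<noteq> 4)"

definition final_tuple :: "nat list \<Rightarrow> nat list \<Rightarrow> bool" where
  "final_tuple w as \<longleftrightarrow> (\<forall>j<length as. Suc (as ! j) < length w \<longrightarrow> w ! Suc (as ! j) = 4)"

definition few_open :: "nat list \<Rightarrow> nat \<Rightarrow> nat list \<Rightarrow> bool" where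
  "few_open w p as \<longleftrightarrow> card {s. s < length w \<and> opener w as s} \<le> p"

lemma tuples_Suc: "tuples N (Suc k) = {a # as |a as. a < N \<and> as \<in> tuples N k}"
proof (intro set_eqI iffI)
  fix as assume "as \<in> tuples N (Suc k)"
  then show "as \<in> {a # as |a as. a < N \<and> as \<in> tuples N k}"
    by (cases as) (auto simp: tuples_def)
qed (auto simp: tuples_def)

lemma tuples_0: "tuples N 0 = {[]}"
  by (auto simp: tuples_def)

lemma sem_Conjs [simp]: "sem In N m e (Conjs as) \<longleftrightarrow> (\<forall>a\<in>set as. sem In N m e a)"
  by (induction as) (auto simp: Conjs_def)

lemma sem_Disjs [simp]: "sem In N m e (Disjs as) \<longleftrightarrow> (\<exists>a\<in>set as. sem In N m e a)"
  by (simp add: Disjs_def)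

lemma sem_Disj [simp]: "sem In N m e (Disj a b) \<longleftrightarrow> sem In N m e a \<or> sem In N m e b"
  by (simp add: Disj_def)

lemma sem_Exists [simp]: "sem In N m e (Exists a) \<longleftrightarrow> (\<exists>i<N. sem In N (Suc m) (e(m := i)) a)"
  by (auto simp: Exists_def tuples_Suc tuples_0)

lemma sem_Less [simp]: "sem In N m e (Less v u) \<longleftrightarrow> e v < e u"
  by (auto simp: Less_def)

lemma sem_Eq [simp]: "sem In N m e (Eq v u) \<longleftrightarrow> e v = e u"
  by (auto simp: Eq_def)

lemma sem_Succ [simp]:
  "v < m \<Longrightarrow> u < m \<Longrightarrow> e u < N \<Longrightarrow> sem In N m e (Succ m v u) \<longleftrightarrow> e u = Suc (e v)"
  by (auto simp: Succ_def)

lemma sem_Zero [simp]: "v < m \<Longrightarrow> e v < N \<Longrightarrow> sem In N m e (Zero m v) \<longleftrightarrow> e v = 0"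
  by (auto simp: Zero_def)

section \<open>Closures on pairs of positions\<close>

lemma tuples_2: "as \<in> tuples N 2 \<longleftrightarrow> (\<exists>a<N. \<exists>b<N. as = [a, b])"
  by (auto simp: numeral_2_eq_2 tuples_Suc tuples_0)

lemma Bex_tuples_2: "(\<exists>as\<in>tuples N 2. Q as) \<longleftrightarrow> (\<exists>a<N. \<exists>b<N. Q [a, b])"
  unfolding Bex_def tuples_2 by blast

lemma rtrancl_pairs:
  "([a, b], [c, d]) \<in> {(as, bs). as \<in> tuples N 2 \<and> bs \<in> tuples N 2 \<and> Q as bs}\<^sup>* \<longleftrightarrow>
    ((a, b), (c, d)) \<in> {((a, b), (c, d)). a < N \<and> b < N \<and> c < N \<and> d < N \<and> Q [a, b] [c, d]}\<^sup>*"
  (is "_ \<in> ?L\<^sup>* \<longleftrightarrow> _ \<in> ?P\<^sup>*")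
proof
  have "([a, b], cd) \<in> ?L\<^sup>* \<Longrightarrow> \<exists>c d. cd = [c, d] \<and> ((a, b), (c, d)) \<in> ?P\<^sup>*" for cd
  proof (induction rule: rtrancl_induct)
    case (step y z)
    then obtain c d where y: "y = [c, d]" "((a, b), (c, d)) \<in> ?P\<^sup>*"
      by blast
    from step(2) obtain c' d' where z: "z = [c', d']"
      and step': "c < N" "d < N" "c' < N" "d' < N" "Q [c, d] [c', d']"
      unfolding y(1) by (auto simp: tuples_2)
    from step' have "((c, d), (c', d')) \<in> ?P"
      by simp
    with y(2) have "((a, b), (c', d')) \<in> ?P\<^sup>*"
      by (rule rtrancl_into_rtrancl)
    with z show ?case
      by blast
  qed simp
  then show "([a, b], [c, d]) \<in> ?L\<^sup>* \<Longrightarrow> ((a, b), (c, d)) \<in> ?P\<^sup>*"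
    by blast
next
  have "((a, b), cd) \<in> ?P\<^sup>* \<Longrightarrow> ([a, b], [fst cd, snd cd]) \<in> ?L\<^sup>*" for cd
  proof (induction rule: rtrancl_induct)
    case (step y z)
    then have "([fst y, snd y], [fst z, snd z]) \<in> ?L"
      by (auto simp: tuples_2)
    with step.IH show ?case
      by (rule rtrancl_into_rtrancl)
  qed simp
  from this[of "(c, d)"] show "((a, b), (c, d)) \<in> ?P\<^sup>* \<Longrightarrow> ([a, b], [c, d]) \<in> ?L\<^sup>*"
    by simp
qed

lemma sem_Reach2:
  "sem In N m e (Reach 2 A R T) \<longleftrightarrow>
    (\<exists>a<N. \<exists>b<N. \<exists>c<N. \<exists>d<N. sem In N (Suc (Suc m)) (e(Suc m := b, m := a)) A \<and>
     ((a, b), (c, d)) \<in> {((a, b), (c, d)). a < N \<and> b < N \<and> c < N \<and> d < N \<and>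
        sem In N (Suc (Suc (Suc (Suc m))))
          (e(Suc m := b, m := a, Suc (Suc (Suc m)) := d, Suc (Suc m) := c)) R}\<^sup>* \<and>
     sem In N (Suc (Suc m)) (e(Suc m := d, m := c)) T)"
  unfolding sem.simps Bex_tuples_2 rtrancl_pairs by simp

lemma ext_other: "v < m \<or> m + length as \<le> v \<Longrightarrow> ext m as e v = e v"
  by (induction as arbitrary: m) auto

lemma ext_nth: "j < length as \<Longrightarrow> ext m as e (m + j) = as ! j"
proof (induction as arbitrary: m j)
  case (Cons a as)
  then show ?case using Cons.IH[of "j - 1" "Suc m"] by (cases j) auto
qed simp

definition steps :: "nat \<Rightarrow> (nat \<Rightarrow> nat \<Rightarrow> nat \<Rightarrow> nat \<Rightarrow> bool) \<Rightarrow> ((nat \<times> nat) \<times> (nat \<times> nat)) set" where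
  "steps N R = {((a, b), (c, d)). a < N \<and> b < N \<and> c < N \<and> d < N \<and> R a b c d}\<^sup>*"

lemma steps_refl: "(x, x) \<in> steps N R"
  by (simp add: steps_def)

lemma steps_snoc:
  "(x, (a, b)) \<in> steps N R \<Longrightarrow> R a b c d \<Longrightarrow> a < N \<Longrightarrow> b < N \<Longrightarrow> c < N \<Longrightarrow> d < N \<Longrightarrow>
    (x, (c, d)) \<in> steps N R"
  unfolding steps_def by (erule rtrancl_into_rtrancl) simp

lemma steps_invariant:
  assumes "((a, b), (c, d)) \<in> steps N R" "I a b"
    "\<And>a b c d. I a b \<Longrightarrow> a < N \<Longrightarrow> b < N \<Longrightarrow> c < N \<Longrightarrow> d < N \<Longrightarrow> R a b c d \<Longrightarrow> I c d"
  shows "I c d"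
proof -
  have "I (fst cd) (snd cd)"
    if "((a, b), cd) \<in> {((a, b), (c, d)). a < N \<and> b < N \<and> c < N \<and> d < N \<and> R a b c d}\<^sup>*" for cd
    using that by (induction rule: rtrancl_induct) (use assms(2,3) in force)+
  with assms(1) show ?thesis
    by (force simp: steps_def)
qed

text \<open>This separates logic from arithmetic: after replacing the three subformulas by
  predicates on numbers below \<open>N\<close>, only the relation \<open>steps\<close> remains to be
  analysed.\<close>

lemma sem_Reach2_iff:
  assumes "\<And>a b. a < N \<Longrightarrow> b < N \<Longrightarrow> sem In N (Suc (Suc m)) (e(Suc m := b, m := a)) A \<longleftrightarrow> A' a b"
    and R: "\<And>a b c d. a < N \<Longrightarrow> b < N \<Longrightarrow> c < N \<Longrightarrow> d < N \<Longrightarrow> sem In N (Suc (Suc (Suc (Suc m))))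
          (e(Suc m := b, m := a, Suc (Suc (Suc m)) := d, Suc (Suc m) := c)) R \<longleftrightarrow> R' a b c d"
    and "\<And>a b. a < N \<Longrightarrow> b < N \<Longrightarrow> sem In N (Suc (Suc m)) (e(Suc m := b, m := a)) T \<longleftrightarrow> T' a b"
  shows "sem In N m e (Reach 2 A R T) \<longleftrightarrow>
    (\<exists>a b c d. a < N \<and> b < N \<and> c < N \<and> d < N \<and> A' a b \<and> ((a, b), (c, d)) \<in> steps N R' \<and> T' c d)"
proof -
  have "{((a, b), (c, d)). a < N \<and> b < N \<and> c < N \<and> d < N \<and>
        sem In N (Suc (Suc (Suc (Suc m))))
          (e(Suc m := b, m := a, Suc (Suc (Suc m)) := d, Suc (Suc m) := c)) R} =
      {((a, b), (c, d)). a < N \<and> b < N \<and> c < N \<and> d < N \<and> R' a b c d}"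
    using R by blast
  then show ?thesis
    unfolding sem_Reach2 steps_def using assms(1,3) by (metis (no_types, lifting))
qed

lemma sem_Double:
  assumes "v < m" "u < m" "e v < N" "e u < N"
  shows "sem In N m e (Double m v u) \<longleftrightarrow> e u = 2 * e v"
proof -
  let ?R = "\<lambda>a b c d. c = Suc a \<and> d = Suc (Suc b)"
  have "sem In N m e (Double m v u) \<longleftrightarrow> (\<exists>a b c d. a < N \<and> b < N \<and> c < N \<and> d < N \<and> (a = 0 \<and> b = 0) \<and>
      ((a, b), (c, d)) \<in> steps N ?R \<and> (c = e v \<and> d = e u))"
    unfolding Double_def Let_def
    by (rule sem_Reach2_iff) (use assms in \<open>auto cong: conj_cong\<close>)
  also have "\<dots> \<longleftrightarrow> ((0, 0), (e v, e u)) \<in> steps N ?R"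
    using assms by auto
  also have "\<dots> \<longleftrightarrow> e u = 2 * e v"
  proof
    assume "((0, 0), (e v, e u)) \<in> steps N ?R"
    then show "e u = 2 * e v"
      by (rule steps_invariant[where I = "\<lambda>a b. b = 2 * a"]) simp_all
  next
    \<comment> \<open>The intermediate doubles are smaller than the last one, so the walk never
      leaves the universe.\<close>
    have "((0, 0), (n, 2 * n)) \<in> steps N ?R" if "2 * n < N" for n
      using that
    proof (induction n)
      case (Suc n)
      show ?case by (rule steps_snoc[of _ n "2 * n"]) (use Suc in auto)
    qed (simp add: steps_refl)
    then show "e u = 2 * e v \<Longrightarrow> ((0, 0), (e v, e u)) \<in> steps N ?R"
      using assms by simp
  qed
  finally show ?thesis .
qed

text \<open>That position 0 fails the property justifies the start with count 0. It also keeps each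
  count at most equal to its position, so the counter never outgrows the universe.\<close>

lemma sem_Count:
  assumes v: "v < m" "e v < N" and "\<not> \<phi> 0"
    and \<phi>: "\<And>c e'. c < N \<Longrightarrow> (\<And>i. i < m \<Longrightarrow> e' i = e i) \<Longrightarrow> e' (Suc (Suc m)) = c \<Longrightarrow>
      sem In N (Suc (Suc (Suc (Suc m)))) e' (a (Suc (Suc (Suc (Suc m)))) (Suc (Suc m))) \<longleftrightarrow> \<phi> c"
  shows "sem In N m e (Count a m v) \<longleftrightarrow> e v = card {u. u < N \<and> \<phi> u}"
proof -
  let ?R = "\<lambda>a b c d. c = Suc a \<and> (\<phi> c \<and> d = Suc b \<or> \<not> \<phi> c \<and> d = b)"
  let ?c = "\<lambda>x. card {u. u \<le> x \<and> \<phi> u}"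
  have card_Suc: "?c (Suc x) = (if \<phi> (Suc x) then Suc (?c x) else ?c x)" for x
  proof -
    have "{u. u \<le> Suc x \<and> \<phi> u} = (if \<phi> (Suc x) then insert (Suc x) {u. u \<le> x \<and> \<phi> u} else {u. u \<le> x \<and> \<phi> u})"
      by (auto simp: le_Suc_eq)
    then show ?thesis by simp
  qed
  have le: "?c x \<le> x" for x
    using card_Suc \<open>\<not> \<phi> 0\<close> by (induction x) (auto simp: card_eq_0_iff intro: le_SucI)
  from le[of 0] have c0: "?c 0 = 0"
    by (rule le_0_eq[THEN iffD1])
  have all: "?c (N - 1) = card {u. u < N \<and> \<phi> u}"
    using v by (intro arg_cong[of _ _ card]) auto
  have "sem In N m e (Count a m v) \<longleftrightarrow> (\<exists>a b c d. a < N \<and> b < N \<and> c < N \<and> d < N \<and> (a = 0 \<and> b = 0) \<and>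
      ((a, b), (c, d)) \<in> steps N ?R \<and> (\<not> Suc c < N \<and> d = e v))"
    unfolding Count_def Let_def
    by (rule sem_Reach2_iff) (use assms in \<open>auto cong: conj_cong\<close>)
  also have "\<dots> \<longleftrightarrow> ((0, 0), (N - 1, e v)) \<in> steps N ?R"
  proof
    assume "\<exists>a b c d. a < N \<and> b < N \<and> c < N \<and> d < N \<and> (a = 0 \<and> b = 0) \<and>
      ((a, b), (c, d)) \<in> steps N ?R \<and> (\<not> Suc c < N \<and> d = e v)"
    then obtain c where "c < N" "\<not> Suc c < N" "((0, 0), (c, e v)) \<in> steps N ?R"
      by blast
    moreover from this have "c = N - 1"
      by linarith
    ultimately show "((0, 0), (N - 1, e v)) \<in> steps N ?R"
      by simp
  next
    assume "((0, 0), (N - 1, e v)) \<in> steps N ?R"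
    then show "\<exists>a b c d. a < N \<and> b < N \<and> c < N \<and> d < N \<and> (a = 0 \<and> b = 0) \<and>
      ((a, b), (c, d)) \<in> steps N ?R \<and> (\<not> Suc c < N \<and> d = e v)"
      using v by (intro exI[of _ 0] exI[of _ "N - 1"] exI[of _ "e v"]) auto
  qed
  also have "\<dots> \<longleftrightarrow> e v = ?c (N - 1)"
  proof
    assume "((0, 0), (N - 1, e v)) \<in> steps N ?R"
    then show "e v = ?c (N - 1)"
    proof (rule steps_invariant[where I = "\<lambda>a b. b = ?c a"])
      show "0 = ?c 0"
        by (rule c0[symmetric])
    next
      fix a b c d
      assume "b = ?c a" "?R a b c d"
      then show "d = ?c c"
        using card_Suc[of a] by auto
    qed
  next
    have "((0, 0), (n, ?c n)) \<in> steps N ?R" if "n < N" for n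
      using that
    proof (induction n)
      case 0
      show ?case unfolding c0 by (rule steps_refl)
    next
      case (Suc n)
      show ?case
        by (rule steps_snoc[of _ n "?c n"])
          (use Suc le[of n] le[of "Suc n"] card_Suc[of n] in auto)
    qed
    from this[of "N - 1"] show "e v = ?c (N - 1) \<Longrightarrow> ((0, 0), (N - 1, e v)) \<in> steps N ?R"
      using v by simp
  qed
  finally show ?thesis
    unfolding all .
qed

context
  fixes w :: "nat list"
  assumes symbols: "set w \<subseteq> {1, 2, 3, 4}"
begin

abbreviation "sat \<equiv> sem (word_tracks w) (length w)"

lemma sem_Sym: "e v < length w \<Longrightarrow> s \<in> {1, 2, 3, 4} \<Longrightarrow> sat m e (Sym s v) \<longleftrightarrow> w ! e v = s"
proof -
  assume "e v < length w"
  moreover from this have "w ! e v \<in> {1, 2, 3, 4}"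
    using symbols nth_mem by blast
  ultimately show "s \<in> {1, 2, 3, 4} \<Longrightarrow> ?thesis"
    by (auto simp: Sym_def Lit_def inp_def word_tracks_def bit_iff_odd)
qed

lemma block_step: "Suc x < length w \<Longrightarrow>
    block w x = (if w ! Suc x \<le> 2 then w ! Suc x # block w (Suc x) else [])"
  by (simp add: block_def Cons_nth_drop_Suc[symmetric])

lemma block_end: "length w \<le> Suc x \<Longrightarrow> block w x = []"
  by (simp add: block_def)

lemma block_Cons:
  assumes "block w x = s # r"
  shows "Suc x < length w" "w ! Suc x = s" "s \<le> 2" "block w (Suc x) = r"
proof -
  show "Suc x < length w"
    using assms block_end[of x] by (cases "Suc x < length w") auto
  from block_step[OF this] assms show "w ! Suc x = s" "s \<le> 2" "block w (Suc x) = r"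
    by (auto split: if_splits)
qed

text \<open>Invariant of a walk: each block is the common word read so far followed by the block at
  the current position. With both rests empty the blocks agree. Conversely, induction on the unread
  block walks through two equal blocks to their ends.\<close>

lemma sem_Same:
  assumes "v < m" "u < m" "e v < length w" "e u < length w"
  shows "sat m e (Same m v u) \<longleftrightarrow> block w (e v) = block w (e u)"
proof -
  let ?N = "length w"
  let ?R = "\<lambda>a b c d. (c = Suc a \<and> d = Suc b) \<and> (w ! c = 1 \<and> w ! d = 1 \<or> w ! c = 2 \<and> w ! d = 2)"
  have sym: "w ! x \<le> 2 \<longleftrightarrow> w ! x = 1 \<or> w ! x = 2" if "x < ?N" for x
    using symbols nth_mem[OF that] by auto
  have nil: "block w x = [] \<longleftrightarrow> \<not> (\<exists>y<?N. y = Suc x \<and> (w ! y = 1 \<or> w ! y = 2))" if "x < ?N" for x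
    using block_step[of x] block_end[of x] sym[of "Suc x"] by (cases "Suc x < ?N") auto
  have "sat m e (Same m v u) \<longleftrightarrow> (\<exists>a b c d. a < ?N \<and> b < ?N \<and> c < ?N \<and> d < ?N \<and> (a = e v \<and> b = e u) \<and>
      ((a, b), (c, d)) \<in> steps ?N ?R \<and> (block w c = [] \<and> block w d = []))"
    unfolding Same_def Let_def
    by (rule sem_Reach2_iff) (use assms nil in \<open>auto simp: sem_Sym cong: conj_cong\<close>)
  also have "\<dots> \<longleftrightarrow> (\<exists>c d. c < ?N \<and> d < ?N \<and> ((e v, e u), (c, d)) \<in> steps ?N ?R \<and>
      block w c = [] \<and> block w d = [])"
    using assms by blast
  also have "\<dots> \<longleftrightarrow> block w (e v) = block w (e u)"
  proof
    assume "\<exists>c d. c < ?N \<and> d < ?N \<and> ((e v, e u), (c, d)) \<in> steps ?N ?R \<and> block w c = [] \<and> block w d = []"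
    then obtain c d where r: "((e v, e u), (c, d)) \<in> steps ?N ?R" and cd: "block w c = []" "block w d = []"
      by blast
    have "\<exists>xs. block w (e v) = xs @ block w c \<and> block w (e u) = xs @ block w d"
      using r
    proof (rule steps_invariant[where I = "\<lambda>c d. \<exists>xs. block w (e v) = xs @ block w c \<and> block w (e u) = xs @ block w d"])
      show "\<exists>xs. block w (e v) = xs @ block w (e v) \<and> block w (e u) = xs @ block w (e u)"
        by (intro exI[of _ "[]"]) simp
    next
      fix a b c d
      assume "\<exists>xs. block w (e v) = xs @ block w a \<and> block w (e u) = xs @ block w b"
        "c < ?N" "d < ?N" "?R a b c d"
      then show "\<exists>xs. block w (e v) = xs @ block w c \<and> block w (e u) = xs @ block w d"
        using block_step[of a] block_step[of b] by (metis append_Cons append_Nil append_assoc one_le_numeral order_refl)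
    qed
    with cd show "block w (e v) = block w (e u)" by auto
  next
    have "block w x = block w y \<Longrightarrow> x < ?N \<Longrightarrow> y < ?N \<Longrightarrow> ((e v, e u), (x, y)) \<in> steps ?N ?R \<Longrightarrow>
      \<exists>c d. c < ?N \<and> d < ?N \<and> ((e v, e u), (c, d)) \<in> steps ?N ?R \<and> block w c = [] \<and> block w d = []" for x y
    proof (induction "block w x" arbitrary: x y)
      case Nil
      then show ?case by (intro exI[of _ x] exI[of _ y]) simp
    next
      case (Cons s r)
      note x = block_Cons[OF Cons(2)[symmetric]]
      note y = block_Cons[OF Cons(2)[unfolded Cons(3), symmetric]]
      have "((e v, e u), (Suc x, Suc y)) \<in> steps ?N ?R"
        by (rule steps_snoc[OF Cons(6)]) (use Cons(4,5) x y sym[of "Suc x"] in auto)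
      with Cons(1)[of "Suc x" "Suc y"] x y show ?case by simp
    qed
    from this[of "e v" "e u"] show "block w (e v) = block w (e u) \<Longrightarrow>
      \<exists>c d. c < ?N \<and> d < ?N \<and> ((e v, e u), (c, d)) \<in> steps ?N ?R \<and> block w c = [] \<and> block w d = []"
      using assms by (simp add: steps_refl)
  qed
  finally show ?thesis .
qed

lemma sem_Removed:
  assumes "b + k \<le> m" "v < m" "e v < length w" "\<And>j. j < k \<Longrightarrow> e (b + j) < length w"
  shows "sat m e (Removed k b m v) \<longleftrightarrow> removed w (map e [b..<b + k]) (e v)"
proof -
  have "sat m e (Conj (Le v (b + j)) (Neg (Exists (Conj (Less v m) (Conj (Le m (b + j)) (Sym 4 m)))))) \<longleftrightarrow>
      e v \<le> e (b + j) \<and> (\<forall>u. e v < u \<and> u \<le> e (b + j) \<longrightarrow> w ! u \<noteq> 4)" if "j < k" for j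
    using assms(1,2) assms(4)[OF that] that by (auto simp: sem_Sym cong: conj_cong)
  then show ?thesis
    by (auto simp: Removed_def removed_def cong: conj_cong)
qed

lemma sem_Opener:
  assumes "b + k \<le> m" "v < m" "e v < length w" "\<And>j. j < k \<Longrightarrow> e (b + j) < length w"
  shows "sat m e (Opener k b m v) \<longleftrightarrow> opener w (map e [b..<b + k]) (e v)"
proof -
  have map: "map (e(m := i)) [b..<b + k] = map e [b..<b + k]" for i
    using assms(1) by auto
  have Removed: "sat (Suc m) (e(m := i)) (Removed k b (Suc m) m) \<longleftrightarrow> removed w (map e [b..<b + k]) i"
    if "i < length w" for i
    using sem_Removed[of b k "Suc m" m "e(m := i)"] assms that by (simp add: map)
  have Same: "sat (Suc m) (e(m := i)) (Same (Suc m) m v) \<longleftrightarrow> block w i = block w (e v)"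
    if "i < length w" for i
    using sem_Same[of m "Suc m" v "e(m := i)"] assms that by simp
  show ?thesis
    using assms(1-3) sem_Removed[OF assms]
    by (auto simp: Opener_def opener_def sem_Sym Removed Same cong: conj_cong)
qed

context
  fixes L p :: nat
  assumes L: "L < length w" "w ! L = 4" "\<And>i. i < L \<Longrightarrow> w ! i = p div 2 ^ i mod 2 + 1" "p < 2 ^ L"
begin

text \<open>Horner's scheme: the walk goes from the first separator down to position 0 with the
  invariant \<open>b = p div 2 ^ a\<close>, so it can end only with \<open>p\<close> itself. If
  \<open>p\<close> is not a position, the end is unreachable, in accordance with \<open>e v\<close>
  being a position.\<close>

lemma sem_Param_less:
  assumes "v < m" "e v < length w"
  shows "sat m e (Param_less m v) \<longleftrightarrow> p < e v"
proof -
  let ?N = "length w"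
  let ?R = "\<lambda>a b c d. a = Suc c \<and> (w ! c = 1 \<and> d = 2 * b \<or> w ! c = 2 \<and> d = Suc (2 * b))"
  have half: "p div 2 ^ c = 2 * (p div 2 ^ Suc c) + p div 2 ^ c mod 2" for c
    using div_mult_mod_eq[of "p div 2 ^ c" 2] by (simp add: power_Suc2 div_mult2_eq del: power_Suc)
  have "(w ! a = 4 \<and> \<not> (\<exists>i<?N. i < a \<and> w ! i = 4)) \<longleftrightarrow> a = L" if "a < ?N" for a
  proof
    assume a: "w ! a = 4 \<and> \<not> (\<exists>i<?N. i < a \<and> w ! i = 4)"
    then have "\<not> a < L"
      using L(3)[of a] by (auto simp: mod2_eq_if split: if_splits)
    moreover have "\<not> L < a"
      using a L(1,2) by auto
    ultimately show "a = L" by simp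
  next
    have "w ! i \<noteq> 4" if "i < L" for i
      using L(3)[OF that] by (auto simp: mod2_eq_if split: if_splits)
    then show "a = L \<Longrightarrow> w ! a = 4 \<and> \<not> (\<exists>i<?N. i < a \<and> w ! i = 4)"
      using L by auto
  qed
  then have "sat m e (Param_less m v) \<longleftrightarrow> (\<exists>a b c d. a < ?N \<and> b < ?N \<and> c < ?N \<and> d < ?N \<and> (a = L \<and> b = 0) \<and>
      ((a, b), (c, d)) \<in> steps ?N ?R \<and> (c = 0 \<and> d < e v))"
    unfolding Param_less_def Let_def
    by (intro sem_Reach2_iff) (use assms in \<open>auto simp: sem_Sym sem_Double cong: conj_cong\<close>)
  also have "\<dots> \<longleftrightarrow> (\<exists>d<e v. ((L, 0), (0, d)) \<in> steps ?N ?R)"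
  proof (intro iffI)
    assume "\<exists>d<e v. ((L, 0), (0, d)) \<in> steps ?N ?R"
    then obtain d where "d < e v" "((L, 0), (0, d)) \<in> steps ?N ?R"
      by blast
    then show "\<exists>a b c d. a < ?N \<and> b < ?N \<and> c < ?N \<and> d < ?N \<and> (a = L \<and> b = 0) \<and>
      ((a, b), (c, d)) \<in> steps ?N ?R \<and> (c = 0 \<and> d < e v)"
      using assms L(1) by (intro exI[of _ L] exI[of _ 0] exI[of _ d]) auto
  qed blast
  also have "\<dots> \<longleftrightarrow> p < e v"
  proof
    assume "\<exists>d<e v. ((L, 0), (0, d)) \<in> steps ?N ?R"
    then obtain d where d: "d < e v" "((L, 0), (0, d)) \<in> steps ?N ?R"
      by blast
    from d(2) have "0 \<le> L \<and> d = p div 2 ^ 0"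
    proof (rule steps_invariant[where I = "\<lambda>a b. a \<le> L \<and> b = p div 2 ^ a"])
      show "L \<le> L \<and> 0 = p div 2 ^ L"
        using L(4) by simp
    next
      fix a b c d
      assume "a \<le> L \<and> b = p div 2 ^ a" "?R a b c d"
      then show "c \<le> L \<and> d = p div 2 ^ c"
        using L(3)[of c] half[of c] by auto
    qed
    with d(1) show "p < e v" by simp
  next
    assume p: "p < e v"
    \<comment> \<open>All prefixes of the parameter are at most \<open>p\<close>, which is below the
      position \<open>e v\<close>; hence the whole walk fits.\<close>
    have less: "p div 2 ^ a < ?N" for a
      using p assms(2) div_le_dividend[of p "2 ^ a"] by linarith
    have "((L, 0), (n, p div 2 ^ n)) \<in> steps ?N ?R" if "n \<le> L" for n
      using that
    proof (induction n rule: inc_induct)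
      case base
      then show ?case using L(4) by (simp add: steps_refl)
    next
      case (step n)
      have "?R (Suc n) (p div 2 ^ Suc n) n (p div 2 ^ n)"
        using L(3)[OF step(2)] half[of n] by auto
      then show ?case
        by (rule steps_snoc[OF step.IH]) (use step less L(1) in \<open>auto simp del: power_Suc\<close>)
    qed
    from this[of 0] p show "\<exists>d<e v. ((L, 0), (0, d)) \<in> steps ?N ?R"
      by auto
  qed
  finally show ?thesis .
qed

text \<open>Position 0 does not start a bin, so there are fewer representatives than positions and
  their number is itself an element of the universe.\<close>

lemma sem_Few_open:
  assumes "b + k \<le> m" "\<And>j. j < k \<Longrightarrow> e (b + j) < length w" "w ! 0 \<noteq> 3"
  shows "sat m e (Few_open k b m) \<longleftrightarrow> card {s. s < length w \<and> opener w (map e [b..<b + k]) s} \<le> p"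
proof -
  let ?is = "map e [b..<b + k]"
  let ?c = "card {s. s < length w \<and> opener w ?is s}"
  have "{s. s < length w \<and> opener w ?is s} \<subseteq> {1..<length w}"
    using assms(3) by (auto simp: opener_def Suc_le_eq intro: Nat.gr0I)
  then have "?c \<le> length w - 1"
    using card_mono[of "{1..<length w}"] by fastforce
  then have c: "?c < length w"
    using L(1) by simp
  have "sat (Suc m) (e(m := i)) (Count (Opener k b) (Suc m) m) \<longleftrightarrow> i = ?c" if i: "i < length w" for i
  proof -
    have "sat (Suc m) (e(m := i)) (Count (Opener k b) (Suc m) m) \<longleftrightarrow> (e(m := i)) m = ?c"
    proof (rule sem_Count)
      fix c e'
      assume c: "c < length w" "\<And>j. j < Suc m \<Longrightarrow> e' j = (e(m := i)) j" "e' (Suc (Suc (Suc m))) = c"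
      have e': "e' (b + j) = e (b + j)" if "j < k" for j
        using c(2)[of "b + j"] that assms(1) by auto
      then have "map e' [b..<b + k] = ?is"
        by (auto simp: le_iff_add)
      with sem_Opener[of b k "Suc (Suc (Suc (Suc (Suc m))))" "Suc (Suc (Suc m))" e'] c(1,3) assms e'
      show "sat (Suc (Suc (Suc (Suc (Suc m))))) e' (Opener k b (Suc (Suc (Suc (Suc (Suc m))))) (Suc (Suc (Suc m)))) \<longleftrightarrow>
          opener w ?is c"
        by simp
    qed (use i assms(3) in \<open>auto simp: opener_def\<close>)
    then show ?thesis by simp
  qed
  then have "sat m e (Few_open k b m) \<longleftrightarrow> (\<exists>i<length w. i = ?c \<and> \<not> p < i)"
    by (simp add: Few_open_def sem_Param_less cong: conj_cong)
  then show ?thesis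
    using c by auto
qed

lemma sem_Problem:
  assumes "w ! 0 \<noteq> 3"
  shows "sat 0 e (Problem k) \<longleftrightarrow> (\<exists>as\<in>tuples (length w) k. \<exists>bs\<in>tuples (length w) k. start_tuple w as \<and>
     (as, bs) \<in> {(as, bs). as \<in> tuples (length w) k \<and> bs \<in> tuples (length w) k \<and>
        few_open w p bs \<and> move_tuple w as bs}\<^sup>* \<and> final_tuple w bs)"
proof -
  let ?T = "tuples (length w) k"
  have len: "length as = k" if "as \<in> ?T" for as
    using that by (simp add: tuples_def)
  have less: "as ! j < length w" if "as \<in> ?T" "j < k" for as j
    using that nth_mem[of j as] by (auto simp: tuples_def subset_iff)
  have ext0: "ext 0 as e j = as ! j" if "as \<in> ?T" "j < k" for as j e
    using ext_nth[of j as 0 e] that by (simp add: len)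
  have start: "sat (0 + k) (ext 0 as e) (Conj (Conjs (map (Sym 4) [0..<k])) (Conjs (map (\<lambda>j. Less j (Suc j)) [0..<k - 1])))
      \<longleftrightarrow> start_tuple w as" if "as \<in> ?T" for as
    using that by (auto simp: start_tuple_def sem_Sym ext0 len less)
  have final: "sat (0 + k) (ext 0 as e) (Conjs (map (\<lambda>j. Neg (Exists (Conj (Succ (Suc k) j k) (Neg (Sym 4 k))))) [0..<k]))
      \<longleftrightarrow> final_tuple w as" if "as \<in> ?T" for as
    using that by (auto simp: final_tuple_def sem_Sym ext0 len less cong: conj_cong)
  have move: "sat (0 + k + k) (ext (0 + k) bs (ext 0 as e))
       (Conj (Few_open k k (k + k)) (Disjs (map (\<lambda>j. Conj (Conj (Succ (k + k) j (k + j)) (Neg (Sym 4 (k + j))))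
        (Conjs (map (\<lambda>l. if l = j then Le 0 0 else Eq l (k + l)) [0..<k]))) [0..<k]))) \<longleftrightarrow>
      few_open w p bs \<and> move_tuple w as bs" if as: "as \<in> ?T" and bs: "bs \<in> ?T" for as bs
  proof -
    let ?e = "ext k bs (ext 0 as e)"
    have a: "?e j = as ! j" if "j < k" for j
      using that as ext_other[of j k bs] by (simp add: ext0)
    have b: "?e (k + j) = bs ! j" if "j < k" for j
      using that bs ext_nth[of j bs k] by (simp add: len)
    have "map ?e [k..<k + k] = bs"
      using b bs by (intro nth_equalityI) (auto simp: len)
    then have few: "sat (k + k) ?e (Few_open k k (k + k)) \<longleftrightarrow> few_open w p bs"
      using sem_Few_open[of k k "k + k" ?e] b bs assms by (simp add: few_open_def less)
    have move: "sat (k + k) ?e (Conj (Conj (Succ (k + k) j (k + j)) (Neg (Sym 4 (k + j))))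
        (Conjs (map (\<lambda>l. if l = j then Le 0 0 else Eq l (k + l)) [0..<k]))) \<longleftrightarrow>
      bs = as[j := Suc (as ! j)] \<and> w ! Suc (as ! j) \<noteq> 4" if "j < k" for j
    proof -
      have eq: "bs = as[j := Suc (as ! j)] \<longleftrightarrow> bs ! j = Suc (as ! j) \<and> (\<forall>l<k. l \<noteq> j \<longrightarrow> as ! l = bs ! l)"
      proof
        assume "bs = as[j := Suc (as ! j)]"
        then show "bs ! j = Suc (as ! j) \<and> (\<forall>l<k. l \<noteq> j \<longrightarrow> as ! l = bs ! l)"
          using that len[OF as] by simp
      next
        assume *: "bs ! j = Suc (as ! j) \<and> (\<forall>l<k. l \<noteq> j \<longrightarrow> as ! l = bs ! l)"
        show "bs = as[j := Suc (as ! j)]"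
        proof (rule nth_equalityI)
          fix l
          assume "l < length bs"
          then show "bs ! l = as[j := Suc (as ! j)] ! l"
            using * that len[OF as] len[OF bs] by (cases "l = j") simp_all
        qed (simp add: len[OF as] len[OF bs])
      qed
      have succ: "sat (k + k) ?e (Succ (k + k) j (k + j)) \<longleftrightarrow> bs ! j = Suc (as ! j)"
        using that less[OF bs that] by (subst sem_Succ) (simp_all add: a b)
      have sym: "sat (k + k) ?e (Sym 4 (k + j)) \<longleftrightarrow> w ! (bs ! j) = 4"
        using that less[OF bs that] by (subst sem_Sym) (simp_all add: b)
      have same: "sat (k + k) ?e (Conjs (map (\<lambda>l. if l = j then Le 0 0 else Eq l (k + l)) [0..<k])) \<longleftrightarrow>
          (\<forall>l<k. l \<noteq> j \<longrightarrow> as ! l = bs ! l)"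
        by (auto simp: a b simp del: if_image_distrib)
      show ?thesis
        unfolding sem.simps succ sym same eq by (cases "bs ! j = Suc (as ! j)") (simp_all add: conj_commute)
    qed
    show ?thesis
      using few move by (auto simp: move_tuple_def len[OF as])
  qed
  have "{(as, bs). as \<in> ?T \<and> bs \<in> ?T \<and> sat (0 + k + k) (ext (0 + k) bs (ext 0 as e))
       (Conj (Few_open k k (k + k)) (Disjs (map (\<lambda>j. Conj (Conj (Succ (k + k) j (k + j)) (Neg (Sym 4 (k + j))))
        (Conjs (map (\<lambda>l. if l = j then Le 0 0 else Eq l (k + l)) [0..<k]))) [0..<k])))} =
     {(as, bs). as \<in> ?T \<and> bs \<in> ?T \<and> few_open w p bs \<and> move_tuple w as bs}"
    using move by blast
  then show ?thesis
    unfolding Problem_def sem.simps(5) using start final by auto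
qed

end

end

subsection \<open>Binary numbers and codes of sequences\<close>

fun val :: "nat list \<Rightarrow> nat" where
  "val [] = 0"
| "val (s # ss) = s - 1 + 2 * val ss"

declare bits.simps [simp del]

lemma val_bits [simp]: "val (bits n) = n"
  by (induction n rule: bits.induct) (subst bits.simps, auto)

lemma bits_inject [simp]: "bits m = bits n \<longleftrightarrow> m = n"
  by (metis val_bits)

lemma set_bits: "set (bits n) \<subseteq> {1, 2}"
  by (induction n rule: bits.induct) (subst bits.simps, auto simp: mod2_eq_if split: if_splits)

lemma bits_not_Nil [simp]: "bits n \<noteq> []"
  by (subst bits.simps) auto

lemma nth_bits: "i < length (bits n) \<Longrightarrow> bits n ! i = n div 2 ^ i mod 2 + 1"
proof (induction n arbitrary: i rule: bits.induct)
  case (1 n)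
  show ?case
  proof (cases "n < 2")
    case True
    then have "bits n = [n + 1]" by (subst bits.simps) simp
    with 1(2) True show ?thesis by simp
  next
    case False
    then have "bits n = (n mod 2 + 1) # bits (n div 2)" by (subst bits.simps) simp
    with 1 False show ?thesis
      by (cases i) (auto simp: div_mult2_eq)
  qed
qed

lemma less_bits: "n < 2 ^ length (bits n)"
proof (induction n rule: bits.induct)
  case (1 n)
  show ?case
  proof (cases "n < 2")
    case True
    then have "bits n = [n + 1]" by (subst bits.simps) simp
    with True show ?thesis by simp
  next
    case False
    then have "bits n = (n mod 2 + 1) # bits (n div 2)" by (subst bits.simps) simp
    with 1[OF False] show ?thesis by simp
  qed
qed

definition seg :: "nat list \<Rightarrow> nat list" where
  "seg q = concat (map (\<lambda>t. 3 # bits t) q)"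

lemma seg_simps [simp]:
  "seg [] = []" "seg (t # q) = 3 # bits t @ seg q" "seg (q @ q') = seg q @ seg q'"
  by (auto simp: seg_def)

lemma set_seg: "set (seg q) \<subseteq> {1, 2, 3}"
  using set_bits by (induction q) fastforce+

text \<open>The number of bins whose code starts within the first \<open>x\<close> symbols of \<open>seg q\<close>.\<close>
fun cnt :: "nat list \<Rightarrow> nat \<Rightarrow> nat" where
  "cnt [] x = 0"
| "cnt (t # q) x = (if x = 0 then 0 else Suc (cnt q (x - Suc (length (bits t)))))"

lemma cnt_0 [simp]: "cnt q 0 = 0"
  by (cases q) auto

lemma cnt_le: "cnt q x \<le> length q"
  by (induction q arbitrary: x) auto

lemma cnt_all: "cnt q (length (seg q)) = length q"
  by (induction q) auto

text \<open>One more symbol can start at most one more bin; hence moving an entry by one symbol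
  removes at most one bin.\<close>

lemma cnt_Suc: "cnt q (Suc x) = cnt q x \<or> cnt q (Suc x) = Suc (cnt q x)"
proof (induction q arbitrary: x)
  case (Cons t q)
  show ?case
    using Cons[of "x - Suc (length (bits t))"] by (cases "Suc (length (bits t)) \<le> x") (auto simp: Suc_diff_Suc)
qed simp

lemma less_cnt: "r < length q \<Longrightarrow> r < cnt q x \<longleftrightarrow> length (seg (take r q)) < x"
proof (induction q arbitrary: r x)
  case (Cons t q)
  show ?case
  proof (cases r)
    case (Suc r')
    then show ?thesis using Cons.IH[of r' "x - Suc (length (bits t))"] Cons.prems by auto
  qed simp
qed simp

lemma seg_split: "r < length q \<Longrightarrow>
    seg q = seg (take r q) @ 3 # bits (q ! r) @ seg (drop (Suc r) q)"
  using id_take_nth_drop[of r q] by (metis seg_simps(2,3))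

text \<open>Binary digits are written as 1 and 2, so a 3 can only open the code of a bin.\<close>

lemma seg_nth_3: "y < length (seg q) \<Longrightarrow> seg q ! y = 3 \<Longrightarrow> \<exists>r<length q. y = length (seg (take r q))"
proof (induction q arbitrary: y)
  case (Cons t q)
  have "y = 0 \<or> Suc (length (bits t)) \<le> y"
  proof (rule ccontr)
    assume *: "\<not> ?thesis"
    then have "bits t ! (y - 1) = 3" "y - 1 < length (bits t)"
      using Cons.prems by (auto simp: nth_Cons' nth_append split: if_splits)
    then show False
      using set_bits[of t] nth_mem[of "y - 1" "bits t"] by auto
  qed
  then show ?case
  proof
    assume "Suc (length (bits t)) \<le> y"
    then obtain z where y: "y = Suc (length (bits t)) + z"
      using le_Suc_ex by blast
    then have "z < length (seg q)" "seg q ! z = 3"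
      using Cons.prems by (auto simp: nth_append)
    then obtain r where "r < length q" "z = length (seg (take r q))"
      using Cons.IH by blast
    then show ?thesis
      using y by (intro exI[of _ "Suc r"]) auto
  qed (auto intro: exI[of _ 0])
qed simp

lemma length_seg_take_mono: "r \<le> r' \<Longrightarrow> length (seg (take r q)) \<le> length (seg (take r' q))"
proof -
  assume "r \<le> r'"
  then have "take r' q = take r q @ take (r' - r) (drop r q)"
    by (metis le_add_diff_inverse take_add)
  then show ?thesis by simp
qed

text \<open>A bin is counted once its separator lies in the prefix; the digits after it leave the
  count unchanged.\<close>

lemma cnt_between:
  assumes "r < length q" "length (seg (take r q)) < x" "x \<le> length (seg (take (Suc r) q))"
  shows "cnt q x = Suc r"
proof -
  have "r < cnt q x"
    using less_cnt assms by blast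
  moreover have "\<not> Suc r < cnt q x"
    using less_cnt[of "Suc r" q x] assms(3) cnt_le[of q x] by (cases "Suc r < length q") auto
  ultimately show ?thesis by simp
qed

lemma cnt_code_start: "r \<le> length q \<Longrightarrow> cnt q (length (seg (take r q))) = r"
proof (cases r)
  case (Suc r')
  assume "r \<le> length q"
  then have "seg (take (Suc r') q) = seg (take r' q) @ 3 # bits (q ! r')"
    using Suc by (simp add: take_Suc_conv_app_nth)
  then show ?thesis
    using cnt_between[of r' q "length (seg (take (Suc r') q))"] Suc \<open>r \<le> length q\<close> by simp
qed simp

section \<open>Processings as reachability of configurations\<close>

text \<open>Nothing has been removed from the initial configuration, so it has no open pallet. The
  bound can therefore be attached to the target of each step.\<close>

lemma has_processing_iff:
  "has_processing Q p \<longleftrightarrow>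
    (Q, map (\<lambda>_. []) Q) \<in> {(c, c'). trans_step c c' \<and> card (open_pallets Q c') \<le> p}\<^sup>*"
  (is "_ \<longleftrightarrow> _ \<in> ?E\<^sup>*")
proof
  assume "has_processing Q p"
  then obtain cs where cs: "cs \<noteq> []" "hd cs = Q" "last cs = map (\<lambda>_. []) Q"
    "\<And>i. Suc i < length cs \<Longrightarrow> trans_step (cs ! i) (cs ! Suc i)"
    "\<And>c. c \<in> set cs \<Longrightarrow> card (open_pallets Q c) \<le> p"
    unfolding has_processing_def by blast
  have "(Q, cs ! i) \<in> ?E\<^sup>*" if "i < length cs" for i
    using that
  proof (induction i)
    case 0
    then show ?case using cs(1,2) by (simp add: hd_conv_nth)
  next
    case (Suc i)
    then have "(cs ! i, cs ! Suc i) \<in> ?E"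
      using cs(4,5) by auto
    with Suc show ?case
      by (auto intro: rtrancl_into_rtrancl)
  qed
  from this[of "length cs - 1"] show "(Q, map (\<lambda>_. []) Q) \<in> ?E\<^sup>*"
    using cs by (simp add: last_conv_nth)
next
  have start: "open_pallets Q Q = {}"
    by (auto simp: open_pallets_def is_open_def removed_part_def)
  have "(Q, c) \<in> ?E\<^sup>* \<Longrightarrow> \<exists>cs. cs \<noteq> [] \<and> hd cs = Q \<and> last cs = c \<and>
      (\<forall>i. Suc i < length cs \<longrightarrow> trans_step (cs ! i) (cs ! Suc i)) \<and>
      (\<forall>c\<in>set cs. card (open_pallets Q c) \<le> p)" for c
  proof (induction rule: rtrancl_induct)
    case base
    then show ?case using start by (intro exI[of _ "[Q]"]) simp
  next
    case (step c c')
    then obtain cs where cs: "cs \<noteq> []" "hd cs = Q" "last cs = c"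
      "\<forall>i. Suc i < length cs \<longrightarrow> trans_step (cs ! i) (cs ! Suc i)"
      "\<forall>c\<in>set cs. card (open_pallets Q c) \<le> p"
      by blast
    have "trans_step ((cs @ [c']) ! i) ((cs @ [c']) ! Suc i)" if "Suc i < length (cs @ [c'])" for i
    proof (cases "Suc i < length cs")
      case True
      with cs(4) show ?thesis by (simp add: nth_append)
    next
      case False
      with that have i: "length cs = Suc i" by simp
      with cs(1,3) have "cs ! i = c" by (simp add: last_conv_nth)
      with i step(2) show ?thesis by (simp add: nth_append)
    qed
    with cs step(2) show ?case
      by (intro exI[of _ "cs @ [c']"]) auto
  qed
  then show "(Q, map (\<lambda>_. []) Q) \<in> ?E\<^sup>* \<Longrightarrow> has_processing Q p"
    unfolding has_processing_def by blast
qed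

section \<open>The code of an instance\<close>

locale stack_up =
  fixes k :: nat and Q :: "nat list list" and p :: nat
  assumes length_Q: "length Q = k" and k: "0 < k"
begin

definition w :: "nat list" where
  "w = encode Q p"

text \<open>The position of the separator of sequence \<open>j\<close>; \<open>off k\<close> is the
  length of the word, which treats the end of the last sequence like that of the others.\<close>

definition off :: "nat \<Rightarrow> nat" where
  "off j = length (bits p @ concat (map (\<lambda>q. 4 # seg q) (take j Q)))"

abbreviation len :: "nat \<Rightarrow> nat" where
  "len j \<equiv> length (seg (Q ! j))"

lemma w_split:
  assumes "j < k"
  obtains xs ys where "w = xs @ 4 # seg (Q ! j) @ ys" "length xs = off j" "ys = [] \<or> hd ys = 4"
proof -
  have "Q = take j Q @ Q ! j # drop (Suc j) Q"
    using assms length_Q by (simp add: id_take_nth_drop)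
  then have "w = (bits p @ concat (map (\<lambda>q. 4 # seg q) (take j Q))) @ 4 # seg (Q ! j) @
      concat (map (\<lambda>q. 4 # seg q) (drop (Suc j) Q))"
    unfolding w_def encode_def seg_def[symmetric]
    by (metis append.assoc append_Cons concat.simps(2) concat_append list.simps(9) map_append)
  then show ?thesis
    by (rule that) (auto simp: off_def, cases "drop (Suc j) Q", auto)
qed

lemma off_Suc: "j < k \<Longrightarrow> off (Suc j) = off j + Suc (len j)"
  using length_Q by (simp add: off_def take_Suc_conv_app_nth)

lemma off_k: "off k = length w"
  using length_Q by (simp add: off_def w_def encode_def seg_def)

lemma off_0: "off 0 = length (bits p)"
  by (simp add: off_def)

lemma off_mono:
  assumes "i < j" "j \<le> k"
  shows "off i + Suc (len i) \<le> off j"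
proof -
  have "i + Suc d \<le> k \<Longrightarrow> off i + Suc (len i) \<le> off (i + Suc d)" for d
  proof (induction d)
    case (Suc d)
    then show ?case using off_Suc[of "i + Suc d"] by simp
  qed (simp add: off_Suc)
  from this[of "j - Suc i"] assms show ?thesis by simp
qed

end

subsection \<open>Configurations and tuples of positions\<close>

context stack_up
begin

lemma position_less: "j < k \<Longrightarrow> y \<le> len j \<Longrightarrow> off j + y < length w"
  using off_mono[of j k] by (simp add: off_k)

lemma w_off: "j < k \<Longrightarrow> w ! off j = 4"
  by (erule w_split) (metis nth_append_length)

lemma w_seg: "j < k \<Longrightarrow> y < len j \<Longrightarrow> w ! (off j + Suc y) = seg (Q ! j) ! y"
proof (erule w_split)
  fix xs ys
  assume "y < len j" "w = xs @ 4 # seg (Q ! j) @ ys" "length xs = off j"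
  then show ?thesis
    by (metis nth_Cons_Suc nth_append nth_append_length_plus)
qed

lemma w_param: "i < off 0 \<Longrightarrow> w ! i = p div 2 ^ i mod 2 + 1"
  by (simp add: off_0 w_def encode_def nth_append nth_bits)

lemma symbols: "set w \<subseteq> {1, 2, 3, 4}"
proof -
  have "set w = set (bits p) \<union> (\<Union>q\<in>set Q. insert 4 (set (seg q)))"
    by (auto simp: w_def encode_def seg_def)
  show ?thesis
    unfolding \<open>set w = _\<close> using set_bits[of p] set_seg by blast
qed

lemma position_cases:
  assumes "i < length w"
  shows "i < off 0 \<or> (\<exists>j<k. \<exists>y\<le>len j. i = off j + y)"
proof -
  have "n \<le> k \<Longrightarrow> i < off n \<Longrightarrow> ?thesis" for n
  proof (induction n)
    case (Suc n)
    show ?case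
    proof (cases "i < off n")
      case False
      then have "i = off n + (i - off n)" "i - off n \<le> len n"
        using Suc.prems off_Suc[of n] by auto
      with Suc.prems show ?thesis
        by (metis Suc_le_eq)
    qed (use Suc in auto)
  qed auto
  with assms show ?thesis
    by (metis off_k order_refl)
qed

lemma four_iff: "i < length w \<Longrightarrow> w ! i = 4 \<longleftrightarrow> (\<exists>j<k. i = off j)"
proof
  assume i: "i < length w" "w ! i = 4"
  from position_cases[OF i(1)] show "\<exists>j<k. i = off j"
  proof
    assume "i < off 0"
    with w_param[of i] i(2) show ?thesis
      by (auto simp: mod2_eq_if split: if_splits)
  next
    assume "\<exists>j<k. \<exists>y\<le>len j. i = off j + y"
    then obtain j y where jy: "j < k" "y \<le> len j" "i = off j + y"
      by blast
    show ?thesis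
    proof (cases y)
      case (Suc z)
      with jy i(2) w_seg[of j z] have "4 \<in> set (seg (Q ! j))"
        by (metis Suc_le_eq nth_mem)
      then show ?thesis
        using set_seg[of "Q ! j"] by auto
    qed (use jy in auto)
  qed
qed (use w_off in auto)

definition pos :: "(nat \<Rightarrow> nat) \<Rightarrow> nat list" where
  "pos x = map (\<lambda>j. off j + x j) [0..<k]"

text \<open>A bin is regarded as removed as soon as its separator is consumed, so every position
  inside its code already stands for the configuration after the removal.\<close>

definition cfg :: "(nat \<Rightarrow> nat) \<Rightarrow> nat list list" where
  "cfg x = map (\<lambda>j. drop (cnt (Q ! j) (x j)) (Q ! j)) [0..<k]"

definition bounded :: "(nat \<Rightarrow> nat) \<Rightarrow> bool" where
  "bounded x \<longleftrightarrow> (\<forall>j<k. x j \<le> len j)"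

lemma length_pos [simp]: "length (pos x) = k"
  by (simp add: pos_def)

lemma nth_pos [simp]: "j < k \<Longrightarrow> pos x ! j = off j + x j"
  by (simp add: pos_def)

lemma length_cfg [simp]: "length (cfg x) = k"
  by (simp add: cfg_def)

lemma nth_cfg [simp]: "j < k \<Longrightarrow> cfg x ! j = drop (cnt (Q ! j) (x j)) (Q ! j)"
  by (simp add: cfg_def)

lemma pos_tuples: "bounded x \<Longrightarrow> pos x \<in> tuples (length w) k"
  using position_less by (auto simp: tuples_def bounded_def pos_def)

lemma pos_upd: "j < k \<Longrightarrow> pos (x(j := y)) = (pos x)[j := off j + y]"
  by (rule nth_equalityI) (auto simp: nth_list_update)

text \<open>There are exactly \<open>k\<close> separators. A strictly increasing list of
  \<open>k\<close> of them therefore contains all, and a strictly sorted list is determined by its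
  set.\<close>

lemma start_tuple_iff: "as \<in> tuples (length w) k \<Longrightarrow> start_tuple w as \<longleftrightarrow> as = pos (\<lambda>_. 0)"
proof
  have less: "off i < off j" if "i < j" "j < k" for i j
    using off_mono[of i j] that by simp
  then have sorted: "sorted_wrt (<) (pos (\<lambda>_. 0))"
    by (auto simp: sorted_wrt_iff_nth_less)
  have set: "set (pos (\<lambda>_. 0)) = off ` {..<k}"
    by (auto simp: pos_def)
  {
    assume as: "as \<in> tuples (length w) k" "start_tuple w as"
    then have len: "length as = k"
      by (simp add: tuples_def)
    have "sorted_wrt (<) as"
      using as(2) by (subst sorted_wrt_iff_nth_Suc_transp) (auto simp: start_tuple_def)
    moreover have "set as = set (pos (\<lambda>_. 0))"
    proof (rule card_subset_eq)
      show "set as \<subseteq> set (pos (\<lambda>_. 0))"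
      proof
        fix i
        assume "i \<in> set as"
        then obtain j where "j < length as" "i = as ! j"
          by (auto simp: in_set_conv_nth)
        with as have "i < length w" "w ! i = 4"
          by (auto simp: start_tuple_def tuples_def subset_iff)
        then show "i \<in> set (pos (\<lambda>_. 0))"
          using four_iff set by auto
      qed
      show "card (set as) = card (set (pos (\<lambda>_. 0)))"
        using \<open>sorted_wrt (<) as\<close> sorted len
        by (metis distinct_card length_pos strict_sorted_iff)
    qed simp
    ultimately show "as = pos (\<lambda>_. 0)"
      using sorted strict_sorted_equal by blast
  }
  show "start_tuple w as" if "as = pos (\<lambda>_. 0)"
    using that less w_off by (auto simp: start_tuple_def)
qed

lemma separator_or_end:
  assumes "j < k" "off j + Suc (len j) < length w"
  shows "w ! (off j + Suc (len j)) = 4"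
proof -
  have "Suc j \<noteq> k"
    using assms off_Suc[of j] off_k by auto
  then show ?thesis
    using w_off[of "Suc j"] off_Suc assms(1) by simp
qed

lemma not_separator: "j < k \<Longrightarrow> y < len j \<Longrightarrow> w ! (off j + Suc y) \<noteq> 4"
proof -
  assume j: "j < k" and y: "y < len j"
  have "seg (Q ! j) ! y \<in> {1, 2, 3}"
    using set_seg nth_mem[OF y] by blast
  then show ?thesis
    unfolding w_seg[OF j y] by auto
qed

lemma final_tuple_iff: "bounded x \<Longrightarrow> final_tuple w (pos x) \<longleftrightarrow> (\<forall>j<k. x j = len j)"
proof -
  assume "bounded x"
  have "(Suc (pos x ! j) < length w \<longrightarrow> w ! Suc (pos x ! j) = 4) \<longleftrightarrow> x j = len j" if j: "j < k" for j
  proof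
    assume *: "Suc (pos x ! j) < length w \<longrightarrow> w ! Suc (pos x ! j) = 4"
    show "x j = len j"
    proof (rule ccontr)
      assume "x j \<noteq> len j"
      with \<open>bounded x\<close> j have "x j < len j"
        by (auto simp: bounded_def order.order_iff_strict)
      with * j position_less[of j "Suc (x j)"] not_separator[of j "x j"] show False
        by simp
    qed
  next
    assume "x j = len j"
    with j separator_or_end[of j] show "Suc (pos x ! j) < length w \<longrightarrow> w ! Suc (pos x ! j) = 4"
      by simp
  qed
  then show ?thesis
    by (simp add: final_tuple_def)
qed

lemma move_tuple_iff:
  assumes "bounded x" "bs \<in> tuples (length w) k"
  shows "move_tuple w (pos x) bs \<longleftrightarrow> (\<exists>j<k. x j < len j \<and> bs = pos (x(j := Suc (x j))))"
proof -
  have "(bs = (pos x)[j := Suc (pos x ! j)] \<and> w ! Suc (pos x ! j) \<noteq> 4) \<longleftrightarrow>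
      x j < len j \<and> bs = pos (x(j := Suc (x j)))" if j: "j < k" for j
  proof
    assume *: "bs = (pos x)[j := Suc (pos x ! j)] \<and> w ! Suc (pos x ! j) \<noteq> 4"
    then have "bs ! j = Suc (off j + x j)"
      using j by simp
    \<comment> \<open>Since \<open>bs\<close> consists of positions, the inspected next symbol
      exists; behind the last symbol \<open>w ! Suc (pos x ! j)\<close> would be an unspecified
      value.\<close>
    moreover have "bs ! j < length w"
      using assms(2) j by (auto simp: tuples_def subset_iff)
    ultimately have "x j \<noteq> len j"
      using separator_or_end[of j] * j by auto
    then have "x j < len j"
      using assms(1) j by (auto simp: bounded_def order.order_iff_strict)
    with * j show "x j < len j \<and> bs = pos (x(j := Suc (x j)))"
      by (simp add: pos_upd)
  next
    assume "x j < len j \<and> bs = pos (x(j := Suc (x j)))"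
    with j not_separator[of j "x j"] show "bs = (pos x)[j := Suc (pos x ! j)] \<and> w ! Suc (pos x ! j) \<noteq> 4"
      by (simp add: pos_upd)
  qed
  then show ?thesis
    unfolding move_tuple_def length_pos by blast
qed

section \<open>Bins, their representatives and open pallets\<close>

definition bin :: "nat \<Rightarrow> nat \<Rightarrow> nat" where
  "bin j r = off j + Suc (length (seg (take r (Q ! j))))"

lemma seg_take_less: "r < length q \<Longrightarrow> length (seg (take r q)) < length (seg q)"
  by (subst (2) seg_split) auto

lemma bin_less: "j < k \<Longrightarrow> r < length (Q ! j) \<Longrightarrow> bin j r < length w"
  using position_less[of j "Suc (length (seg (take r (Q ! j))))"] seg_take_less[of r "Q ! j"]
  by (simp add: bin_def Suc_le_eq)

lemma w_bin: "j < k \<Longrightarrow> r < length (Q ! j) \<Longrightarrow> w ! bin j r = 3"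
  using w_seg[of j "length (seg (take r (Q ! j)))"] seg_take_less[of r "Q ! j"] seg_split[of r "Q ! j"]
  unfolding bin_def by (metis nth_append_length)

lemma bin_exists:
  assumes "i < length w" "w ! i = 3"
  obtains j r where "j < k" "r < length (Q ! j)" "i = bin j r"
proof -
  from position_cases[OF assms(1)] obtain j y where jy: "j < k" "y \<le> len j" "i = off j + y"
    using w_param[of i] assms(2) by (auto simp: mod2_eq_if split: if_splits)
  then obtain z where z: "y = Suc z"
    using assms(2) w_off[of j] by (cases y) auto
  then have "seg (Q ! j) ! z = 3"
    using jy assms(2) w_seg[of j z] by auto
  then obtain r where "r < length (Q ! j)" "z = length (seg (take r (Q ! j)))"
    using seg_nth_3[of z "Q ! j"] jy z by auto
  with jy z show ?thesis
    by (intro that[of j r]) (auto simp: bin_def)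
qed

text \<open>The digits of a bin are followed by a 3, by a 4 or by the end of the word, so
  \<open>takeWhile\<close> cuts off exactly the number.\<close>

lemma block_bin:
  assumes "j < k" "r < length (Q ! j)"
  shows "block w (bin j r) = bits (Q ! j ! r)"
proof -
  obtain xs ys where w: "w = xs @ 4 # seg (Q ! j) @ ys" "length xs = off j" "ys = [] \<or> hd ys = 4"
    using w_split[OF assms(1)] .
  let ?zs = "seg (drop (Suc r) (Q ! j)) @ ys"
  have "w = (xs @ 4 # seg (take r (Q ! j)) @ [3]) @ bits (Q ! j ! r) @ ?zs"
    using w(1) seg_split[OF assms(2)] by simp
  then have "drop (Suc (bin j r)) w = bits (Q ! j ! r) @ ?zs"
    using w(2) by (simp add: bin_def)
  moreover have "takeWhile (\<lambda>s. s \<le> 2) ?zs = []"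
    using w(3) by (cases "drop (Suc r) (Q ! j)"; cases ys) auto
  moreover have "\<forall>s\<in>set (bits (Q ! j ! r)). s \<le> 2"
    using set_bits by fastforce
  ultimately show ?thesis
    unfolding block_def by (simp add: takeWhile_append2)
qed

text \<open>The witnessing entry must belong to sequence \<open>j\<close>: entries of earlier
  sequences stand to the left of the bin, and before an entry of a later sequence comes the
  separator of that sequence. \<open>less_cnt\<close> then turns the comparison of positions into
  one of bin counts.\<close>

lemma removed_bin:
  assumes "bounded x" "j < k" "r < length (Q ! j)"
  shows "removed w (pos x) (bin j r) \<longleftrightarrow> r < cnt (Q ! j) (x j)"
proof -
  let ?y = "length (seg (take r (Q ! j)))"
  have y: "?y < len j"
    using seg_take_less[OF assms(3)] .
  have "removed w (pos x) (bin j r) \<longleftrightarrow> ?y < x j"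
  proof
    assume "removed w (pos x) (bin j r)"
    then obtain l where l: "l < k" "bin j r \<le> off l + x l"
      and no: "\<And>u. bin j r < u \<Longrightarrow> u \<le> off l + x l \<Longrightarrow> w ! u \<noteq> 4"
      by (auto simp: removed_def)
    have xl: "x l \<le> len l"
      using assms(1) l(1) by (simp add: bounded_def)
    consider "l < j" | "l = j" | "j < l" by linarith
    then show "?y < x j"
    proof cases
      case 1
      then show ?thesis
        using off_mono[of l j] l xl assms(2) by (simp add: bin_def)
    next
      case 2
      then show ?thesis
        using l by (simp add: bin_def)
    next
      case 3
      then show ?thesis
        using off_mono[of j l] y no[of "off l"] w_off[OF l(1)] l(1) by (simp add: bin_def)
    qed
  next
    assume "?y < x j"
    have "w ! u \<noteq> 4" if u: "bin j r < u" "u \<le> off j + x j" for u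
    proof -
      have u': "u = off j + Suc (u - Suc (off j))"
        using u by (simp add: bin_def)
      have "x j \<le> len j"
        using assms(1,2) by (simp add: bounded_def)
      then have "u - Suc (off j) < len j"
        using u by (auto simp: bin_def)
      with not_separator[OF assms(2)] u' show ?thesis
        by metis
    qed
    with \<open>?y < x j\<close> show "removed w (pos x) (bin j r)"
      unfolding removed_def using assms(2) by (intro exI[of _ j]) (auto simp: bin_def)
  qed
  with less_cnt[OF assms(3)] show ?thesis
    by simp
qed

lemma open_iff:
  "t \<in> open_pallets Q (cfg x) \<longleftrightarrow>
    (\<exists>j<k. \<exists>r<length (Q ! j). \<not> r < cnt (Q ! j) (x j) \<and> Q ! j ! r = t) \<and>
    (\<exists>j<k. \<exists>r<length (Q ! j). r < cnt (Q ! j) (x j) \<and> Q ! j ! r = t)"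
proof -
  have drop: "t \<in> set (drop c q) \<longleftrightarrow> (\<exists>r<length q. \<not> r < c \<and> q ! r = t)" for c and q :: "nat list"
  proof
    assume "t \<in> set (drop c q)"
    then obtain i where "i < length q - c" "q ! (c + i) = t"
      by (auto simp: in_set_conv_nth)
    then show "\<exists>r<length q. \<not> r < c \<and> q ! r = t"
      by (intro exI[of _ "c + i"]) auto
  next
    assume "\<exists>r<length q. \<not> r < c \<and> q ! r = t"
    then obtain r where "r < length q" "c \<le> r" "q ! r = t" by auto
    then show "t \<in> set (drop c q)"
      unfolding in_set_conv_nth by (intro exI[of _ "r - c"]) auto
  qed
  have removed: "t \<in> set (removed_part q (drop c q)) \<longleftrightarrow> (\<exists>r<length q. r < c \<and> q ! r = t)"
    if "c \<le> length q" for c and q :: "nat list"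
    using that by (auto simp: removed_part_def in_set_conv_nth) (metis order.strict_trans2)
  show ?thesis
    by (simp add: open_pallets_def is_open_def length_Q drop removed[OF cnt_le] cong: conj_cong)
qed

text \<open>Reading the number of the bin is a bijection from representatives to open pallets. Of
  two representatives with equal numbers the earlier would disqualify the later; for an open pallet
  the least position of a removed bin is a representative.\<close>

lemma card_opener:
  assumes "bounded x"
  shows "card {s. s < length w \<and> opener w (pos x) s} = card (open_pallets Q (cfg x))"
proof -
  let ?O = "{s. s < length w \<and> opener w (pos x) s}"
  let ?f = "\<lambda>s. val (block w s)"
  have bits: "block w s = bits (?f s)" if "s < length w" "w ! s = 3" for s
    using bin_exists[OF that] block_bin by (metis val_bits)
  have "inj_on ?f ?O"
  proof (rule inj_onI)
    fix s u
    assume su: "s \<in> ?O" "u \<in> ?O" "?f s = ?f u"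
    then have "block w s = block w u"
      using bits[of s] bits[of u] by (simp add: opener_def)
    with su show "s = u"
      unfolding opener_def mem_Collect_eq by (metis linorder_neqE_nat)
  qed
  moreover have "?f ` ?O = open_pallets Q (cfg x)"
  proof (intro equalityI subsetI)
    fix t
    assume "t \<in> ?f ` ?O"
    then obtain s u where s: "s < length w" "w ! s = 3" "removed w (pos x) s" "?f s = t"
      and u: "u < length w" "w ! u = 3" "\<not> removed w (pos x) u" "block w u = block w s"
      by (auto simp: opener_def)
    obtain j r where jr: "j < k" "r < length (Q ! j)" "s = bin j r"
      using bin_exists[OF s(1,2)] .
    obtain j' r' where jr': "j' < k" "r' < length (Q ! j')" "u = bin j' r'"
      using bin_exists[OF u(1,2)] .
    have "Q ! j ! r = t" "Q ! j' ! r' = t"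
      using jr jr' s(4) u(4) by (auto simp: block_bin)
    moreover have "r < cnt (Q ! j) (x j)" "\<not> r' < cnt (Q ! j') (x j')"
      using removed_bin[OF assms] jr jr' s(3) u(3) by auto
    ultimately show "t \<in> open_pallets Q (cfg x)"
      using jr jr' by (auto simp: open_iff)
  next
    fix t
    assume "t \<in> open_pallets Q (cfg x)"
    then obtain j r j' r' where
      jr: "j < k" "r < length (Q ! j)" "r < cnt (Q ! j) (x j)" "Q ! j ! r = t" and
      jr': "j' < k" "r' < length (Q ! j')" "\<not> r' < cnt (Q ! j') (x j')" "Q ! j' ! r' = t"
      by (auto simp: open_iff)
    let ?A = "\<lambda>s. s < length w \<and> w ! s = 3 \<and> removed w (pos x) s \<and> block w s = bits t"
    define s where "s = (LEAST s. ?A s)"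
    have "?A (bin j r)"
      using jr by (auto simp: bin_less w_bin removed_bin[OF assms] block_bin)
    then have s: "?A s"
      unfolding s_def by (rule LeastI[of ?A])
    have least: "\<not> ?A u" if "u < s" for u
      using that unfolding s_def by (rule not_less_Least)
    have "opener w (pos x) s"
      unfolding opener_def
    proof (intro conjI)
      show "\<not> (\<exists>u<s. w ! u = 3 \<and> removed w (pos x) u \<and> block w u = block w s)"
        using s least order.strict_trans by auto
      show "\<exists>u<length w. w ! u = 3 \<and> \<not> removed w (pos x) u \<and> block w u = block w s"
        using s jr' by (intro exI[of _ "bin j' r'"]) (auto simp: bin_less w_bin removed_bin[OF assms] block_bin)
    qed (use s in auto)
    with s show "t \<in> ?f ` ?O"
      by (intro image_eqI[of _ _ s]) auto
  qed
  ultimately show ?thesis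
    by (metis card_image)
qed

section \<open>Paths of tuples and paths of configurations\<close>

abbreviation tuple_steps :: "(nat list \<times> nat list) set" where
  "tuple_steps \<equiv> {(as, bs). as \<in> tuples (length w) k \<and> bs \<in> tuples (length w) k \<and>
     few_open w p bs \<and> move_tuple w as bs}"

abbreviation cfg_steps :: "(nat list list \<times> nat list list) set" where
  "cfg_steps \<equiv> {(c, c'). trans_step c c' \<and> card (open_pallets Q c') \<le> p}"

lemma few_open_iff: "bounded x \<Longrightarrow> few_open w p (pos x) \<longleftrightarrow> card (open_pallets Q (cfg x)) \<le> p"
  by (simp add: few_open_def card_opener)

lemma cfg_0: "cfg (\<lambda>_. 0) = Q"
  by (rule nth_equalityI) (auto simp: length_Q)

lemma cfg_upd: "j < k \<Longrightarrow> cfg (x(j := y)) = (cfg x)[j := drop (cnt (Q ! j) y) (Q ! j)]"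
  by (rule nth_equalityI) (auto simp: nth_list_update)

lemma cfg_step:
  assumes "j < k"
  shows "cfg (x(j := Suc (x j))) = cfg x \<or> trans_step (cfg x) (cfg (x(j := Suc (x j))))"
  using cnt_Suc[of "Q ! j" "x j"]
proof
  assume "cnt (Q ! j) (Suc (x j)) = cnt (Q ! j) (x j)"
  then have "cfg (x(j := Suc (x j))) = cfg x"
    using assms by (simp add: cfg_upd list_update_same_conv)
  then show ?thesis ..
next
  assume Suc: "cnt (Q ! j) (Suc (x j)) = Suc (cnt (Q ! j) (x j))"
  then have "cfg x ! j \<noteq> []"
    using cnt_le[of "Q ! j" "Suc (x j)"] assms by simp
  moreover have "cfg (x(j := Suc (x j))) = (cfg x)[j := tl (cfg x ! j)]"
    using assms Suc by (simp add: cfg_upd drop_Suc tl_drop)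
  ultimately have "trans_step (cfg x) (cfg (x(j := Suc (x j))))"
    using assms by (auto simp: trans_step_def)
  then show ?thesis ..
qed

text \<open>Each move of an entry either leaves the configuration as it is or removes one bin, so
  the path of configurations arises by dropping repetitions.\<close>

lemma tuple_path_imp_cfg_path:
  assumes "(pos (\<lambda>_. 0), bs) \<in> tuple_steps\<^sup>*"
  shows "\<exists>x. bounded x \<and> bs = pos x \<and> (Q, cfg x) \<in> cfg_steps\<^sup>*"
  using assms
proof (induction rule: rtrancl_induct)
  case base
  then show ?case
    by (intro exI[of _ "\<lambda>_. 0"]) (simp add: bounded_def cfg_0)
next
  case (step as bs)
  then obtain x where x: "bounded x" "as = pos x" "(Q, cfg x) \<in> cfg_steps\<^sup>*"
    by blast
  from step(2) have bs: "bs \<in> tuples (length w) k" "few_open w p bs" "move_tuple w (pos x) bs"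
    using x(2) by auto
  then obtain j where j: "j < k" "x j < len j" "bs = pos (x(j := Suc (x j)))"
    using move_tuple_iff[OF x(1)] by blast
  have bounded: "bounded (x(j := Suc (x j)))"
    using x(1) j by (auto simp: bounded_def)
  then have "card (open_pallets Q (cfg (x(j := Suc (x j))))) \<le> p"
    using few_open_iff bs(2) j(3) by simp
  then have "(Q, cfg (x(j := Suc (x j)))) \<in> cfg_steps\<^sup>*"
    using cfg_step[OF j(1), of x] x(3) by (auto intro: rtrancl_into_rtrancl)
  with bounded j(3) show ?case by blast
qed

text \<open>Normal form of a tuple: in sequence \<open>j\<close> the codes of the first
  \<open>rs j\<close> bins are consumed completely and the next one is untouched.\<close>

definition code_starts :: "(nat \<Rightarrow> nat) \<Rightarrow> nat \<Rightarrow> nat" where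
  "code_starts rs j = length (seg (take (rs j) (Q ! j)))"

lemma bounded_code_starts: "bounded (code_starts rs)"
proof -
  have "length (seg (take r q)) \<le> length (seg q)" for r q
    by (metis append_take_drop_id le_add1 length_append seg_simps(3))
  then show ?thesis
    by (simp add: bounded_def code_starts_def)
qed

lemma cfg_code_starts:
  assumes "\<And>j. j < k \<Longrightarrow> rs j \<le> length (Q ! j)"
  shows "cfg (code_starts rs) = map (\<lambda>j. drop (rs j) (Q ! j)) [0..<k]"
  using assms by (auto simp: cfg_def code_starts_def cnt_code_start)

text \<open>The removal of one bin is imitated by walking through its whole code, from one normal
  form to the next.\<close>

lemma cfg_path_imp_tuple_path:
  assumes "(Q, c) \<in> cfg_steps\<^sup>*"
  shows "\<exists>rs. (\<forall>j<k. rs j \<le> length (Q ! j)) \<and> c = cfg (code_starts rs) \<and>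
    (pos (\<lambda>_. 0), pos (code_starts rs)) \<in> tuple_steps\<^sup>*"
  using assms
proof (induction rule: rtrancl_induct)
  case base
  have "code_starts (\<lambda>_. 0) = (\<lambda>_. 0)"
    by (auto simp: code_starts_def)
  then show ?case
    by (intro exI[of _ "\<lambda>_. 0"]) (simp add: cfg_0)
next
  case (step c c')
  then obtain rs where rs: "\<And>j. j < k \<Longrightarrow> rs j \<le> length (Q ! j)" and c: "c = cfg (code_starts rs)"
    and path: "(pos (\<lambda>_. 0), pos (code_starts rs)) \<in> tuple_steps\<^sup>*"
    by blast
  let ?x = "code_starts rs"
  from step(2) obtain i where i: "i < k" "c ! i \<noteq> []" "c' = c[i := tl (c ! i)]"
    and few: "card (open_pallets Q c') \<le> p"
    using c by (auto simp: trans_step_def)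
  have ci: "c ! i = drop (rs i) (Q ! i)"
    using c i(1) rs by (simp add: cfg_code_starts)
  with i(2) have ri: "rs i < length (Q ! i)"
    by simp
  let ?y = "length (seg (take (Suc (rs i)) (Q ! i)))"
  have c'_eq: "c' = c[i := drop (Suc (rs i)) (Q ! i)]"
    using i(3) ci by (simp add: drop_Suc tl_drop)
  \<comment> \<open>From the separator of the bin to its last digit every tuple represents the same
    configuration \<open>c'\<close>, so the single bound on \<open>c'\<close> covers the whole
    walk.\<close>
  have c': "cfg (?x(i := y)) = c'" if "?x i < y" "y \<le> ?y" for y
    using cnt_between[OF ri, of y] that i(1) unfolding c'_eq c
    by (simp add: cfg_upd code_starts_def)
  have le: "?y \<le> len i"
    using length_seg_take_mono[of "Suc (rs i)" "length (Q ! i)" "Q ! i"] ri by simp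
  have bounded: "bounded (?x(i := y))" if "y \<le> ?y" for y
    using bounded_code_starts[of rs] le that by (auto simp: bounded_def)
  have start: "?x i \<le> ?y"
    using length_seg_take_mono[of "rs i" "Suc (rs i)" "Q ! i"] by (simp add: code_starts_def)
  have "(pos (\<lambda>_. 0), pos (?x(i := y))) \<in> tuple_steps\<^sup>*" if "?x i \<le> y" "y \<le> ?y" for y
    using that
  proof (induction y rule: dec_induct)
    case base
    then show ?case using path by simp
  next
    case (step y)
    have "few_open w p (pos (?x(i := Suc y)))"
      using few_open_iff[OF bounded[of "Suc y"]] c'[of "Suc y"] few step by simp
    moreover have "move_tuple w (pos (?x(i := y))) (pos (?x(i := Suc y)))"
      using move_tuple_iff[OF bounded[of y] pos_tuples[OF bounded[of "Suc y"]]] step i(1) le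
      by (auto intro!: exI[of _ i])
    ultimately have "(pos (?x(i := y)), pos (?x(i := Suc y))) \<in> tuple_steps"
      using pos_tuples[OF bounded[of y]] pos_tuples[OF bounded[of "Suc y"]] step by simp
    moreover have "(pos (\<lambda>_. 0), pos (?x(i := y))) \<in> tuple_steps\<^sup>*"
      by (rule step.IH) (use step in simp)
    ultimately show ?case
      by (rule rtrancl_into_rtrancl[rotated])
  qed
  from this[OF start order_refl] have walk: "(pos (\<lambda>_. 0), pos (?x(i := ?y))) \<in> tuple_steps\<^sup>*" .
  define rs' where "rs' = rs(i := Suc (rs i))"
  have "?x i < ?y"
    using ri by (simp add: code_starts_def take_Suc_conv_app_nth)
  from c'[OF this order_refl] have "c' = cfg (?x(i := ?y))" ..
  moreover have "?x(i := ?y) = code_starts rs'"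
    by (auto simp: rs'_def code_starts_def fun_eq_iff)
  moreover have "\<forall>j<k. rs' j \<le> length (Q ! j)"
    using rs ri by (auto simp: rs'_def)
  ultimately show ?case
    using walk by (intro exI[of _ rs']) simp
qed

lemma code_starts_exhausted:
  assumes "\<And>j. j < k \<Longrightarrow> rs j \<le> length (Q ! j)"
    "cfg (code_starts rs) = map (\<lambda>_. []) Q" "j < k"
  shows "code_starts rs j = len j"
proof -
  have "drop (rs j) (Q ! j) = []"
    using arg_cong[OF assms(2), of "\<lambda>c. c ! j"] assms(1,3) by (simp add: cfg_code_starts length_Q)
  then show ?thesis
    using assms by (simp add: code_starts_def)
qed

theorem sem_Problem_iff:
  "sem (word_tracks w) (length w) 0 e (Problem k) \<longleftrightarrow> has_processing Q p"
proof -
  have "off 0 > 0"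
    by (simp add: off_0)
  \<comment> \<open>The word begins with a digit of the parameter, as a binary number has at least
    one digit.\<close>
  then have "w ! 0 \<noteq> 3"
    using w_param[of 0] by (simp add: mod2_eq_if)
  moreover have "off 0 < length w"
    using position_less[of 0 0] k by simp
  moreover have "p < 2 ^ off 0"
    using less_bits by (simp add: off_0)
  ultimately have sem: "sem (word_tracks w) (length w) 0 e (Problem k) \<longleftrightarrow>
    (\<exists>as\<in>tuples (length w) k. \<exists>bs\<in>tuples (length w) k. start_tuple w as \<and>
       (as, bs) \<in> tuple_steps\<^sup>* \<and> final_tuple w bs)"
    using sem_Problem[OF symbols, where L = "off 0" and p = p and k = k and e = e] w_off[of 0] w_param k by simp
  have start: "pos (\<lambda>_. 0) \<in> tuples (length w) k" "start_tuple w (pos (\<lambda>_. 0))"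
    using pos_tuples[of "\<lambda>_. 0"] start_tuple_iff by (auto simp: bounded_def)
  show ?thesis
    unfolding sem has_processing_iff
  proof
    assume "\<exists>as\<in>tuples (length w) k. \<exists>bs\<in>tuples (length w) k. start_tuple w as \<and>
       (as, bs) \<in> tuple_steps\<^sup>* \<and> final_tuple w bs"
    then obtain bs where "(pos (\<lambda>_. 0), bs) \<in> tuple_steps\<^sup>*" "final_tuple w bs"
      using start_tuple_iff by blast
    then obtain x where x: "bounded x" "(Q, cfg x) \<in> cfg_steps\<^sup>*" "final_tuple w (pos x)"
      using tuple_path_imp_cfg_path by blast
    then have "cfg x = map (\<lambda>_. []) Q"
      by (intro nth_equalityI) (auto simp: final_tuple_iff length_Q cnt_all)
    with x(2) show "(Q, map (\<lambda>_. []) Q) \<in> cfg_steps\<^sup>*"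
      by simp
  next
    assume "(Q, map (\<lambda>_. []) Q) \<in> cfg_steps\<^sup>*"
    from cfg_path_imp_tuple_path[OF this]
    obtain rs where rs: "\<forall>j<k. rs j \<le> length (Q ! j)" "map (\<lambda>_. []) Q = cfg (code_starts rs)"
      and path: "(pos (\<lambda>_. 0), pos (code_starts rs)) \<in> tuple_steps\<^sup>*"
      by blast
    have "code_starts rs j = len j" if "j < k" for j
      using code_starts_exhausted[of rs j] rs that by simp
    then have "final_tuple w (pos (code_starts rs))"
      using final_tuple_iff[OF bounded_code_starts] by simp
    with start path pos_tuples[OF bounded_code_starts]
    show "\<exists>as\<in>tuples (length w) k. \<exists>bs\<in>tuples (length w) k. start_tuple w as \<and>
       (as, bs) \<in> tuple_steps\<^sup>* \<and> final_tuple w bs"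
      by blast
  qed
qed

end

theorem theorem7:
  fixes k :: nat
  assumes "0 < k"
  shows "\<exists>M c d. valid_tm M \<and>
           (\<forall>Q p. valid_instance k Q \<and> 0 < p \<longrightarrow>
              decides_within M (encode Q p) (c * (length (encode Q p) + 1) ^ d)
                (has_processing Q p))"
proof -
  obtain M c d where M: "valid_tm M" and decides: "\<And>w. set w \<subseteq> {1, 2, 3, 4} \<Longrightarrow>
     decides_within M w (c * (length w + 1) ^ d) (sem (word_tracks w) (length w) 0 (\<lambda>v. 0) (Problem k))"
    using sentence_decidable[of "Problem k"] by blast
  have "decides_within M (encode Q p) (c * (length (encode Q p) + 1) ^ d) (has_processing Q p)"
    if "valid_instance k Q" for Q p
  proof -
    interpret stack_up k Q p
      using that assms by unfold_locales (auto simp: valid_instance_def)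
    show ?thesis
      using decides[OF symbols] unfolding sem_Problem_iff unfolding w_def .
  qed
  with M show ?thesis by blast
qed

end
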